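(* If $N:\mathbb{R}^n\to\mathbb{R}_+$ is a strictly convex norm that is $C^2$-smooth, then the Wasserstein space $\mathcal{W}_p(\mathbb{R}^n,d_N)$ is isometrically rigid for all $p\in[1,\infty)$, $p\neq 2$.
   Context: $\mathbb{R}_+=[0,\infty)$ and $d_N(x,y)=N(x-y)$. The norm $N$ is strictly convex if $N(\tfrac{x+y}{2})<1$ whenever $N(x)=N(y)=1$, $x\ne y$. The norm $N$ is called $C^2$-smooth if at any point $x\in\mathbb{R}^n\setminus\{0\}$, $N$ is (at least) twice differentiable at $x$. For a complete separable metric space $(X,d_X)$ and $p\ge 1$, $\mathcal{W}_p(X,d_X)$ is the set of Borel probability measures $\mu$ on $X$ with $\int_X d_X^p(x,x_0)\,d\mu(x)<\infty$ for some (hence any) $x_0\in X$, equipped with the distance $d_{\mathcal{W}_p}(\mu,\nu)=\inf_{\pi\in\Pi(\mu,\nu)}\left(\iint_{X\times X} d_X^p(x,y)\,d\pi(x,y)\right)^{1/p}$, where $\Pi(\mu,\nu)$ is the set of couplings of $\mu$ and $\nu$. An isometry is a distance-preserving bijection of a metric space onto itself. For a map $\phi$, the push-forward is $\phi_{\#}\mu(A)=\mu(\phi^{-1}(A))$. If $\phi$ is an isometry of $(X,d_X)$, then $\phi_\#$ is an isometry of $\mathcal{W}_p(X,d_X)$; isometries of $\mathcal{W}_p(X,d_X)$ of this form are called trivial. $\mathcal{W}_p(X,d_X)$ is isometrically rigid if all of its isometries are trivial, i.e. every isometry $\Phi$ of $\mathcal{W}_p(X,d_X)$ equals $\phi_\#$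 for some isometry $\phi$ of $(X,d_X)$. *)

theory Defs
  imports "HOL-Probability.Probability"
begin

section \<open>Norms\<close>

definition is_norm :: "('a::real_vector \<Rightarrow> real) \<Rightarrow> bool" where
  "is_norm N \<longleftrightarrow>
     (\<forall>x. 0 \<le> N x) \<and>
     (\<forall>x. N x = 0 \<longleftrightarrow> x = 0) \<and>
     (\<forall>a x. N (a *\<^sub>R x) = \<bar>a\<bar> * N x) \<and>
     (\<forall>x y. N (x + y) \<le> N x + N y)"

definition norm_dist :: "('a::real_vector \<Rightarrow> real) \<Rightarrow> 'a \<Rightarrow> 'a \<Rightarrow> real" where
  "norm_dist N x y = N (x - y)"

definition strictly_convex_norm :: "('a::real_vector \<Rightarrow> real) \<Rightarrow> bool" where
  "strictly_convex_norm N \<longleftrightarrow>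
     (\<forall>x y. N x = 1 \<and> N y = 1 \<and> x \<noteq> y \<longrightarrow> N ((1/2) *\<^sub>R (x + y)) < 1)"

text \<open>
  Frechet derivatives are taken as elements of the space of bounded linear maps, with the
  operator norm. The first derivative has to exist near the point for the second one to make sense.
\<close>

definition twice_differentiable_at ::
    "('a::real_normed_vector \<Rightarrow> 'b::real_normed_vector) \<Rightarrow> 'a \<Rightarrow> bool" where
  "twice_differentiable_at f x \<longleftrightarrow>
     (\<exists>f' :: 'a \<Rightarrow> 'a \<Rightarrow>\<^sub>L 'b.
        (\<forall>\<^sub>F y in nhds x. (f has_derivative blinfun_apply (f' y)) (at y)) \<and>
        f' differentiable (at x))"

text \<open>Twice differentiability away from the origin; continuity of the second derivative is not required.\<close>

definition C2_smooth_norm :: "('a::real_normed_vector \<Rightarrow> real) \<Rightarrow> bool" where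
  "C2_smooth_norm N \<longleftrightarrow> (\<forall>x. x \<noteq> 0 \<longrightarrow> twice_differentiable_at N x)"


section \<open>Wasserstein spaces\<close>

text \<open>
  The definitions below are meant for a complete separable metric space with carrier \<open>X\<close>, distance
  \<open>d\<close>, and for \<open>p \<ge> 1\<close>.
\<close>

definition metric_borel :: "'a set \<Rightarrow> ('a \<Rightarrow> 'a \<Rightarrow> real) \<Rightarrow> 'a measure" where
  "metric_borel X d = sigma X {U. openin (Metric_space.mtopology X d) U}"

definition wasserstein_space ::
    "real \<Rightarrow> 'a set \<Rightarrow> ('a \<Rightarrow> 'a \<Rightarrow> real) \<Rightarrow> 'a measure set" where
  "wasserstein_space p X d =
     {\<mu>. prob_space \<mu> \<and> sets \<mu> = sets (metric_borel X d) \<and>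
          (\<exists>x0\<in>X. (\<integral>\<^sup>+x. ennreal (d x x0 powr p) \<partial>\<mu>) < \<infinity>)}"

definition couplings ::
    "'a set \<Rightarrow> ('a \<Rightarrow> 'a \<Rightarrow> real) \<Rightarrow> 'a measure \<Rightarrow> 'a measure \<Rightarrow> ('a \<times> 'a) measure set" where
  "couplings X d \<mu> \<nu> =
     {\<pi>. prob_space \<pi> \<and> sets \<pi> = sets (metric_borel X d \<Otimes>\<^sub>M metric_borel X d) \<and>
          distr \<pi> (metric_borel X d) fst = \<mu> \<and> distr \<pi> (metric_borel X d) snd = \<nu>}"

text \<open>
  For \<open>\<mu>\<close> and \<open>\<nu>\<close> in the Wasserstein space the cost is integrable against every coupling (by the
  triangle inequality and the moment conditions), so the convention that the Bochner integral of a
  non-integrable function is 0 plays no role; and the set of couplings contains the product measure.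
\<close>

definition wasserstein_dist ::
    "real \<Rightarrow> 'a set \<Rightarrow> ('a \<Rightarrow> 'a \<Rightarrow> real) \<Rightarrow> 'a measure \<Rightarrow> 'a measure \<Rightarrow> real" where
  "wasserstein_dist p X d \<mu> \<nu> =
     (INF \<pi>\<in>couplings X d \<mu> \<nu>. (\<integral>z. d (fst z) (snd z) powr p \<partial>\<pi>) powr (1 / p))"


section \<open>Isometric rigidity\<close>

definition isometry_of :: "'a set \<Rightarrow> ('a \<Rightarrow> 'a \<Rightarrow> real) \<Rightarrow> ('a \<Rightarrow> 'a) \<Rightarrow> bool" where
  "isometry_of X d f \<longleftrightarrow> bij_betw f X X \<and> (\<forall>x\<in>X. \<forall>y\<in>X. d (f x) (f y) = d x y)"

definition isometrically_rigid :: "real \<Rightarrow> 'a set \<Rightarrow> ('a \<Rightarrow> 'a \<Rightarrow> real) \<Rightarrow> bool" where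
  "isometrically_rigid p X d \<longleftrightarrow>
     (\<forall>\<Phi>. isometry_of (wasserstein_space p X d) (wasserstein_dist p X d) \<Phi> \<longrightarrow>
        (\<exists>\<phi>. isometry_of X d \<phi> \<and>
           (\<forall>\<mu>\<in>wasserstein_space p X d. \<Phi> \<mu> = distr \<mu> (metric_borel X d) \<phi>)))"

end

theory Submission
  imports Defs
begin

text \<open>
  Write \<open>h = N powr p\<close>. An isometry permutes the Dirac measures, because these are the measures from which
  every geodesic can be doubled; after composing with the induced isometry of the base space it fixes
  them, hence it preserves all potentials \<open>x \<mapsto> \<integral> h (y - x) d\<mu>(y)\<close>. For \<open>p = 1\<close> the singularity of the
  potential at \<open>x\<close> shows the mass of the atom at \<open>x\<close>, so finitely supported measures are fixed, and these are dense.

  For \<open>p > 1\<close> it suffices to fix the two-point measures, since the distances to them determine the laws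
  of the functions \<open>z \<mapsto> h (z - b) - h (z - a)\<close>. By Fubini's theorem the relation ``the product
  coupling is optimal'' is invariant; it relates a two-point measure to the measures living on a level
  set of such a function, and the shape of these level sets at infinity shows the direction of the
  two-point measure. Together with the second moments with respect to the quadratic forms \<open>h''(v)\<close>, which
  are read off from the potential at infinity, this shows that the image of a two-point measure of
  direction \<open>e\<close> lives on a line of some direction \<open>f\<close> with \<open>h''(v)(e, e) = h''(v)(f, f)\<close> for all \<open>v\<close>.
  If \<open>f = e\<close> or \<open>f = - e\<close>, then a double-well function combining the \<open>p\<close>-th and the second moment, available
  because \<open>p \<noteq> 2\<close>, fixes the measure. Otherwise \<open>h\<close> splits along \<open>e + f\<close> and \<open>e - f\<close>, and the measure would
  have to be symmetric.
\<close>

subsection \<open>Power costs and couplings\<close>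

text \<open>For p > 1 the potentials alone are weak information: if \<open>h\<close> is a
  polynomial, say the fourth power of the Euclidean norm, the potential of a measure encodes only
  finitely many of its moments. This is why a second invariant is needed. Optimality of the product
  coupling serves because it is a condition on supports: it makes differences of the cost constant
  on them, so it passes from an image measure to any two points of its support and can then be
  pulled back.

  The genuine obstacle is a cost that splits on a plane as \<open>|x|^p + |y|^p\<close> up to
  constants. Its potential in that plane sees only the two marginals, so symmetric two-point
  measures on the two diagonals have equal potentials there. Hence the weight 1/2 is excluded from
  the test measures; an asymmetric weight prevents the exchange of the diagonals.

  Existence of optimal couplings is never invoked. Upper bounds for \<open>C\<close> come from
  explicit couplings, lower bounds from estimates valid for each coupling. For distances to
  two-point measures the two sides meet only in the limit of a parameter \<open>s < 1\<close>
  tending to 1.\<close>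

lemma Bernoulli_powr_less:
  fixes u q :: real
  assumes "1 < q" "0 \<le> u" "u \<noteq> 1"
  shows "1 + q * (u - 1) < u powr q"
proof (cases "1 + q * (u - 1) \<le> 0")
  case True
  show ?thesis
  proof (cases "u = 0")
    case True with assms show ?thesis by simp
  next
    case False with assms have "0 < u powr q" by simp
    with True show ?thesis by linarith
  qed
next
  case False
  define w where "w = 1 + q * (u - 1)"
  have w: "0 < w" using False by (simp add: w_def)
  have u: "0 < u" using assms False by (cases "u = 0") auto
  \<comment> \<open>The tangent bound for \<open>ln\<close> at \<open>w / u\<close> and, strictly,
    at \<open>1 / u\<close> is added with weights 1 and \<open>q - 1\<close>; by the choice of
    \<open>w\<close> the right-hand sides cancel.\<close>
  have "ln (w / u) \<le> w / u - 1" using w u by (intro ln_le_minus_one) simp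
  hence 1: "ln w - ln u \<le> w / u - 1" using w u by (simp add: ln_div)
  have "ln (1 / u) \<noteq> 1 / u - 1" using ln_eq_minus_one[of "1/u"] u assms by auto
  moreover have "ln (1 / u) \<le> 1 / u - 1" using u by (intro ln_le_minus_one) simp
  ultimately have 2: "- ln u < 1 / u - 1" using u by (simp add: ln_div)
  have "(ln w - ln u) + (q - 1) * (- ln u) < (w / u - 1) + (q - 1) * (1 / u - 1)"
    using 1 2 assms by (intro add_le_less_mono mult_strict_left_mono) auto
  also have "\<dots> = 0" using u by (simp add: w_def field_simps)
  finally have "ln w < q * ln u" by (simp add: algebra_simps)
  hence "w < exp (q * ln u)" using w by (metis exp_less_mono exp_ln)
  thus ?thesis using u by (simp add: powr_def w_def)
qed

lemma Bernoulli_powr_le: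
  fixes u q :: real
  assumes "1 \<le> q" "0 \<le> u"
  shows "1 + q * (u - 1) \<le> u powr q"
proof (cases "q = 1 \<or> u = 1")
  case False
  with Bernoulli_powr_less[of q u] assms show ?thesis by simp
qed (use assms in auto)

text \<open>The case of an exponent above 1, applied to \<open>u powr q\<close> with exponent
  \<open>1 / q\<close>. The reversed sign for exponents below 1 is what makes
  \<open>double_well\<close> work on either side of \<open>p = 2\<close>.\<close>

lemma Bernoulli_powr_greater:
  fixes u q :: real
  assumes "0 < q" "q < 1" "0 \<le> u" "u \<noteq> 1"
  shows "u powr q < 1 + q * (u - 1)"
proof -
  have "u powr q \<noteq> 1" using assms by (cases "u = 0") (auto simp: powr_eq_one_iff_gen)
  hence "1 + (1/q) * (u powr q - 1) < (u powr q) powr (1/q)"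
    using assms by (intro Bernoulli_powr_less) auto
  also have "\<dots> = u" using assms by (simp add: powr_powr)
  finally show ?thesis using assms by (simp add: field_simps)
qed

text \<open>Bernoulli at \<open>s / m\<close> and \<open>t / m\<close> is the tangent of the power
  at the mean \<open>m\<close>; in the weighted sum the linear terms cancel.\<close>

lemma powr_convex_comb:
  fixes s t l q :: real
  assumes "1 \<le> q" "0 \<le> s" "0 \<le> t" "0 \<le> l" "l \<le> 1"
  shows "((1 - l) * s + l * t) powr q \<le> (1 - l) * s powr q + l * t powr q"
proof (cases "(1 - l) * s + l * t = 0")
  case True then show ?thesis using assms by simp
next
  case False
  define m where "m = (1 - l) * s + l * t"
  have m: "0 < m" using False assms by (simp add: m_def less_le)
  have "m powr q * (1 + q * (s / m - 1)) \<le> m powr q * (s / m) powr q"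
       "m powr q * (1 + q * (t / m - 1)) \<le> m powr q * (t / m) powr q"
    using assms m by (auto intro!: mult_left_mono Bernoulli_powr_le)
  hence a: "m powr q * (1 + q * (s / m - 1)) \<le> s powr q"
        "m powr q * (1 + q * (t / m - 1)) \<le> t powr q"
    using m assms by (auto simp: powr_divide)
  have "(1 - l) * (m powr q * (1 + q * (s / m - 1))) + l * (m powr q * (1 + q * (t / m - 1)))
     \<le> (1 - l) * s powr q + l * t powr q"
    using a assms by (intro add_mono mult_left_mono) auto
  moreover have "(1 - l) * (m powr q * (1 + q * (s / m - 1))) + l * (m powr q * (1 + q * (t / m - 1)))
     = m powr q * (1 + q * (m / m - 1))"
    by (simp add: m_def[symmetric] field_simps) (simp add: m_def algebra_simps)
  ultimately show ?thesis using m by (simp add: m_def)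
qed

lemma powr_midpoint_less:
  fixes s t q :: real
  assumes "1 < q" "0 \<le> s" "0 \<le> t" "s \<noteq> t"
  shows "((s + t) / 2) powr q < (s powr q + t powr q) / 2"
proof -
  define m where "m = (s + t) / 2"
  have m: "0 < m" using assms by (auto simp: m_def)
  have "s / m \<noteq> 1" "t / m \<noteq> 1" using assms m by (auto simp: m_def)
  hence "m powr q * (1 + q * (s / m - 1)) < m powr q * (s / m) powr q"
       "m powr q * (1 + q * (t / m - 1)) < m powr q * (t / m) powr q"
    using assms m by (auto intro!: mult_strict_left_mono Bernoulli_powr_less)
  hence a: "m powr q * (1 + q * (s / m - 1)) < s powr q"
        "m powr q * (1 + q * (t / m - 1)) < t powr q"
    using m assms by (auto simp: powr_divide)
  have "m powr q * (1 + q * (s / m - 1)) + m powr q * (1 + q * (t / m - 1))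
     = m powr q * (2 + q * ((s + t) / m - 2))" by (simp add: algebra_simps add_divide_distrib)
  also have "(s + t) / m = 2" using m by (simp add: m_def field_simps)
  finally show ?thesis using a m by (simp add: m_def)
qed

section \<open>A norm and its p-th power as a cost\<close>

locale power_cost =
  fixes N :: "'a::euclidean_space \<Rightarrow> real" and p :: real
  assumes norm: "is_norm N" and p1: "1 \<le> p"
begin

lemma N_nonneg [simp]: "0 \<le> N x" and N_eq_0 [simp]: "N x = 0 \<longleftrightarrow> x = 0"
  and N_scale: "N (a *\<^sub>R x) = \<bar>a\<bar> * N x" and N_triangle: "N (x + y) \<le> N x + N y"
  using norm by (auto simp: is_norm_def)

lemma N_0 [simp]: "N 0 = 0" by simp

lemma N_minus [simp]: "N (- x) = N x"
  using N_scale[of "-1" x] by simp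

lemma N_diff_commute: "N (x - y) = N (y - x)"
  using N_minus[of "x - y"] by simp

lemma N_pos [simp]: "0 < N x \<longleftrightarrow> x \<noteq> 0"
  using N_nonneg[of x] N_eq_0[of x] by linarith

lemma N_triangle_diff: "\<bar>N x - N y\<bar> \<le> N (x - y)"
  using N_triangle[of "x - y" y] N_triangle[of "y - x" x] by (simp add: N_diff_commute abs_le_iff)

lemma N_upper: "\<exists>K>0. \<forall>x. N x \<le> K * norm x"
proof (intro exI conjI allI)
  show "0 < 1 + (\<Sum>b\<in>Basis. N b)" by (intro add_pos_nonneg sum_nonneg) auto
  fix x :: 'a
  have *: "N (\<Sum>b\<in>A. (x \<bullet> b) *\<^sub>R b) \<le> (\<Sum>b\<in>A. N ((x \<bullet> b) *\<^sub>R b))" if "finite A" for A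
    using that
  proof (induction A)
    case (insert a A)
    have "N ((x \<bullet> a) *\<^sub>R a + (\<Sum>b\<in>A. (x \<bullet> b) *\<^sub>R b)) \<le> N ((x \<bullet> a) *\<^sub>R a) + N (\<Sum>b\<in>A. (x \<bullet> b) *\<^sub>R b)"
      by (rule N_triangle)
    with insert show ?case by simp
  qed simp
  have "N x = N (\<Sum>b\<in>Basis. (x \<bullet> b) *\<^sub>R b)" by (simp add: euclidean_representation)
  also have "\<dots> \<le> (\<Sum>b\<in>Basis. \<bar>x \<bullet> b\<bar> * N b)" using *[of Basis] by (simp add: N_scale)
  also have "\<dots> \<le> (\<Sum>b\<in>Basis. norm x * N b)"
    by (intro sum_mono mult_right_mono) (auto simp: Basis_le_norm)
  also have "\<dots> \<le> (1 + (\<Sum>b\<in>Basis. N b)) * norm x"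
    by (simp add: sum_distrib_left algebra_simps)
  finally show "N x \<le> (1 + (\<Sum>b\<in>Basis. N b)) * norm x" .
qed

lemma N_isCont: "isCont N x"
proof -
  obtain K where K: "K > 0" "\<And>x. N x \<le> K * norm x" using N_upper by blast
  have "\<exists>d>0. \<forall>x'. norm (x' - x) < d \<longrightarrow> norm (N x' - N x) < e" if "e > 0" for e
  proof (intro exI[of _ "e / K"] conjI allI impI)
    fix x' assume "norm (x' - x) < e / K"
    hence "K * norm (x' - x) < e" using K by (simp add: field_simps)
    thus "norm (N x' - N x) < e" using N_triangle_diff[of x' x] K(2)[of "x' - x"] by simp
  qed (use K \<open>e > 0\<close> in simp)
  thus ?thesis by (auto simp: continuous_at_eps_delta dist_norm)
qed

lemma N_continuous_on: "continuous_on S N"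
  by (simp add: N_isCont continuous_at_imp_continuous_on)

lemma N_lower: "\<exists>k>0. \<forall>x. k * norm x \<le> N x"
proof (cases "sphere (0::'a) 1 = {}")
  case True
  then have "\<And>x::'a. x = 0" by (metis dist_0_norm empty_iff mem_sphere norm_sgn)
  thus ?thesis by (metis N_nonneg mult_zero_right norm_zero zero_less_one)
next
  case False
  obtain z where z: "z \<in> sphere 0 1" "\<And>y. y \<in> sphere 0 1 \<Longrightarrow> N z \<le> N y"
    using continuous_attains_inf[OF _ False N_continuous_on] by auto
  have "N z * norm x \<le> N x" for x
  proof (cases "x = 0")
    case False
    have "N z \<le> N ((1 / norm x) *\<^sub>R x)" using False by (intro z) auto
    also have "\<dots> = N x / norm x" by (simp add: N_scale)
    finally show ?thesis using False by (simp add: field_simps)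
  qed simp
  moreover have "z \<noteq> 0" using z by auto
  ultimately show ?thesis using N_pos by blast
qed

definition h :: "'a \<Rightarrow> real" where "h x = N x powr p"

lemma h_nonneg [simp]: "0 \<le> h x" by (simp add: h_def)
lemma h_0 [simp]: "h 0 = 0" by (simp add: h_def)
lemma h_eq_0 [simp]: "h x = 0 \<longleftrightarrow> x = 0" by (simp add: h_def)
lemma h_pos [simp]: "0 < h x \<longleftrightarrow> x \<noteq> 0" by (simp add: less_le)
lemma h_minus [simp]: "h (- x) = h x" by (simp add: h_def)
lemma h_diff_commute: "h (x - y) = h (y - x)" by (simp add: h_def N_diff_commute)
lemma h_scale: "h (a *\<^sub>R x) = \<bar>a\<bar> powr p * h x" by (simp add: h_def N_scale powr_mult)

lemma h_isCont: "isCont h x"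
proof -
  have "isCont (\<lambda>x. N x powr p) x"
    unfolding isCont_def using N_isCont[of x] p1
    by (intro tendsto_powr') (auto simp: isCont_def)
  thus ?thesis by (simp add: h_def[abs_def])
qed

lemma h_continuous_on: "continuous_on S h"
  by (simp add: h_isCont continuous_at_imp_continuous_on)

lemma h_continuous_on_comp: "continuous_on S f \<Longrightarrow> continuous_on S (\<lambda>x. h (f x))"
  using continuous_on_compose2[OF h_continuous_on[of UNIV]] by auto

lemma h_tendsto: "(f \<longlongrightarrow> a) F \<Longrightarrow> ((\<lambda>x. h (f x)) \<longlongrightarrow> h a) F"
  using h_isCont isCont_tendsto_compose by blast

lemma h_measurable [measurable]: "h \<in> borel_measurable borel"
  by (intro borel_measurable_continuous_onI h_continuous_on)

lemma N_measurable [measurable]: "N \<in> borel_measurable borel"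
  by (intro borel_measurable_continuous_onI N_continuous_on)

lemma h_convex: "0 \<le> t \<Longrightarrow> t \<le> 1 \<Longrightarrow> h ((1 - t) *\<^sub>R x + t *\<^sub>R y) \<le> (1 - t) * h x + t * h y"
proof -
  assume t: "0 \<le> t" "t \<le> 1"
  have "N ((1 - t) *\<^sub>R x + t *\<^sub>R y) \<le> (1 - t) * N x + t * N y"
    using N_triangle[of "(1 - t) *\<^sub>R x" "t *\<^sub>R y"] t by (simp add: N_scale)
  hence "h ((1 - t) *\<^sub>R x + t *\<^sub>R y) \<le> ((1 - t) * N x + t * N y) powr p"
    unfolding h_def using p1 by (intro powr_mono2) auto
  also have "\<dots> \<le> (1 - t) * h x + t * h y" unfolding h_def
    using t p1 by (intro powr_convex_comb) auto
  finally show ?thesis .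
qed

lemma h_midpoint: "h ((1/2) *\<^sub>R (x + y)) \<le> (h x + h y) / 2"
  using h_convex[of "1/2" x y] by (simp add: scaleR_add_right)

lemma h_add_le: "h (x + y) \<le> 2 powr (p - 1) * (h x + h y)"
proof -
  have "h (x + y) = h (2 *\<^sub>R ((1/2) *\<^sub>R (x + y)))" by simp
  also have "\<dots> = 2 powr p * h ((1/2) *\<^sub>R (x + y))" by (subst h_scale) simp
  also have "\<dots> \<le> 2 powr p * ((h x + h y) / 2)" by (intro mult_left_mono h_midpoint) auto
  also have "\<dots> = 2 powr (p - 1) * (h x + h y)" by (simp add: powr_diff)
  finally show ?thesis .
qed

lemma h_diff_le: "h (x - y) \<le> 2 powr (p - 1) * (h x + h y)"
  using h_add_le[of x "- y"] by simp

text \<open>Equivalence of norms: balls of \<open>N\<close> and Euclidean balls contain each other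
  after rescaling by the constants of \<open>N_upper\<close> and \<open>N_lower\<close>.\<close>

lemma sets_metric_borel: "sets (metric_borel UNIV (norm_dist N)) = sets borel"
proof -
  interpret M: Metric_space UNIV "norm_dist N"
  proof
    show "norm_dist N x z \<le> norm_dist N x y + norm_dist N y z" for x y z
      using N_triangle[of "x - y" "y - z"] by (simp add: norm_dist_def)
  qed (auto simp: norm_dist_def intro: N_diff_commute)
  obtain K where K: "K > 0" "\<And>x. N x \<le> K * norm x" using N_upper by blast
  obtain k where k: "k > 0" "\<And>x. k * norm x \<le> N x" using N_lower by blast
  have "openin M.mtopology U \<longleftrightarrow> open U" for U
  proof
    assume U: "openin M.mtopology U"
    show "open U" unfolding open_contains_ball
    proof
      fix x assume "x \<in> U"
      then obtain r where r: "r > 0" "M.mball x r \<subseteq> U" using U by (auto simp: M.openin_mtopology)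
      have "ball x (r / K) \<subseteq> M.mball x r"
      proof
        fix y assume "y \<in> ball x (r / K)"
        hence "K * norm (x - y) < r" using K by (simp add: dist_norm field_simps)
        thus "y \<in> M.mball x r" using K(2)[of "x - y"] by (simp add: norm_dist_def)
      qed
      thus "\<exists>e>0. ball x e \<subseteq> U" using r K by (intro exI[of _ "r / K"]) auto
    qed
  next
    assume U: "open U"
    show "openin M.mtopology U" unfolding M.openin_mtopology
    proof (intro conjI allI impI)
      fix x assume "x \<in> U"
      then obtain r where r: "r > 0" "ball x r \<subseteq> U" using U by (auto simp: open_contains_ball)
      have "M.mball x (r * k) \<subseteq> ball x r"
      proof
        fix y assume "y \<in> M.mball x (r * k)"
        hence "k * norm (x - y) < k * r" using k(2)[of "x - y"] by (simp add: norm_dist_def mult.commute)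
        thus "y \<in> ball x r" using k by (simp add: dist_norm)
      qed
      thus "\<exists>e>0. M.mball x e \<subseteq> U" using r k by (intro exI[of _ "r * k"]) auto
    qed simp
  qed
  hence "{U. openin (Metric_space.mtopology UNIV (norm_dist N)) U} = {U. open U}" by auto
  thus ?thesis by (simp add: metric_borel_def borel_def)
qed

section \<open>Wasserstein space, couplings and transport cost\<close>

definition P :: "'a measure set" where
  "P = {\<mu>. prob_space \<mu> \<and> sets \<mu> = sets borel \<and> integrable \<mu> h}"

lemma PD: assumes "\<mu> \<in> P" shows "prob_space \<mu>" "sets \<mu> = sets borel" "integrable \<mu> h" "space \<mu> = UNIV"
  using assms by (auto simp: P_def dest: sets_eq_imp_space_eq)

lemma P_measurable: "\<mu> \<in> P \<Longrightarrow> f \<in> borel_measurable borel \<Longrightarrow> f \<in> borel_measurable \<mu>"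
  using PD(2) measurable_cong_sets by blast

lemma P_integrable_shift:
  assumes "\<mu> \<in> P" shows "integrable \<mu> (\<lambda>x. h (x - a))"
proof (rule Bochner_Integration.integrable_bound)
  interpret prob_space \<mu> using PD[OF assms] by simp
  show "integrable \<mu> (\<lambda>x. 2 powr (p - 1) * (h x + h a))" using PD[OF assms] by auto
  show "(\<lambda>x. h (x - a)) \<in> borel_measurable \<mu>" by (rule P_measurable[OF assms]) measurable
qed (auto simp: h_diff_le)

lemma wasserstein_space_eq: "wasserstein_space p UNIV (norm_dist N) = P"
proof (intro set_eqI iffI)
  fix \<mu> assume "\<mu> \<in> wasserstein_space p UNIV (norm_dist N)"
  then obtain x0 where *: "prob_space \<mu>" "sets \<mu> = sets borel"
    "(\<integral>\<^sup>+x. ennreal (h (x - x0)) \<partial>\<mu>) < \<infinity>"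
    by (auto simp: wasserstein_space_def sets_metric_borel norm_dist_def h_def)
  interpret prob_space \<mu> by fact
  have m: "f \<in> borel_measurable \<mu>" if "f \<in> borel_measurable borel" for f :: "'a \<Rightarrow> real"
    using that *(2) measurable_cong_sets by blast
  have i: "integrable \<mu> (\<lambda>x. h (x - x0))"
    using *(3) by (intro integrableI_nonneg m) auto
  have "integrable \<mu> h"
  proof (rule Bochner_Integration.integrable_bound)
    show "integrable \<mu> (\<lambda>x. 2 powr (p - 1) * (h (x - x0) + h x0))" using i by auto
    show "h \<in> borel_measurable \<mu>" by (rule m) measurable
    show "AE x in \<mu>. norm (h x) \<le> norm (2 powr (p - 1) * (h (x - x0) + h x0))"
      using h_add_le[of "x - x0" x0 for x] by auto
  qed
  thus "\<mu> \<in> P" using * by (simp add: P_def)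
next
  fix \<mu> assume "\<mu> \<in> P"
  hence "(\<integral>\<^sup>+x. ennreal (h (x - 0)) \<partial>\<mu>) < \<infinity>"
    using integrableD(2)[of \<mu> h] by (simp add: P_def real_integrable_def top.not_eq_extremum)
  thus "\<mu> \<in> wasserstein_space p UNIV (norm_dist N)" using \<open>\<mu> \<in> P\<close>
    by (auto simp: wasserstein_space_def sets_metric_borel norm_dist_def h_def P_def intro!: exI[of _ 0])
qed

definition cpl :: "'a measure \<Rightarrow> 'a measure \<Rightarrow> ('a \<times> 'a) measure set" where
  "cpl \<mu> \<nu> = {\<pi>. prob_space \<pi> \<and> sets \<pi> = sets (borel \<Otimes>\<^sub>M borel) \<and> distr \<pi> borel fst = \<mu> \<and> distr \<pi> borel snd = \<nu>}"

lemma couplings_eq: "couplings UNIV (norm_dist N) \<mu> \<nu> = cpl \<mu> \<nu>"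
proof -
  have "distr \<pi> (metric_borel UNIV (norm_dist N)) f = distr \<pi> borel f" for \<pi> and f :: "'a \<times> 'a \<Rightarrow> 'a"
    by (rule distr_cong) (auto simp: sets_metric_borel)
  moreover have "sets (metric_borel UNIV (norm_dist N) \<Otimes>\<^sub>M metric_borel UNIV (norm_dist N)) = sets (borel \<Otimes>\<^sub>M borel)"
    by (intro sets_pair_measure_cong sets_metric_borel)
  ultimately show ?thesis by (auto simp: couplings_def cpl_def)
qed

definition cost :: "('a \<times> 'a) measure \<Rightarrow> real" where
  "cost \<pi> = (\<integral>z. h (fst z - snd z) \<partial>\<pi>)"

text \<open>The p-th power removes the root outside the infimum, so \<open>C\<close> compares
  directly with the integrals \<open>cost\<close>, which are linear in the coupling.\<close>

definition C :: "'a measure \<Rightarrow> 'a measure \<Rightarrow> real" where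
  "C \<mu> \<nu> = wasserstein_dist p UNIV (norm_dist N) \<mu> \<nu> powr p"

lemma cost_nonneg: "0 \<le> cost \<pi>" by (simp add: cost_def)

lemma wasserstein_dist_eq:
  "wasserstein_dist p UNIV (norm_dist N) \<mu> \<nu> = (INF \<pi>\<in>cpl \<mu> \<nu>. cost \<pi> powr (1 / p))"
  by (simp add: wasserstein_dist_def couplings_eq cost_def h_def norm_dist_def)

lemma bdd_below_cost: "bdd_below ((\<lambda>\<pi>. cost \<pi> powr (1 / p)) ` cpl \<mu> \<nu>)"
  by (auto simp: bdd_below_def intro!: exI[of _ 0])

lemma cplD:
  assumes "\<pi> \<in> cpl \<mu> \<nu>"
  shows "prob_space \<pi>" "sets \<pi> = sets (borel \<Otimes>\<^sub>M borel)" "distr \<pi> borel fst = \<mu>" "distr \<pi> borel snd = \<nu>"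
  using assms by (simp_all add: cpl_def)

lemma cpl_measurable:
  assumes "\<pi> \<in> cpl \<mu> \<nu>" "f \<in> measurable (borel \<Otimes>\<^sub>M borel) M"
  shows "f \<in> measurable \<pi> M"
  using assms(2) by (simp add: measurable_cong_sets[OF cplD(2)[OF assms(1)] refl])

lemma cpl_fst_measurable: "\<pi> \<in> cpl \<mu> \<nu> \<Longrightarrow> fst \<in> measurable \<pi> borel"
  by (erule cpl_measurable) simp

lemma cpl_snd_measurable: "\<pi> \<in> cpl \<mu> \<nu> \<Longrightarrow> snd \<in> measurable \<pi> borel"
  by (erule cpl_measurable) simp

lemma cpl_integral:
  assumes "\<pi> \<in> cpl \<mu> \<nu>" and f: "f \<in> borel_measurable borel"
  shows "(\<integral>z. f (fst z) \<partial>\<pi>) = (\<integral>x. f x \<partial>\<mu>)" "(\<integral>z. f (snd z) \<partial>\<pi>) = (\<integral>x. (f x :: real) \<partial>\<nu>)"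
  using integral_distr[OF cpl_fst_measurable[OF assms(1)] f] integral_distr[OF cpl_snd_measurable[OF assms(1)] f]
    by (simp_all add: cplD(3,4)[OF assms(1)])

lemma cpl_integrable:
  assumes "\<pi> \<in> cpl \<mu> \<nu>" and f: "(f :: 'a \<Rightarrow> real) \<in> borel_measurable borel"
  shows "integrable \<mu> f \<Longrightarrow> integrable \<pi> (\<lambda>z. f (fst z))" "integrable \<nu> f \<Longrightarrow> integrable \<pi> (\<lambda>z. f (snd z))"
  using integrable_distr_eq[OF cpl_fst_measurable[OF assms(1)] f] integrable_distr_eq[OF cpl_snd_measurable[OF assms(1)] f]
    by (simp_all add: cplD(3,4)[OF assms(1)])

lemma cpl_AE:
  assumes "\<pi> \<in> cpl \<mu> \<nu>" and Q: "{x. Q x} \<in> sets borel"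
  shows "(AE x in \<mu>. Q x) \<Longrightarrow> AE z in \<pi>. Q (fst z)" "(AE x in \<nu>. Q x) \<Longrightarrow> AE z in \<pi>. Q (snd z)"
proof -
  have "{x \<in> space borel. Q x} \<in> sets borel" using Q by simp
  from AE_distr_iff[OF cpl_fst_measurable[OF assms(1)] this] AE_distr_iff[OF cpl_snd_measurable[OF assms(1)] this]
  show "(AE x in \<mu>. Q x) \<Longrightarrow> AE z in \<pi>. Q (fst z)" "(AE x in \<nu>. Q x) \<Longrightarrow> AE z in \<pi>. Q (snd z)"
    unfolding cplD(3,4)[OF assms(1)] by blast+
qed

lemma cost_integrable:
  assumes "\<pi> \<in> cpl \<mu> \<nu>" "\<mu> \<in> P" "\<nu> \<in> P"
  shows "integrable \<pi> (\<lambda>z. h (fst z - snd z))"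
proof (rule Bochner_Integration.integrable_bound)
  show "integrable \<pi> (\<lambda>z. 2 powr (p - 1) * (h (fst z) + h (snd z)))"
    using cpl_integrable[OF assms(1) h_measurable] assms(2,3)[THEN PD(3)] by auto
  show "(\<lambda>z. h (fst z - snd z)) \<in> borel_measurable \<pi>"
    by (rule cpl_measurable[OF assms(1)]) measurable
qed (auto simp: h_diff_le)

text \<open>Supplies competitors that have a density with respect to the product:
  \<open>k = 1\<close> gives the product itself, other choices redistribute mass while both partial
  integrals stay 1, which preserves the marginals.\<close>

lemma density_coupling:
  fixes k :: "'a \<times> 'a \<Rightarrow> real"
  assumes \<mu>: "\<mu> \<in> P" and \<nu>: "\<nu> \<in> P"
    and k[measurable]: "k \<in> borel_measurable (borel \<Otimes>\<^sub>M borel)" and k0: "\<And>z. 0 \<le> k z"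
    and 1: "\<And>x. (\<integral>\<^sup>+y. ennreal (k (x, y)) \<partial>\<nu>) = 1" and 2: "\<And>y. (\<integral>\<^sup>+x. ennreal (k (x, y)) \<partial>\<mu>) = 1"
  shows "density (\<mu> \<Otimes>\<^sub>M \<nu>) (\<lambda>z. ennreal (k z)) \<in> cpl \<mu> \<nu>"
    and "cost (density (\<mu> \<Otimes>\<^sub>M \<nu>) (\<lambda>z. ennreal (k z))) = (\<integral>z. k z * h (fst z - snd z) \<partial>(\<mu> \<Otimes>\<^sub>M \<nu>))"
proof -
  note [measurable_cong] = PD(2)[OF \<mu>] PD(2)[OF \<nu>]
  interpret M: prob_space \<mu> using PD[OF \<mu>] by simp
  interpret Nu: prob_space \<nu> using PD[OF \<nu>] by simp
  interpret pair_prob_space \<mu> \<nu> ..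
  have km[measurable]: "k \<in> borel_measurable (\<mu> \<Otimes>\<^sub>M \<nu>)" by measurable
  let ?D = "density (\<mu> \<Otimes>\<^sub>M \<nu>) (\<lambda>z. ennreal (k z))"
  have s: "sets ?D = sets (borel \<Otimes>\<^sub>M borel)" by simp (intro sets_pair_measure_cong PD \<mu> \<nu>)
  have "distr ?D borel fst = \<mu>"
  proof (rule measure_eqI)
    fix A assume "A \<in> sets (distr ?D borel fst)"
    hence A[measurable]: "A \<in> sets borel" by simp
    have "emeasure (distr ?D borel fst) A = (\<integral>\<^sup>+z. ennreal (k z) * indicator (fst -` A \<inter> space ?D) z \<partial>(\<mu> \<Otimes>\<^sub>M \<nu>))"
      by (subst emeasure_distr, simp, simp, subst emeasure_density) auto
    also have "\<dots> = (\<integral>\<^sup>+z. ennreal (k z) * indicator A (fst z) \<partial>(\<mu> \<Otimes>\<^sub>M \<nu>))"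
      by (intro nn_integral_cong) (auto simp: indicator_def space_pair_measure)
    also have "\<dots> = (\<integral>\<^sup>+x. \<integral>\<^sup>+y. ennreal (k (x, y)) * indicator A x \<partial>\<nu> \<partial>\<mu>)"
      by (subst Nu.nn_integral_fst[symmetric]) auto
    also have "\<dots> = (\<integral>\<^sup>+x. indicator A x \<partial>\<mu>)"
      by (subst nn_integral_multc) (auto simp: 1)
    also have "\<dots> = emeasure \<mu> A" by (simp add: PD[OF \<mu>])
    finally show "emeasure (distr ?D borel fst) A = emeasure \<mu> A" .
  qed (simp add: PD[OF \<mu>])
  moreover have "distr ?D borel snd = \<nu>"
  proof (rule measure_eqI)
    fix A assume "A \<in> sets (distr ?D borel snd)"
    hence A[measurable]: "A \<in> sets borel" by simp
    have "emeasure (distr ?D borel snd) A = (\<integral>\<^sup>+z. ennreal (k z) * indicator (snd -` A \<inter> space ?D) z \<partial>(\<mu> \<Otimes>\<^sub>M \<nu>))"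
      by (subst emeasure_distr, simp, simp, subst emeasure_density) auto
    also have "\<dots> = (\<integral>\<^sup>+z. ennreal (k z) * indicator A (snd z) \<partial>(\<mu> \<Otimes>\<^sub>M \<nu>))"
      by (intro nn_integral_cong) (auto simp: indicator_def space_pair_measure)
    also have "\<dots> = (\<integral>\<^sup>+y. \<integral>\<^sup>+x. ennreal (k (x, y)) * indicator A y \<partial>\<mu> \<partial>\<nu>)"
      by (subst nn_integral_snd[symmetric]) auto
    also have "\<dots> = (\<integral>\<^sup>+x. indicator A x \<partial>\<nu>)"
      by (subst nn_integral_multc) (auto simp: 2)
    also have "\<dots> = emeasure \<nu> A" by (simp add: PD[OF \<nu>])
    finally show "emeasure (distr ?D borel snd) A = emeasure \<nu> A" .
  qed (simp add: PD[OF \<nu>])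
  moreover have "prob_space ?D"
  proof
    have "emeasure ?D (space ?D) = (\<integral>\<^sup>+z. ennreal (k z) \<partial>(\<mu> \<Otimes>\<^sub>M \<nu>))"
      by (subst emeasure_density) (auto intro!: nn_integral_cong)
    also have "\<dots> = (\<integral>\<^sup>+x. \<integral>\<^sup>+y. ennreal (k (x, y)) \<partial>\<nu> \<partial>\<mu>)"
      by (subst Nu.nn_integral_fst[symmetric]) auto
    also have "\<dots> = 1" by (simp add: 1 M.emeasure_space_1)
    finally show "emeasure ?D (space ?D) = 1" .
  qed
  ultimately show "?D \<in> cpl \<mu> \<nu>" using s by (simp add: cpl_def)
  show "cost ?D = (\<integral>z. k z * h (fst z - snd z) \<partial>(\<mu> \<Otimes>\<^sub>M \<nu>))"
    unfolding cost_def by (subst integral_density) (auto simp: k0)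
qed

lemma product_coupling:
  assumes "\<mu> \<in> P" "\<nu> \<in> P"
  shows "\<mu> \<Otimes>\<^sub>M \<nu> \<in> cpl \<mu> \<nu>"
proof -
  interpret M: prob_space \<mu> using PD[OF assms(1)] by simp
  interpret Nu: prob_space \<nu> using PD[OF assms(2)] by simp
  have "density (\<mu> \<Otimes>\<^sub>M \<nu>) (\<lambda>z. ennreal 1) \<in> cpl \<mu> \<nu>"
    by (rule density_coupling[OF assms]) (auto simp: M.emeasure_space_1 Nu.emeasure_space_1)
  thus ?thesis by (simp add: density_1)
qed

lemma C_le_cost:
  assumes "\<pi> \<in> cpl \<mu> \<nu>"
  shows "C \<mu> \<nu> \<le> cost \<pi>"
proof -
  have a: "(INF \<pi>\<in>cpl \<mu> \<nu>. cost \<pi> powr (1 / p)) \<le> cost \<pi> powr (1 / p)"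
    by (rule cINF_lower[OF bdd_below_cost assms])
  have "0 \<le> (INF \<pi>\<in>cpl \<mu> \<nu>. cost \<pi> powr (1 / p))"
    using assms by (intro cINF_greatest) auto
  hence "C \<mu> \<nu> \<le> (cost \<pi> powr (1 / p)) powr p"
    unfolding C_def wasserstein_dist_eq using a p1 by (intro powr_mono2) auto
  also have "\<dots> = cost \<pi>" using p1 by (simp add: powr_powr cost_nonneg)
  finally show ?thesis .
qed

text \<open>With \<open>C_le_cost\<close> this is the interface to the infimum: a bound that holds
  for every single coupling replaces the choice of an optimal one.\<close>

lemma C_ge:
  assumes P: "\<mu> \<in> P" "\<nu> \<in> P" and a: "\<And>\<pi>. \<pi> \<in> cpl \<mu> \<nu> \<Longrightarrow> a \<le> cost \<pi>"
  shows "a \<le> C \<mu> \<nu>"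
proof (cases "a \<le> 0")
  case True thus ?thesis by (simp add: C_def order_trans)
next
  case False
  have "a powr (1 / p) \<le> (INF \<pi>\<in>cpl \<mu> \<nu>. cost \<pi> powr (1 / p))"
    using product_coupling[OF P] False a p1 by (intro cINF_greatest powr_mono2) auto
  hence "(a powr (1 / p)) powr p \<le> C \<mu> \<nu>"
    unfolding C_def wasserstein_dist_eq using p1 by (intro powr_mono2) auto
  thus ?thesis using False p1 by (simp add: powr_powr)
qed

lemma C_eqI:
  assumes P: "\<mu> \<in> P" "\<nu> \<in> P" and a: "\<And>\<pi>. \<pi> \<in> cpl \<mu> \<nu> \<Longrightarrow> cost \<pi> = a"
  shows "C \<mu> \<nu> = a"
  using C_ge[OF P, of a] C_le_cost[OF product_coupling[OF P]] a[OF product_coupling[OF P]] a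
  by (intro order_antisym) auto

lemma C_nonneg: "0 \<le> C \<mu> \<nu>" by (simp add: C_def)

lemma return_in_P: "return borel a \<in> P"
  by (auto simp: P_def prob_space_return integrable_iff_bounded nn_integral_return)

lemma AE_return_borel: "AE x in return borel a. x = (a::'a)"
  by (subst AE_return) auto

text \<open>Every coupling with a Dirac measure has second coordinate \<open>a\<close> almost
  everywhere, so all of them have the same cost.\<close>

lemma C_return:
  assumes "\<mu> \<in> P"
  shows "C \<mu> (return borel a) = (\<integral>x. h (x - a) \<partial>\<mu>)"
proof (rule C_eqI[OF assms return_in_P])
  fix \<pi> assume \<pi>: "\<pi> \<in> cpl \<mu> (return borel a)"
  have "AE z in \<pi>. snd z = a"
    by (rule cpl_AE(2)[OF \<pi>]) (auto simp: AE_return_borel)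
  hence "cost \<pi> = (\<integral>z. h (fst z - a) \<partial>\<pi>)" unfolding cost_def
    by (intro integral_cong_AE cpl_measurable[OF \<pi>]) auto
  also have "\<dots> = (\<integral>x. h (x - a) \<partial>\<mu>)"
    by (rule cpl_integral[OF \<pi>]) measurable
  finally show "cost \<pi> = (\<integral>x. h (x - a) \<partial>\<mu>)" .
qed

end

subsection \<open>Supports and convergence\<close>

definition supp :: "'a::second_countable_topology measure \<Rightarrow> 'a set" where
  "supp \<mu> = - \<Union>{S. open S \<and> emeasure \<mu> S = 0}"

lemma closed_supp: "closed (supp \<mu>)"
  unfolding supp_def by (intro closed_Compl open_Union) auto

text \<open>The removed union of null open sets may be uncountable; Lindelof's theorem replaces it
  by a countable one.\<close>

lemma AE_supp:
  assumes "sets \<mu> = sets (borel :: 'a::second_countable_topology measure)"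
  shows "AE x in \<mu>. x \<in> supp \<mu>"
proof -
  obtain F where F: "F \<subseteq> {S. open S \<and> emeasure \<mu> S = 0}" "countable F" "\<Union>F = \<Union>{S. open S \<and> emeasure \<mu> S = 0}"
    using Lindelof[of "{S. open S \<and> emeasure \<mu> S = 0}"] by auto
  have "(\<Union>S\<in>F. S) \<in> null_sets \<mu>"
    using F by (intro null_sets_UN') (auto simp: null_sets_def assms)
  hence "\<Union>F \<in> null_sets \<mu>" by simp
  from AE_not_in[OF this] show ?thesis by (simp add: supp_def F(3))
qed

lemma supp_open_pos:
  assumes "x \<in> supp \<mu>" "open S" "x \<in> S" shows "emeasure \<mu> S \<noteq> 0"
  using assms by (auto simp: supp_def)

lemma supp_subset_closed:
  assumes "closed A" "AE x in \<mu>. x \<in> A" "sets \<mu> = sets (borel :: 'a::second_countable_topology measure)"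
  shows "supp \<mu> \<subseteq> A"
proof
  fix x assume x: "x \<in> supp \<mu>"
  have "- A \<in> sets \<mu>" using assms by auto
  hence "- A \<in> null_sets \<mu>" using assms(2) by (subst AE_iff_null_sets) auto
  hence "emeasure \<mu> (- A) = 0" by blast
  thus "x \<in> A" using supp_open_pos[OF x, of "- A"] assms(1) by auto
qed

context power_cost begin

lemma P_AE_supp: "\<mu> \<in> P \<Longrightarrow> AE x in \<mu>. x \<in> supp \<mu>"
  by (simp add: AE_supp PD)

lemma supp_nonempty: assumes "\<mu> \<in> P" shows "supp \<mu> \<noteq> {}"
proof
  assume "supp \<mu> = {}"
  hence "AE x in \<mu>. False" using P_AE_supp[OF assms] by simp
  thus False using prob_space.AE_False PD(1)[OF assms] by blast
qed

lemma supp_measure_pos: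
  assumes "\<mu> \<in> P" "x \<in> supp \<mu>" "open S" "x \<in> S" shows "0 < measure \<mu> S"
proof -
  interpret prob_space \<mu> using PD[OF assms(1)] by simp
  show ?thesis using supp_open_pos[OF assms(2-4)] by (simp add: emeasure_eq_measure zero_less_measure_iff)
qed

text \<open>A counterexample has an open rectangle around it inside the complement of the relation,
  and that rectangle has positive product mass. This passes from almost everywhere equalities to
  individual points of the supports.\<close>

lemma supp_product:
  assumes P: "\<mu> \<in> P" "\<nu> \<in> P" and cl: "closed {z. Q z}" and ae: "AE z in \<mu> \<Otimes>\<^sub>M \<nu>. Q z"
    and x: "x \<in> supp \<mu>" and y: "y \<in> supp \<nu>"
  shows "Q (x, y)"
proof (rule ccontr)
  assume nQ: "\<not> Q (x, y)"
  interpret M: prob_space \<mu> using PD[OF P(1)] by simp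
  interpret Nu: prob_space \<nu> using PD[OF P(2)] by simp
  have "open (- {z. Q z})" "(x, y) \<in> - {z. Q z}" using cl nQ by auto
  then obtain A B where AB: "open A" "open B" "x \<in> A" "y \<in> B" "A \<times> B \<subseteq> - {z. Q z}"
    by (metis mem_Sigma_iff open_prod_elim)
  have s: "A \<in> sets \<mu>" "B \<in> sets \<nu>" using AB P by (auto simp: PD)
  have "AE z in \<mu> \<Otimes>\<^sub>M \<nu>. z \<notin> A \<times> B" using ae AB(5) by (auto elim!: eventually_mono)
  hence "emeasure (\<mu> \<Otimes>\<^sub>M \<nu>) (A \<times> B) = 0"
    using s by (subst (asm) AE_iff_measurable[of "A \<times> B"]) (auto simp: space_pair_measure PD[OF P(1)] PD[OF P(2)])
  hence "emeasure \<mu> A * emeasure \<nu> B = 0" using s by (simp add: Nu.emeasure_pair_measure_Times)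
  thus False using supp_open_pos[OF x AB(1,3)] supp_open_pos[OF y AB(2,4)] by simp
qed

lemma eq_return_iff:
  assumes "\<mu> \<in> P" "AE x in \<mu>. x = a" shows "\<mu> = return borel a"
proof (rule measure_eqI)
  interpret prob_space \<mu> using PD[OF assms(1)] by simp
  fix A assume A: "A \<in> sets \<mu>"
  have "emeasure \<mu> A = (\<integral>\<^sup>+x. indicator A x \<partial>\<mu>)" using A by simp
  also have "\<dots> = (\<integral>\<^sup>+x. indicator A a \<partial>\<mu>)" by (intro nn_integral_cong_AE) (use assms(2) in auto)
  also have "\<dots> = indicator A a" by (simp add: emeasure_space_1)
  finally show "emeasure \<mu> A = emeasure (return borel a) A" using A by (simp add: PD[OF assms(1)])
qed (simp add: PD assms)

text \<open>Concentration on \<open>F\<close> is assumed for \<open>\<mu>\<close> alone: the atoms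
  in \<open>F\<close> already carry mass 1, which leaves \<open>\<nu>\<close> no mass
  elsewhere.\<close>

lemma finite_measure_eqI:
  assumes P: "\<mu> \<in> P" "\<nu> \<in> P" and F: "finite F" "AE x in \<mu>. x \<in> F"
    and eq: "\<And>x. x \<in> F \<Longrightarrow> measure \<nu> {x} = measure \<mu> {x}"
  shows "\<nu> = \<mu>"
proof -
  interpret M: prob_space \<mu> using PD[OF P(1)] by simp
  interpret Nu: prob_space \<nu> using PD[OF P(2)] by simp
  have sF: "A \<in> sets borel" if "A \<subseteq> F" for A
    using that F(1) by (intro borel_closed finite_imp_closed) (auto intro: finite_subset)
  have m: "measure \<mu> A = (\<Sum>x\<in>A. measure \<mu> {x})" "measure \<nu> A = (\<Sum>x\<in>A. measure \<nu> {x})" if "A \<subseteq> F" for A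
    using that finite_subset[OF that F(1)]
    by (auto intro!: M.finite_measure_eq_sum_singleton Nu.finite_measure_eq_sum_singleton simp: PD[OF P(1)] PD[OF P(2)])
  have e: "measure \<mu> A = measure \<nu> A" if "A \<subseteq> F" for A
    using m[OF that] eq that by (auto intro!: sum.cong)
  have "measure \<mu> F = 1" using F(2) sF[of F] by (subst M.prob_eq_1) (auto simp: PD[OF P(1)])
  hence "measure \<nu> F = 1" using e[of F] by simp
  hence F': "AE x in \<nu>. x \<in> F" using sF[of F] by (subst (asm) Nu.prob_eq_1) (auto simp: PD[OF P(2)])
  show ?thesis
  proof (rule measure_eqI)
    fix A assume A: "A \<in> sets \<nu>"
    have b: "A \<in> sets \<mu>" "A \<inter> F \<in> sets \<mu>" "A \<inter> F \<in> sets \<nu>" using A sF[of F] by (auto simp: PD[OF P(1)] PD[OF P(2)])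
    have "emeasure \<nu> A = emeasure \<nu> (A \<inter> F)"
      by (rule emeasure_eq_AE) (use F' A b in auto)
    also have "\<dots> = emeasure \<mu> (A \<inter> F)" using e[of "A \<inter> F"] by (simp add: M.emeasure_eq_measure Nu.emeasure_eq_measure)
    also have "\<dots> = emeasure \<mu> A" by (rule emeasure_eq_AE) (use F A b in auto)
    finally show "emeasure \<nu> A = emeasure \<mu> A" .
  qed (simp add: PD[OF P(1)] PD[OF P(2)])
qed

section \<open>Push-forwards and doubling from a Dirac measure\<close>

lemma C_return':
  assumes "\<mu> \<in> P"
  shows "C (return borel a) \<mu> = (\<integral>x. h (x - a) \<partial>\<mu>)"
proof (rule C_eqI[OF return_in_P assms])
  fix \<pi> assume \<pi>: "\<pi> \<in> cpl (return borel a) \<mu>"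
  have "AE z in \<pi>. fst z = a"
    by (rule cpl_AE(1)[OF \<pi>]) (auto simp: AE_return_borel)
  hence "cost \<pi> = (\<integral>z. h (a - snd z) \<partial>\<pi>)" unfolding cost_def
    by (intro integral_cong_AE cpl_measurable[OF \<pi>]) auto
  also have "\<dots> = (\<integral>z. h (snd z - a) \<partial>\<pi>)" by (simp add: h_diff_commute)
  also have "\<dots> = (\<integral>x. h (x - a) \<partial>\<mu>)"
    by (rule cpl_integral[OF \<pi>]) measurable
  finally show "cost \<pi> = (\<integral>x. h (x - a) \<partial>\<mu>)" .
qed

lemma map_coupling:
  assumes \<mu>: "\<mu> \<in> P" and G[measurable]: "G \<in> borel_measurable borel"
  shows "distr \<mu> (borel \<Otimes>\<^sub>M borel) (\<lambda>x. (x, G x)) \<in> cpl \<mu> (distr \<mu> borel G)"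
    and "cost (distr \<mu> (borel \<Otimes>\<^sub>M borel) (\<lambda>x. (x, G x))) = (\<integral>x. h (x - G x) \<partial>\<mu>)"
proof -
  interpret prob_space \<mu> using PD[OF \<mu>] by simp
  note [measurable_cong] = PD(2)[OF \<mu>]
  have [measurable]: "G \<in> measurable \<mu> borel" by measurable
  have "distr (distr \<mu> (borel \<Otimes>\<^sub>M borel) (\<lambda>x. (x, G x))) borel fst = distr \<mu> borel (\<lambda>x. x)"
    by (subst distr_distr) (auto simp: comp_def)
  also have "\<dots> = \<mu>" by (rule distr_id2) (simp add: PD \<mu>)
  finally show "distr \<mu> (borel \<Otimes>\<^sub>M borel) (\<lambda>x. (x, G x)) \<in> cpl \<mu> (distr \<mu> borel G)"
    by (auto simp: cpl_def distr_distr comp_def intro!: prob_space_distr)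
  show "cost (distr \<mu> (borel \<Otimes>\<^sub>M borel) (\<lambda>x. (x, G x))) = (\<integral>x. h (x - G x) \<partial>\<mu>)"
    unfolding cost_def by (subst integral_distr) auto
qed

lemma distr_in_P:
  assumes \<mu>: "\<mu> \<in> P" and G[measurable]: "G \<in> borel_measurable borel" and i: "integrable \<mu> (\<lambda>x. h (G x))"
  shows "distr \<mu> borel G \<in> P"
proof -
  interpret prob_space \<mu> using PD[OF \<mu>] by simp
  note [measurable_cong] = PD(2)[OF \<mu>]
  have [measurable]: "G \<in> measurable \<mu> borel" by measurable
  show ?thesis using i by (auto simp: P_def prob_space_distr integrable_distr_eq)
qed

lemma dilation_in_P:
  assumes \<mu>: "\<mu> \<in> P" shows "distr \<mu> borel (\<lambda>z. a + c *\<^sub>R (z - b)) \<in> P"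
proof (rule distr_in_P[OF \<mu>])
  interpret prob_space \<mu> using PD[OF \<mu>] by simp
  show "(\<lambda>z. a + c *\<^sub>R (z - b)) \<in> borel_measurable borel" by measurable
  show "integrable \<mu> (\<lambda>x. h (a + c *\<^sub>R (x - b)))"
  proof (rule Bochner_Integration.integrable_bound)
    show "integrable \<mu> (\<lambda>x. 2 powr (p - 1) * (h a + \<bar>c\<bar> powr p * h (x - b)))"
      using P_integrable_shift[OF \<mu>, of b] by auto
    show "(\<lambda>x. h (a + c *\<^sub>R (x - b))) \<in> borel_measurable \<mu>" by (rule P_measurable[OF \<mu>]) measurable
    show "AE x in \<mu>. norm (h (a + c *\<^sub>R (x - b))) \<le> norm (2 powr (p - 1) * (h a + \<bar>c\<bar> powr p * h (x - b)))"
      using h_add_le[of a "c *\<^sub>R (x - b)" for x] by (auto simp: h_scale)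
  qed
qed

text \<open>The dilation by 2 from \<open>a\<close> prolongs each segment issuing from
  \<open>a\<close> to twice its length, so the geodesic from the Dirac measure to
  \<open>\<nu>\<close> continues equally far beyond \<open>\<nu>\<close>.\<close>

lemma return_doubling:
  assumes \<nu>: "\<nu> \<in> P"
  shows "\<exists>\<rho>\<in>P. C (return borel a) \<rho> = 2 powr p * C (return borel a) \<nu> \<and> C \<nu> \<rho> = C (return borel a) \<nu>"
proof
  let ?G = "\<lambda>z. a + 2 *\<^sub>R (z - a)"
  let ?\<rho> = "distr \<nu> borel ?G"
  note [measurable_cong] = PD(2)[OF \<nu>]
  show \<rho>: "?\<rho> \<in> P" by (rule dilation_in_P[OF \<nu>])
  define M where "M = (\<integral>x. h (x - a) \<partial>\<nu>)"
  have M: "C (return borel a) \<nu> = M" by (simp add: M_def C_return'[OF \<nu>])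
  have \<rho>M: "(\<integral>x. h (x - a) \<partial>?\<rho>) = 2 powr p * M"
    unfolding M_def by (subst integral_distr) (auto simp: h_scale)
  have "C \<nu> ?\<rho> \<le> (\<integral>x. h (x - ?G x) \<partial>\<nu>)"
    using C_le_cost[OF map_coupling(1)[OF \<nu>, of ?G]] map_coupling(2)[OF \<nu>, of ?G] by simp
  also have "\<dots> = (\<integral>x. h (x - a) \<partial>\<nu>)"
  proof (intro Bochner_Integration.integral_cong refl)
    fix x
    have "x - ?G x = - (x - a)" by (simp add: algebra_simps scaleR_2)
    thus "h (x - ?G x) = h (x - a)" by (metis h_minus)
  qed
  finally have le: "C \<nu> ?\<rho> \<le> M" by (simp add: M_def)
  have "M \<le> C \<nu> ?\<rho>"
  proof (rule C_ge[OF \<nu> \<rho>])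
    fix \<pi> assume \<pi>: "\<pi> \<in> cpl \<nu> ?\<rho>"
    have i1: "integrable \<pi> (\<lambda>z. h (fst z - a))"
      by (rule cpl_integrable(1)[OF \<pi>, of "\<lambda>x. h (x - a)"]) (auto intro: P_integrable_shift \<nu>)
    have i2: "integrable \<pi> (\<lambda>z. h (snd z - a))"
      by (rule cpl_integrable(2)[OF \<pi>, of "\<lambda>x. h (x - a)"]) (auto intro: P_integrable_shift \<rho>)
    note i3 = cost_integrable[OF \<pi> \<nu> \<rho>]
    \<comment> \<open>\<open>h_add_le\<close> through the intermediate point \<open>fst z\<close> is
      an equality for two equal steps, which is why it yields the sharp lower bound
      \<open>M\<close>.\<close>
    have "(\<integral>z. h (snd z - a) \<partial>\<pi>) \<le> (\<integral>z. 2 powr (p - 1) * (h (fst z - snd z) + h (fst z - a)) \<partial>\<pi>)"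
    proof (intro integral_mono i2)
      show "integrable \<pi> (\<lambda>z. 2 powr (p - 1) * (h (fst z - snd z) + h (fst z - a)))" using i1 i3 by auto
      fix z :: "'a \<times> 'a"
      show "h (snd z - a) \<le> 2 powr (p - 1) * (h (fst z - snd z) + h (fst z - a))"
        using h_add_le[of "snd z - fst z" "fst z - a"] by (simp add: h_diff_commute)
    qed
    also have "\<dots> = 2 powr (p - 1) * (cost \<pi> + (\<integral>z. h (fst z - a) \<partial>\<pi>))"
      using i1 i3 by (simp add: cost_def)
    also have "(\<integral>z. h (fst z - a) \<partial>\<pi>) = M" unfolding M_def by (rule cpl_integral[OF \<pi>]) measurable
    also have "(\<integral>z. h (snd z - a) \<partial>\<pi>) = (\<integral>x. h (x - a) \<partial>?\<rho>)" by (rule cpl_integral[OF \<pi>]) measurable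
    finally have "2 powr p * M \<le> 2 powr p * ((cost \<pi> + M) / 2)" by (simp add: \<rho>M powr_diff)
    thus "M \<le> cost \<pi>" by simp
  qed
  thus "C (return borel a) ?\<rho> = 2 powr p * C (return borel a) \<nu> \<and> C \<nu> ?\<rho> = C (return borel a) \<nu>"
    using le by (simp add: M C_return'[OF \<rho>] \<rho>M)
qed

text \<open>The elementary bound \<open>N \<le> e + e powr (1 - p) * N powr p\<close> replaces the Hoelder inequality.\<close>

lemma Lipschitz_integral_diff:
  assumes P: "\<mu> \<in> P" "\<nu> \<in> P" and f[measurable]: "f \<in> borel_measurable borel" and fi: "integrable \<mu> f" "integrable \<nu> f"
    and L: "\<And>x y. \<bar>f x - f y\<bar> \<le> L * N (x - y)" and "0 \<le> L" and e: "0 < e"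
  shows "\<bar>(\<integral>x. f x \<partial>\<mu>) - (\<integral>x. f x \<partial>\<nu>)\<bar> \<le> L * (e + e powr (1 - p) * C \<mu> \<nu>)"
proof -
  let ?D = "\<bar>(\<integral>x. f x \<partial>\<mu>) - (\<integral>x. f x \<partial>\<nu>)\<bar>"
  have Nle: "N x \<le> e + e powr (1 - p) * h x" for x
  proof (cases "N x \<le> e")
    case True thus ?thesis by (simp add: add_increasing2)
  next
    case False
    hence "1 \<le> (N x / e) powr (p - 1)" using e p1 by (intro ge_one_powr_ge_zero) (auto simp: field_simps)
    also have "\<dots> = e powr (1 - p) * N x powr (p - 1)" using e by (simp add: powr_divide powr_diff)
    finally have "N x * 1 \<le> N x * (e powr (1 - p) * N x powr (p - 1))"
      by (intro mult_left_mono) auto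
    also have "\<dots> = e powr (1 - p) * h x" using False e by (simp add: h_def powr_diff)
    finally show ?thesis using e by simp
  qed
  show ?thesis
  proof (cases "L = 0")
    case True
    have c: "f x = f 0" for x using L[of x 0] True by simp
    have "(\<integral>x. f x \<partial>\<mu>) = (\<integral>x. f 0 \<partial>\<mu>)" "(\<integral>x. f x \<partial>\<nu>) = (\<integral>x. f 0 \<partial>\<nu>)"
      by (intro Bochner_Integration.integral_cong refl c)+
    thus ?thesis using True prob_space.prob_space[OF PD(1)[OF P(1)]] prob_space.prob_space[OF PD(1)[OF P(2)]]
      by (simp add: PD(4)[OF P(1)] PD(4)[OF P(2)])
  next
    case False
    \<comment> \<open>Solved for the cost, the estimate becomes a lower bound for every coupling, as
      \<open>C_ge\<close> requires; the division is why \<open>L = 0\<close> is a separate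
      case.\<close>
    have "(?D / L - e) / e powr (1 - p) \<le> C \<mu> \<nu>"
    proof (rule C_ge[OF P])
      fix \<pi> assume \<pi>: "\<pi> \<in> cpl \<mu> \<nu>"
      interpret prob_space \<pi> using cplD[OF \<pi>] by simp
      note i = cpl_integrable[OF \<pi> f] cost_integrable[OF \<pi> P]
      have "?D = \<bar>\<integral>z. f (fst z) - f (snd z) \<partial>\<pi>\<bar>"
        using i fi by (simp add: cpl_integral[OF \<pi> f])
      also have "\<dots> \<le> (\<integral>z. \<bar>f (fst z) - f (snd z)\<bar> \<partial>\<pi>)" by (rule integral_abs_bound)
      also have "\<dots> \<le> (\<integral>z. L * (e + e powr (1 - p) * h (fst z - snd z)) \<partial>\<pi>)"
      proof (intro integral_mono)
        fix z
        show "\<bar>f (fst z) - f (snd z)\<bar> \<le> L * (e + e powr (1 - p) * h (fst z - snd z))"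
          using L[of "fst z" "snd z"] mult_left_mono[OF Nle \<open>0 \<le> L\<close>, of "fst z - snd z"] by linarith
      qed (use i fi in auto)
      also have "\<dots> = L * (e + e powr (1 - p) * cost \<pi>)" using i fi by (simp add: cost_def prob_space)
      finally show "(?D / L - e) / e powr (1 - p) \<le> cost \<pi>"
        using False \<open>0 \<le> L\<close> e by (simp add: field_simps)
    qed
    thus ?thesis using False \<open>0 \<le> L\<close> e by (simp add: field_simps)
  qed
qed

text \<open>Truncated distances to a closed set are bounded and Lipschitz and converge to its
  indicator; the closed sets form an intersection-stable generator of the Borel sets.\<close>

lemma closed_integral_eqI:
  assumes P: "\<mu> \<in> P" "\<nu> \<in> P"
    and eq: "\<And>f L. f \<in> borel_measurable borel \<Longrightarrow> (\<And>x y. \<bar>f x - f y\<bar> \<le> L * N (x - y)) \<Longrightarrow> 0 \<le> L \<Longrightarrow>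
      (\<And>x. \<bar>f x\<bar> \<le> 1) \<Longrightarrow> (\<integral>x. f x \<partial>\<mu>) = (\<integral>x. f x \<partial>\<nu>)"
  shows "\<mu> = \<nu>"
proof -
  interpret M: prob_space \<mu> using PD[OF P(1)] by simp
  interpret Nu: prob_space \<nu> using PD[OF P(2)] by simp
  obtain k where k: "k > 0" "\<And>x. k * norm x \<le> N x" using N_lower by blast
  have cl: "emeasure \<mu> A = emeasure \<nu> A" if A: "closed A" for A
  proof (cases "A = {}")
    case False
    define f where "f n x = max 0 (1 - real n * infdist x A)" for n x
    have fm[measurable]: "f n \<in> borel_measurable borel" for n
      unfolding f_def[abs_def] by (intro borel_measurable_continuous_onI continuous_intros)
    have fb: "\<bar>f n x\<bar> \<le> 1" for n x using infdist_nonneg[of x A] by (auto simp: f_def)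
    have fL: "\<bar>f n x - f n y\<bar> \<le> (real n / k) * N (x - y)" for n x y
    proof -
      have "\<bar>infdist x A - infdist y A\<bar> \<le> dist x y" by (rule infdist_triangle_abs)
      also have "\<dots> \<le> N (x - y) / k" using k(1) k(2)[of "x - y"] by (simp add: dist_norm field_simps)
      finally have "real n * \<bar>infdist x A - infdist y A\<bar> \<le> real n * (N (x - y) / k)" by (intro mult_left_mono) auto
      moreover have "real n * \<bar>infdist x A - infdist y A\<bar> = \<bar>real n * infdist x A - real n * infdist y A\<bar>"
        by (simp add: abs_mult flip: right_diff_distrib)
      ultimately show ?thesis unfolding f_def by (simp add: max_def abs_if split: if_splits)
    qed
    have lim: "(\<lambda>n. f n x) \<longlonglongrightarrow> indicator A x" for x
    proof (cases "x \<in> A")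
      case True thus ?thesis by (simp add: f_def)
    next
      case nx: False
      hence pos: "0 < infdist x A" using A False in_closed_iff_infdist_zero[of A x] infdist_nonneg[of x A] by (auto simp: less_le)
      obtain n0 :: nat where n0: "1 / infdist x A < real n0" using reals_Archimedean2 by blast
      have "f n x = 0" if "n \<ge> n0" for n
      proof -
        have "1 / infdist x A \<le> real n" using n0 that by linarith
        thus ?thesis using pos by (simp add: f_def field_simps)
      qed
      thus ?thesis using nx by (intro tendsto_eventually) (auto simp: eventually_sequentially)
    qed
    have lim2: "(\<lambda>n. \<integral>x. f n x \<partial>m) \<longlonglongrightarrow> (\<integral>x. indicator A x \<partial>m)" if "m \<in> P" for m
    proof (rule integral_dominated_convergence[where w="\<lambda>_. 1"])
      interpret prob_space m using PD[OF that] by simp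
      show "integrable m (\<lambda>_. 1 :: real)" by simp
    qed (use lim fb A that in \<open>auto intro!: P_measurable[OF that]\<close>)
    have "(\<integral>x. f n x \<partial>\<mu>) = (\<integral>x. f n x \<partial>\<nu>)" for n
      by (rule eq[OF fm fL]) (use k fb in auto)
    hence "(\<integral>x. indicator A x \<partial>\<mu>) = (\<integral>x. indicator A x \<partial>\<nu> :: real)"
      using lim2[OF P(1)] lim2[OF P(2)] by (simp add: LIMSEQ_unique)
    thus ?thesis using A by (simp add: M.emeasure_eq_measure Nu.emeasure_eq_measure PD[OF P(1)] PD[OF P(2)])
  qed simp
  show ?thesis
  proof (rule measure_eqI_generator_eq[where E="{S. closed S}" and A="\<lambda>_. UNIV" and \<Omega>=UNIV])
    show "Int_stable {S::'a set. closed S}" by (auto simp: Int_stable_def)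
    show "sets \<mu> = sigma_sets UNIV {S. closed S}" "sets \<nu> = sigma_sets UNIV {S. closed S}"
      using P by (simp_all add: PD borel_eq_closed)
  qed (use cl in \<open>auto\<close>)
qed

text \<open>For fixed \<open>e\<close> the bounds of \<open>Lipschitz_integral_diff\<close> add up
  to \<open>2 * L * e\<close> in the limit along the sequence; then \<open>e\<close> tends to
  0.\<close>

lemma C_limit_unique:
  assumes P: "\<mu> \<in> P" "\<mu>' \<in> P" "\<And>i. \<nu> i \<in> P" and lim: "(\<lambda>i. C \<mu> (\<nu> i)) \<longlonglongrightarrow> 0" "(\<lambda>i. C \<mu>' (\<nu> i)) \<longlonglongrightarrow> 0"
  shows "\<mu> = \<mu>'"
proof (rule closed_integral_eqI[OF P(1,2)])
  fix f :: "'a \<Rightarrow> real" and L :: real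
  assume f[measurable]: "f \<in> borel_measurable borel" and L: "\<And>x y. \<bar>f x - f y\<bar> \<le> L * N (x - y)" "0 \<le> L"
    and b: "\<And>x. \<bar>f x\<bar> \<le> 1"
  have fi: "integrable m f" if "m \<in> P" for m
  proof -
    interpret prob_space m using PD[OF that] by simp
    show ?thesis by (rule integrable_const_bound[where B=1]) (use b P_measurable[OF that f] in auto)
  qed
  have bd: "\<bar>(\<integral>x. f x \<partial>\<mu>) - (\<integral>x. f x \<partial>\<mu>')\<bar> \<le> 2 * L * e" if e: "0 < e" for e
  proof (rule LIMSEQ_le_const)
    show "(\<lambda>i. L * (e + e powr (1 - p) * C \<mu> (\<nu> i)) + L * (e + e powr (1 - p) * C \<mu>' (\<nu> i))) \<longlonglongrightarrow> 2 * L * e"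
      using lim by (auto intro!: tendsto_eq_intros)
    have "\<bar>(\<integral>x. f x \<partial>\<mu>) - (\<integral>x. f x \<partial>\<mu>')\<bar>
        \<le> L * (e + e powr (1 - p) * C \<mu> (\<nu> n)) + L * (e + e powr (1 - p) * C \<mu>' (\<nu> n))" for n
      using Lipschitz_integral_diff[OF P(1) P(3)[of n] f fi[OF P(1)] fi[OF P(3)] L e]
        Lipschitz_integral_diff[OF P(2) P(3)[of n] f fi[OF P(2)] fi[OF P(3)] L e] by linarith
    thus "\<exists>N. \<forall>n\<ge>N. \<bar>(\<integral>x. f x \<partial>\<mu>) - (\<integral>x. f x \<partial>\<mu>')\<bar>
        \<le> L * (e + e powr (1 - p) * C \<mu> (\<nu> n)) + L * (e + e powr (1 - p) * C \<mu>' (\<nu> n))" by blast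
  qed
  show "(\<integral>x. f x \<partial>\<mu>) = (\<integral>x. f x \<partial>\<mu>')"
  proof (cases "L = 0")
    case True thus ?thesis using bd[of 1] by simp
  next
    case False
    have "\<bar>(\<integral>x. f x \<partial>\<mu>) - (\<integral>x. f x \<partial>\<mu>')\<bar> \<le> 0"
    proof (rule field_le_epsilon)
      fix e :: real assume "e > 0"
      thus "\<bar>(\<integral>x. f x \<partial>\<mu>) - (\<integral>x. f x \<partial>\<mu>')\<bar> \<le> 0 + e" using bd[of "e / (2 * L)"] False L(2) by simp
    qed
    thus ?thesis by simp
  qed
qed

text \<open>Pushing forward by simple functions \<open>G i\<close> that converge to the identity
  moves the point \<open>x\<close> by \<open>x - G i x\<close>; the growth bound
  \<open>norm (G i x) <= 2 * norm x\<close> makes this cost dominated.\<close>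

lemma finite_approx:
  assumes \<mu>: "\<mu> \<in> P"
  obtains \<nu> where "\<And>i. \<nu> i \<in> P" "\<And>i. \<exists>F. finite F \<and> (AE x in \<nu> i. x \<in> F)" "(\<lambda>i. C \<mu> (\<nu> i)) \<longlonglongrightarrow> 0"
proof -
  have "(\<lambda>x::'a. x) \<in> borel_measurable borel" by simp
  from borel_measurable_implies_sequence_metric[OF this, of 0] obtain G where
    G: "\<And>i. simple_function borel (G i)" "\<And>x. (\<lambda>i. G i x) \<longlonglongrightarrow> x" "\<And>i x. norm (G i x) \<le> 2 * norm (x::'a)"
    by auto
  have Gm[measurable]: "G i \<in> borel_measurable borel" for i by (rule borel_measurable_simple_function[OF G(1)])
  obtain K where K: "K > 0" "\<And>x. N x \<le> K * norm x" using N_upper by blast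
  obtain k where k: "k > 0" "\<And>x. k * norm x \<le> N x" using N_lower by blast
  have hG: "h (G i x) \<le> (2 * K / k) powr p * h x" for i x
  proof -
    have "N (G i x) \<le> K * norm (G i x)" by (rule K)
    also have "\<dots> \<le> K * (2 * norm x)" using K G(3) by (intro mult_left_mono) auto
    also have "\<dots> = (2 * K / k) * (k * norm x)" using k by simp
    also have "\<dots> \<le> (2 * K / k) * N x" using k K by (intro mult_left_mono) auto
    finally have "h (G i x) \<le> ((2 * K / k) * N x) powr p" unfolding h_def using p1 by (intro powr_mono2) auto
    also have "\<dots> = (2 * K / k) powr p * h x" using k K by (simp add: h_def powr_mult[of "2 * K / k" "N x", symmetric])
    finally show ?thesis .
  qed
  have hd: "h (x - G i x) \<le> 2 powr (p - 1) * (h x + (2 * K / k) powr p * h x)" for i x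
    using h_diff_le[of x "G i x"] hG[of i x] by (smt (verit) mult_left_mono powr_ge_zero)
  note \<mu>m = P_measurable[OF \<mu>]
  define \<nu> where "\<nu> i = distr \<mu> borel (G i)" for i
  have "\<nu> i \<in> P" for i unfolding \<nu>_def
  proof (rule distr_in_P[OF \<mu> Gm])
    show "integrable \<mu> (\<lambda>x. h (G i x))"
      by (rule Bochner_Integration.integrable_bound[where f="\<lambda>x. (2 * K / k) powr p * h x"])
         (use hG PD[OF \<mu>] in \<open>auto intro!: \<mu>m\<close>)
  qed
  moreover have "\<exists>F. finite F \<and> (AE x in \<nu> i. x \<in> F)" for i
  proof (intro exI conjI)
    show "finite (range (G i))" using G(1)[of i] by (simp add: simple_function_def)
    hence "closed (range (G i))" by (rule finite_imp_closed)
    thus "AE x in \<nu> i. x \<in> range (G i)" unfolding \<nu>_def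
      by (subst AE_distr_iff) (auto intro!: \<mu>m)
  qed
  moreover have "(\<lambda>i. C \<mu> (\<nu> i)) \<longlonglongrightarrow> 0"
  proof (rule tendsto_sandwich)
    show "\<forall>\<^sub>F i in sequentially. 0 \<le> C \<mu> (\<nu> i)" by (simp add: C_nonneg)
    show "\<forall>\<^sub>F i in sequentially. C \<mu> (\<nu> i) \<le> (\<integral>x. h (x - G i x) \<partial>\<mu>)"
      using C_le_cost[OF map_coupling(1)[OF \<mu> Gm]] map_coupling(2)[OF \<mu> Gm] by (simp add: \<nu>_def)
    have "(\<lambda>i. \<integral>x. h (x - G i x) \<partial>\<mu>) \<longlonglongrightarrow> (\<integral>x. 0 \<partial>\<mu>)"
    proof (rule integral_dominated_convergence[where w="\<lambda>x. 2 powr (p - 1) * (h x + (2 * K / k) powr p * h x)"])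
      show "integrable \<mu> (\<lambda>x. 2 powr (p - 1) * (h x + (2 * K / k) powr p * h x))" using PD[OF \<mu>] by auto
      show "AE x in \<mu>. (\<lambda>i. h (x - G i x)) \<longlonglongrightarrow> 0"
      proof (rule AE_I2)
        fix x
        have "(\<lambda>i. h (x - G i x)) \<longlonglongrightarrow> h (x - x)" by (intro h_tendsto tendsto_diff tendsto_const G)
        thus "(\<lambda>i. h (x - G i x)) \<longlonglongrightarrow> 0" by simp
      qed
    qed (use hd in \<open>auto intro!: \<mu>m\<close>)
    thus "(\<lambda>i. \<integral>x. h (x - G i x) \<partial>\<mu>) \<longlonglongrightarrow> 0" by simp
  qed simp
  ultimately show ?thesis using that by blast
qed

subsection \<open>Dirac measures\<close>

lemma N_isometry_measurable:
  assumes "\<And>x y. N (f x - f y) = N (x - y)" shows "f \<in> borel_measurable borel"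
proof (rule borel_measurable_continuous_onI)
  obtain K where K: "K > 0" "\<And>x. N x \<le> K * norm x" using N_upper by blast
  obtain k where k: "k > 0" "\<And>x. k * norm x \<le> N x" using N_lower by blast
  have "norm (f x - f y) \<le> (K / k) * norm (x - y)" for x y
  proof -
    have "k * norm (f x - f y) \<le> K * norm (x - y)" using k(2)[of "f x - f y"] K(2)[of "x - y"] assms[of x y] by linarith
    thus ?thesis using k by (simp add: field_simps)
  qed
  hence "(K / k)-lipschitz_on UNIV f" using K k by (intro lipschitz_onI) (auto simp: dist_norm)
  thus "continuous_on UNIV f" by (rule lipschitz_on_continuous_on)
qed

text \<open>Pushing a coupling forward in both coordinates leaves its cost unchanged, which gives
  one inequality; the inverse map gives the other in \<open>pushforward_isometry\<close>.\<close>

lemma pushforward_isometry_le: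
  assumes f: "\<And>x y. N (f x - f y) = N (x - y)" and P: "\<mu> \<in> P" "\<nu> \<in> P"
  shows "distr \<mu> borel f \<in> P" and "C (distr \<mu> borel f) (distr \<nu> borel f) \<le> C \<mu> \<nu>"
proof -
  note fm[measurable] = N_isometry_measurable[OF f]
  have i: "distr m borel f \<in> P" if m: "m \<in> P" for m
  proof (rule distr_in_P[OF m fm])
    interpret prob_space m using PD[OF m] by simp
    show "integrable m (\<lambda>x. h (f x))"
    proof (rule Bochner_Integration.integrable_bound)
      show "integrable m (\<lambda>x. 2 powr (p - 1) * (h x + h (f 0)))" using PD[OF m] by auto
      show "AE x in m. norm (h (f x)) \<le> norm (2 powr (p - 1) * (h x + h (f 0)))"
        using h_add_le[of "f x - f 0" "f 0" for x] f[of x 0 for x] by (auto simp: h_def)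
    qed (intro P_measurable[OF m], measurable)
  qed
  show "distr \<mu> borel f \<in> P" by (rule i[OF P(1)])
  show "C (distr \<mu> borel f) (distr \<nu> borel f) \<le> C \<mu> \<nu>"
  proof (rule C_ge[OF P])
    fix \<pi> assume \<pi>: "\<pi> \<in> cpl \<mu> \<nu>"
    interpret prob_space \<pi> using cplD[OF \<pi>] by simp
    note [measurable_cong] = cplD(2)[OF \<pi>]
    let ?F = "\<lambda>z. (f (fst z), f (snd z))"
    let ?\<pi> = "distr \<pi> (borel \<Otimes>\<^sub>M borel) ?F"
    have 1: "distr ?\<pi> borel fst = distr (distr \<pi> borel fst) borel f"
      by (subst distr_distr, simp, simp, subst distr_distr) (auto simp: comp_def)
    have 2: "distr ?\<pi> borel snd = distr (distr \<pi> borel snd) borel f"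
      by (subst distr_distr, simp, simp, subst distr_distr) (auto simp: comp_def)
    have "?\<pi> \<in> cpl (distr \<mu> borel f) (distr \<nu> borel f)"
      using 1 2 by (auto simp: cpl_def cplD(3,4)[OF \<pi>] intro!: prob_space_distr)
    moreover have "cost ?\<pi> = cost \<pi>" unfolding cost_def
      by (subst integral_distr) (auto simp: h_def f)
    ultimately show "C (distr \<mu> borel f) (distr \<nu> borel f) \<le> cost \<pi>" using C_le_cost by metis
  qed
qed

lemma pushforward_inverse:
  assumes f: "\<And>x y. N (f x - f y) = N (x - y)" and g: "\<And>x y. N (g x - g y) = N (x - y)"
    and gf: "\<And>x. g (f x) = x" and P: "\<mu> \<in> P"
  shows "distr (distr \<mu> borel f) borel g = \<mu>"
proof -
  note [measurable] = N_isometry_measurable[OF f] N_isometry_measurable[OF g]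
  note [measurable_cong] = PD(2)[OF P]
  have "distr (distr \<mu> borel f) borel g = distr \<mu> borel (\<lambda>x. x)"
    by (subst distr_distr) (auto simp: comp_def gf)
  also have "\<dots> = \<mu>" by (rule distr_id2) (simp add: PD P)
  finally show ?thesis .
qed

lemma pushforward_isometry:
  assumes f: "\<And>x y. N (f x - f y) = N (x - y)" and g: "\<And>x y. N (g x - g y) = N (x - y)"
    and gf: "\<And>x. g (f x) = x" and P: "\<mu> \<in> P" "\<nu> \<in> P"
  shows "C (distr \<mu> borel f) (distr \<nu> borel f) = C \<mu> \<nu>"
proof (rule antisym)
  have "C (distr (distr \<mu> borel f) borel g) (distr (distr \<nu> borel f) borel g) \<le> C (distr \<mu> borel f) (distr \<nu> borel f)"
    by (rule pushforward_isometry_le[OF g]) (rule pushforward_isometry_le[OF f], use P in auto)+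
  thus "C \<mu> \<nu> \<le> C (distr \<mu> borel f) (distr \<nu> borel f)"
    by (simp add: pushforward_inverse[OF f g gf] P)
qed (rule pushforward_isometry_le[OF f P])

section \<open>Isometries and the Dirac measures\<close>

definition cost_isometry :: "('a measure \<Rightarrow> 'a measure) \<Rightarrow> bool" where
  "cost_isometry \<Phi> \<longleftrightarrow> bij_betw \<Phi> P P \<and> (\<forall>\<mu>\<in>P. \<forall>\<nu>\<in>P. C (\<Phi> \<mu>) (\<Phi> \<nu>) = C \<mu> \<nu>)"

lemma cost_isometryD:
  assumes "cost_isometry \<Phi>"
  shows "\<mu> \<in> P \<Longrightarrow> \<Phi> \<mu> \<in> P" "\<mu> \<in> P \<Longrightarrow> \<nu> \<in> P \<Longrightarrow> C (\<Phi> \<mu>) (\<Phi> \<nu>) = C \<mu> \<nu>" "bij_betw \<Phi> P P"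
  using assms by (auto simp: cost_isometry_def bij_betw_def)

lemma cost_isometry_inv:
  assumes "cost_isometry \<Phi>" shows "cost_isometry (inv_into P \<Phi>)"
    and "\<mu> \<in> P \<Longrightarrow> \<Phi> (inv_into P \<Phi> \<mu>) = \<mu>" "\<mu> \<in> P \<Longrightarrow> inv_into P \<Phi> (\<Phi> \<mu>) = \<mu>"
proof -
  note b = cost_isometryD(3)[OF assms]
  have 1: "\<Phi> (inv_into P \<Phi> \<mu>) = \<mu>" if "\<mu> \<in> P" for \<mu> using b that by (rule bij_betw_inv_into_right)
  have i: "bij_betw (inv_into P \<Phi>) P P" using b by (rule bij_betw_inv_into)
  show "\<mu> \<in> P \<Longrightarrow> \<Phi> (inv_into P \<Phi> \<mu>) = \<mu>" by (rule 1)
  show "\<mu> \<in> P \<Longrightarrow> inv_into P \<Phi> (\<Phi> \<mu>) = \<mu>" using b by (rule bij_betw_inv_into_left)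
  have "inv_into P \<Phi> \<mu> \<in> P" if "\<mu> \<in> P" for \<mu> using i that by (auto simp: bij_betw_def)
  hence "C (inv_into P \<Phi> \<mu>) (inv_into P \<Phi> \<nu>) = C \<mu> \<nu>" if "\<mu> \<in> P" "\<nu> \<in> P" for \<mu> \<nu>
    using cost_isometryD(2)[OF assms, of "inv_into P \<Phi> \<mu>" "inv_into P \<Phi> \<nu>"] that by (simp add: 1)
  thus "cost_isometry (inv_into P \<Phi>)" unfolding cost_isometry_def using i by blast
qed

lemma isometry_of_cost_isometry:
  assumes "isometry_of (wasserstein_space p UNIV (norm_dist N)) (wasserstein_dist p UNIV (norm_dist N)) \<Phi>"
  shows "cost_isometry \<Phi>"
  using assms by (auto simp: isometry_of_def cost_isometry_def wasserstein_space_eq C_def)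

lemma C_return_return: "C (return borel x) (return borel y) = h (x - y)"
  by (subst C_return[OF return_in_P], subst integral_return) auto

lemma return_inj: "return borel x = (return borel y :: 'a measure) \<longleftrightarrow> x = y"
  using C_return_return[of x y] C_return_return[of x x] by auto

end

locale strict_cost = power_cost +
  assumes strict: "strictly_convex_norm N"
begin

text \<open>The unit vectors \<open>?u\<close> and \<open>?v\<close> have a sum of norm less than 2.
  As \<open>N x <= N y\<close>, the rest of \<open>x + y\<close> is a nonnegative multiple of
  \<open>?v\<close>, for which the ordinary triangle inequality is enough.\<close>

lemma N_add_strict:
  assumes "x \<noteq> 0" "N x \<le> N y" "N y *\<^sub>R x \<noteq> N x *\<^sub>R y"
  shows "N (x + y) < N x + N y"
proof -
  have pos: "0 < N x" "0 < N y" using assms(1,2) N_pos[of x] less_le_trans[of 0 "N x" "N y"] by blast+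
  let ?u = "(1 / N x) *\<^sub>R x" and ?v = "(1 / N y) *\<^sub>R y"
  have "N ?u = 1" "N ?v = 1" using pos by (auto simp: N_scale)
  moreover have "?u \<noteq> ?v"
  proof
    assume "?u = ?v"
    hence "(N x * N y) *\<^sub>R ?u = (N x * N y) *\<^sub>R ?v" by simp
    thus False using assms(3) pos by simp
  qed
  ultimately have "N ((1/2) *\<^sub>R (?u + ?v)) < 1" using strict by (auto simp: strictly_convex_norm_def)
  hence "N (?u + ?v) < 2" by (simp add: N_scale)
  moreover have "x + y = N x *\<^sub>R (?u + ?v) + (N y - N x) *\<^sub>R ?v"
    using pos by (simp add: algebra_simps)
  hence "N (x + y) \<le> N x * N (?u + ?v) + (N y - N x) * N ?v"
    using N_triangle[of "N x *\<^sub>R (?u + ?v)" "(N y - N x) *\<^sub>R ?v"] assms(2) pos by (simp only: N_scale)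
  moreover have "N x * N (?u + ?v) < N x * 2" using calculation(1) pos by (intro mult_strict_left_mono) auto
  ultimately show ?thesis using \<open>N ?v = 1\<close> by simp
qed

lemma N_add_eq:
  assumes "N (x + y) = N x + N y" shows "N y *\<^sub>R x = N x *\<^sub>R y"
proof (cases "x = 0 \<or> y = 0")
  case False
  consider "N x \<le> N y" | "N y \<le> N x" by linarith
  thus ?thesis
  proof cases
    case 1 thus ?thesis using N_add_strict[of x y] assms False by force
  next
    case 2 thus ?thesis using N_add_strict[of y x] assms False by (force simp: add.commute)
  qed
qed auto

text \<open>\<open>h_add_le\<close> chains the triangle inequality with convexity of the power, and
  equality overall leaves no slack in the first link. Equality of \<open>N u\<close> and
  \<open>N w\<close> is not to be expected, since \<open>p = 1\<close> is included.\<close>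

lemma h_add_eq:
  assumes "h (u + w) = 2 powr (p - 1) * (h u + h w)"
  shows "N (u + w) = N u + N w"
proof (rule ccontr)
  assume "N (u + w) \<noteq> N u + N w"
  hence "N (u + w) < N u + N w" using N_triangle[of u w] by simp
  hence "h (u + w) < (N u + N w) powr p" unfolding h_def using p1 by (intro powr_less_mono2) auto
  also have "\<dots> = 2 powr p * ((N u + N w) / 2) powr p" by (simp add: powr_divide)
  also have "\<dots> \<le> 2 powr p * ((1 - 1/2) * h u + (1/2) * h w)"
    using powr_convex_comb[of p "N u" "N w" "1/2"] p1 unfolding h_def
    by (intro mult_left_mono) (auto simp: add_divide_distrib)
  also have "\<dots> = 2 powr (p - 1) * (h u + h w)" by (simp add: powr_diff algebra_simps)
  finally show False using assms by simp
qed

text \<open>The failing \<open>\<nu>\<close> is the Dirac measure at the midpoint of two points of the support: equality in the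
  convexity estimate would force every point of the support of \<open>\<rho>\<close> onto two opposite rays from it.\<close>

lemma Dirac_characterization:
  assumes \<mu>: "\<mu> \<in> P"
    and doubling: "\<And>\<nu>. \<nu> \<in> P \<Longrightarrow> \<exists>\<rho>\<in>P. C \<mu> \<rho> = 2 powr p * C \<mu> \<nu> \<and> C \<nu> \<rho> = C \<mu> \<nu>"
  shows "\<exists>a. \<mu> = return borel a"
proof (rule ccontr)
  assume nd: "\<nexists>a. \<mu> = return borel a"
  obtain a where a: "a \<in> supp \<mu>" using supp_nonempty[OF \<mu>] by auto
  have "\<exists>b\<in>supp \<mu>. b \<noteq> a"
  proof (rule ccontr)
    assume "\<not> (\<exists>b\<in>supp \<mu>. b \<noteq> a)"
    hence "AE x in \<mu>. x = a" using P_AE_supp[OF \<mu>] by (auto elim!: eventually_mono)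
    thus False using eq_return_iff[OF \<mu>] nd by blast
  qed
  then obtain b where b: "b \<in> supp \<mu>" "b \<noteq> a" by blast
  define y where "y = (1/2) *\<^sub>R (a + b)"
  define v where "v = (1/2) *\<^sub>R (b - a)"
  have v: "v \<noteq> 0" "a = y - v" "b = y + v" using b
    by (auto simp: v_def y_def algebra_simps simp flip: scaleR_add_left)
  define M where "M = (\<integral>x. h (x - y) \<partial>\<mu>)"
  obtain \<rho> where \<rho>: "\<rho> \<in> P" "C \<mu> \<rho> = 2 powr p * M" "C (return borel y) \<rho> = M"
    using doubling[OF return_in_P[of y]] by (auto simp: M_def C_return[OF \<mu>])
  interpret M: prob_space \<mu> using PD[OF \<mu>] by simp
  interpret R: prob_space \<rho> using PD[OF \<rho>(1)] by simp
  interpret pair_prob_space \<mu> \<rho> ..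
  have \<pi>: "\<mu> \<Otimes>\<^sub>M \<rho> \<in> cpl \<mu> \<rho>" by (rule product_coupling[OF \<mu> \<rho>(1)])
  have \<rho>M: "(\<integral>x. h (x - y) \<partial>\<rho>) = M" using \<rho>(3) C_return'[OF \<rho>(1)] by simp
  let ?g = "\<lambda>z. 2 powr (p - 1) * (h (fst z - y) + h (y - snd z)) - h (fst z - snd z)"
  have i1: "integrable (\<mu> \<Otimes>\<^sub>M \<rho>) (\<lambda>z. h (fst z - y))"
    by (rule cpl_integrable(1)[OF \<pi>, of "\<lambda>x. h (x - y)"]) (auto intro: P_integrable_shift \<mu>)
  have i2: "integrable (\<mu> \<Otimes>\<^sub>M \<rho>) (\<lambda>z. h (snd z - y))"
    by (rule cpl_integrable(2)[OF \<pi>, of "\<lambda>x. h (x - y)"]) (auto intro: P_integrable_shift \<rho>)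
  have i2': "integrable (\<mu> \<Otimes>\<^sub>M \<rho>) (\<lambda>z. h (y - snd z))" using i2 by (simp add: h_diff_commute)
  note i3 = cost_integrable[OF \<pi> \<mu> \<rho>(1)]
  have g0: "0 \<le> ?g z" for z using h_add_le[of "fst z - y" "y - snd z"] by simp
  have e1: "(\<integral>z. h (fst z - y) \<partial>(\<mu> \<Otimes>\<^sub>M \<rho>)) = M"
    unfolding M_def by (rule cpl_integral(1)[OF \<pi>, of "\<lambda>x. h (x - y)"]) measurable
  have "(\<integral>z. h (snd z - y) \<partial>(\<mu> \<Otimes>\<^sub>M \<rho>)) = M"
    using cpl_integral(2)[OF \<pi>, of "\<lambda>x. h (x - y)"] \<rho>M by simp
  hence e2: "(\<integral>z. h (y - snd z) \<partial>(\<mu> \<Otimes>\<^sub>M \<rho>)) = M" by (simp add: h_diff_commute)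
  have "(\<integral>z. ?g z \<partial>(\<mu> \<Otimes>\<^sub>M \<rho>)) = 2 powr (p - 1) * (M + M) - cost (\<mu> \<Otimes>\<^sub>M \<rho>)"
    using i1 i2' i3 by (simp add: cost_def e1 e2)
  \<comment> \<open>The doubling equations make the first term equal to
    \<open>C \<mu> \<rho>\<close>, which no coupling undercuts; hence the pointwise nonnegative
    \<open>?g\<close> has vanishing integral.\<close>
  also have "\<dots> \<le> 0" using C_le_cost[OF \<pi>] \<rho>(2) by (simp add: powr_diff)
  finally have "(\<integral>z. ?g z \<partial>(\<mu> \<Otimes>\<^sub>M \<rho>)) = 0"
    using g0 by (intro antisym Bochner_Integration.integral_nonneg) auto
  hence ae: "AE z in \<mu> \<Otimes>\<^sub>M \<rho>. ?g z = 0"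
    using i1 i2' i3 g0 by (subst (asm) integral_nonneg_eq_0_iff_AE) auto
  have cl: "closed {z. ?g z = 0}"
    by (intro closed_Collect_eq continuous_intros h_continuous_on_comp)
  have "w = y" if w: "w \<in> supp \<rho>" for w
  proof -
    have "N ((a - y) + (y - w)) = N (a - y) + N (y - w)" "N ((b - y) + (y - w)) = N (b - y) + N (y - w)"
      by (rule h_add_eq,
          use supp_product[OF \<mu> \<rho>(1) cl ae a w] supp_product[OF \<mu> \<rho>(1) cl ae b(1) w] in simp)+
    from this[THEN N_add_eq] have "N (y - w) *\<^sub>R (- v) = N v *\<^sub>R (y - w)" "N (y - w) *\<^sub>R v = N v *\<^sub>R (y - w)"
      using v by auto
    hence "N v *\<^sub>R (y - w) = - (N v *\<^sub>R (y - w))" by (metis scaleR_minus_right)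
    hence "2 *\<^sub>R (N v *\<^sub>R (y - w)) = 0" unfolding scaleR_2 by (metis add.left_inverse)
    hence "N v *\<^sub>R (y - w) = 0" by simp
    thus "w = y" using v by simp
  qed
  hence "AE x in \<rho>. x = y" using P_AE_supp[OF \<rho>(1)] by (auto elim!: eventually_mono)
  hence "\<rho> = return borel y" by (rule eq_return_iff[OF \<rho>(1)])
  hence "M = 0" using \<rho>M by (simp add: integral_return)
  hence "AE x in \<mu>. h (x - y) = 0" unfolding M_def
    by (subst (asm) integral_nonneg_eq_0_iff_AE) (auto intro: P_integrable_shift \<mu>)
  hence "AE x in \<mu>. x = y" by auto
  thus False using eq_return_iff[OF \<mu>] nd by blast
qed

text \<open>The doubling property is expressed by \<open>C\<close> alone, so \<open>\<Phi>\<close>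
  transports it; the inverse writes an arbitrary test measure as an image.\<close>

lemma cost_isometry_return:
  assumes \<Phi>: "cost_isometry \<Phi>" shows "\<exists>a. \<Phi> (return borel x) = return borel a"
proof (rule Dirac_characterization)
  note D = cost_isometryD[OF \<Phi>] and I = cost_isometry_inv[OF \<Phi>]
  show "\<Phi> (return borel x) \<in> P" by (intro D return_in_P)
  fix \<nu> assume \<nu>: "\<nu> \<in> P"
  define \<nu>' where "\<nu>' = inv_into P \<Phi> \<nu>"
  have \<nu>': "\<nu>' \<in> P" "\<nu> = \<Phi> \<nu>'" using \<nu> I cost_isometryD(1)[OF I(1)] by (auto simp: \<nu>'_def)
  obtain \<rho> where "\<rho> \<in> P" "C (return borel x) \<rho> = 2 powr p * C (return borel x) \<nu>'" "C \<nu>' \<rho> = C (return borel x) \<nu>'"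
    using return_doubling[OF \<nu>'(1)] by blast
  thus "\<exists>\<rho>\<in>P. C (\<Phi> (return borel x)) \<rho> = 2 powr p * C (\<Phi> (return borel x)) \<nu> \<and> C \<nu> \<rho> = C (\<Phi> (return borel x)) \<nu>"
    using \<nu>' by (intro bexI[of _ "\<Phi> \<rho>"]) (auto simp: D return_in_P)
qed

lemma rigid_if_Dirac_fixing_trivial:
  assumes key: "\<And>\<Psi> \<mu>. cost_isometry \<Psi> \<Longrightarrow> (\<And>x. \<Psi> (return borel x) = return borel x) \<Longrightarrow> \<mu> \<in> P \<Longrightarrow> \<Psi> \<mu> = \<mu>"
  shows "isometrically_rigid p UNIV (norm_dist N)"
  unfolding isometrically_rigid_def
proof (intro allI impI)
  fix \<Phi> assume "isometry_of (wasserstein_space p UNIV (norm_dist N)) (wasserstein_dist p UNIV (norm_dist N)) \<Phi>"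
  hence \<Phi>: "cost_isometry \<Phi>" by (rule isometry_of_cost_isometry)
  let ?\<Phi>' = "inv_into P \<Phi>"
  note D = cost_isometryD[OF \<Phi>] and I = cost_isometry_inv[OF \<Phi>] and D' = cost_isometryD[OF cost_isometry_inv(1)[OF \<Phi>]]
  define f where "f x = (SOME a. \<Phi> (return borel x) = return borel a)" for x
  define g where "g x = (SOME a. ?\<Phi>' (return borel x) = return borel a)" for x
  have f: "\<Phi> (return borel x) = return borel (f x)" for x
    unfolding f_def by (rule someI_ex[OF cost_isometry_return[OF \<Phi>]])
  have g: "?\<Phi>' (return borel x) = return borel (g x)" for x
    unfolding g_def by (rule someI_ex[OF cost_isometry_return[OF I(1)]])
  have gf: "g (f x) = x" for x using I(3)[OF return_in_P[of x]] f[of x] g[of "f x"] by (simp add: return_inj)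
  have fg: "f (g x) = x" for x using I(2)[OF return_in_P[of x]] g[of x] f[of "g x"] by (simp add: return_inj)
  have hN: "h x = h y \<Longrightarrow> N x = N y" for x y
    unfolding h_def using p1 powr_less_mono2[of p "N x" "N y"] powr_less_mono2[of p "N y" "N x"]
    by (cases "N x" "N y" rule: linorder_cases) auto
  have fN: "N (f x - f y) = N (x - y)" for x y
    by (rule hN) (use D(2)[OF return_in_P return_in_P, of x y] in \<open>simp add: f C_return_return\<close>)
  have gN: "N (g x - g y) = N (x - y)" for x y
    by (rule hN) (use D'(2)[OF return_in_P return_in_P, of x y] in \<open>simp add: g C_return_return\<close>)
  \<comment> \<open>Since \<open>g\<close> inverts the map \<open>f\<close> induced on points, this
    composition is a cost isometry that fixes all Dirac measures.\<close>
  define \<Psi> where "\<Psi> \<mu> = distr (\<Phi> \<mu>) borel g" for \<mu>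
  have \<Psi>P: "\<Psi> \<mu> \<in> P" if "\<mu> \<in> P" for \<mu>
    unfolding \<Psi>_def using pushforward_isometry_le(1)[OF gN] D(1) that by auto
  have "cost_isometry \<Psi>" unfolding cost_isometry_def
  proof (intro conjI ballI)
    show "bij_betw \<Psi> P P"
    proof (rule bij_betw_byWitness[where f'="\<lambda>\<mu>. ?\<Phi>' (distr \<mu> borel f)"])
      have fP: "distr \<mu> borel f \<in> P" if "\<mu> \<in> P" for \<mu> using pushforward_isometry_le(1)[OF fN] that by auto
      show "\<forall>\<mu>\<in>P. ?\<Phi>' (distr (\<Psi> \<mu>) borel f) = \<mu>"
        unfolding \<Psi>_def using pushforward_inverse[OF gN fN fg] D(1) I(3) by auto
      show "\<forall>\<mu>\<in>P. \<Psi> (?\<Phi>' (distr \<mu> borel f)) = \<mu>"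
        unfolding \<Psi>_def using pushforward_inverse[OF fN gN gf] I(2) fP by auto
      show "\<Psi> ` P \<subseteq> P" using \<Psi>P by auto
      show "(\<lambda>\<mu>. ?\<Phi>' (distr \<mu> borel f)) ` P \<subseteq> P" using D'(1) fP by auto
    qed
    fix \<mu> \<nu> assume "\<mu> \<in> P" "\<nu> \<in> P"
    thus "C (\<Psi> \<mu>) (\<Psi> \<nu>) = C \<mu> \<nu>" unfolding \<Psi>_def using pushforward_isometry[OF gN fN fg] D by auto
  qed
  moreover have "\<Psi> (return borel x) = return borel x" for x
    unfolding \<Psi>_def f using N_isometry_measurable[OF gN] by (subst distr_return) (auto simp: gf)
  ultimately have \<Psi>: "\<Psi> \<mu> = \<mu>" if "\<mu> \<in> P" for \<mu> using key that by blast
  have "\<Phi> \<mu> = distr \<mu> (metric_borel UNIV (norm_dist N)) f" if \<mu>: "\<mu> \<in> P" for \<mu>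
  proof -
    have "\<Phi> \<mu> = distr (\<Psi> \<mu>) borel f" unfolding \<Psi>_def using pushforward_inverse[OF gN fN fg] D(1)[OF \<mu>] by simp
    also have "\<dots> = distr \<mu> (metric_borel UNIV (norm_dist N)) f"
      using \<Psi>[OF \<mu>] by (intro distr_cong) (auto simp: sets_metric_borel)
    finally show ?thesis .
  qed
  moreover have "isometry_of UNIV (norm_dist N) f"
    using fN gf fg by (auto simp: isometry_of_def norm_dist_def intro!: bij_betw_byWitness[where f'=g])
  ultimately show "\<exists>\<phi>. isometry_of UNIV (norm_dist N) \<phi> \<and>
      (\<forall>\<mu>\<in>wasserstein_space p UNIV (norm_dist N). \<Phi> \<mu> = distr \<mu> (metric_borel UNIV (norm_dist N)) \<phi>)"
    by (auto simp: wasserstein_space_eq)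
qed

end

context power_cost begin

subsection \<open>Two-point measures as test measures\<close>

definition two :: "real \<Rightarrow> 'a \<Rightarrow> 'a \<Rightarrow> 'a measure" where
  "two \<alpha> a b = distr (measure_pmf (bernoulli_pmf \<alpha>)) borel (\<lambda>c. if c then b else a)"

lemma integral_two:
  assumes "0 \<le> \<alpha>" "\<alpha> \<le> 1" and [measurable]: "f \<in> borel_measurable borel"
  shows "(\<integral>x. f x \<partial>two \<alpha> a b) = \<alpha> * f b + (1 - \<alpha>) * (f a :: real)"
  unfolding two_def using assms(1,2) by (subst integral_distr) auto

lemma nn_integral_two:
  assumes "0 \<le> \<alpha>" "\<alpha> \<le> 1" and [measurable]: "f \<in> borel_measurable borel"
  shows "(\<integral>\<^sup>+x. f x \<partial>two \<alpha> a b) = ennreal \<alpha> * f b + ennreal (1 - \<alpha>) * f a"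
  unfolding two_def using assms(1,2) by (subst nn_integral_distr) (auto simp: mult.commute)

lemma sets_two [simp]: "sets (two \<alpha> a b) = sets borel"
  by (simp add: two_def)

lemma prob_two: "prob_space (two \<alpha> a b)"
  unfolding two_def by (intro prob_space.prob_space_distr measure_pmf.prob_space_axioms) auto

lemma integrable_two: "f \<in> borel_measurable borel \<Longrightarrow> integrable (two \<alpha> a b) (f :: 'a \<Rightarrow> real)"
  unfolding two_def by (subst integrable_distr_eq) (auto intro!: integrable_measure_pmf_finite)

lemma two_in_P: "two \<alpha> a b \<in> P"
  by (auto simp: P_def prob_two intro: integrable_two)

lemma AE_two: "AE x in two \<alpha> a b. x \<in> {a, b}"
  unfolding two_def by (subst AE_distr_iff) auto

lemma measure_two:
  assumes "0 \<le> \<alpha>" "\<alpha> \<le> 1" "A \<in> sets borel"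
  shows "measure (two \<alpha> a b) A = \<alpha> * indicator A b + (1 - \<alpha>) * indicator A a"
  using integral_two[of \<alpha> "indicator A" a b] assms two_in_P[of \<alpha> a b] by (auto simp: PD(4))

lemma in_supp_two:
  assumes "0 < \<alpha>" "\<alpha> < 1" shows "a \<in> supp (two \<alpha> a b)" "b \<in> supp (two \<alpha> a b)"
proof -
  interpret prob_space "two \<alpha> a b" by (rule prob_two)
  have "emeasure (two \<alpha> a b) S \<noteq> 0" if "open S" "a \<in> S \<or> b \<in> S" for S
    using that assms measure_two[of \<alpha> S a b] by (auto simp: emeasure_eq_measure indicator_def split: if_splits)
  thus "a \<in> supp (two \<alpha> a b)" "b \<in> supp (two \<alpha> a b)" by (auto simp: supp_def)
qed

lemma two_eqI:
  assumes "\<nu> \<in> P" "0 \<le> \<alpha>" "\<alpha> \<le> 1" "a \<noteq> b" "AE x in \<nu>. x \<in> {a, b}" "measure \<nu> {b} = \<alpha>"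
  shows "\<nu> = two \<alpha> a b"
proof (rule finite_measure_eqI[symmetric])
  interpret prob_space \<nu> using PD[OF assms(1)] by simp
  have "measure \<nu> {a, b} = 1" using assms by (subst prob_eq_1) (auto simp: PD)
  moreover have "measure \<nu> {a, b} = measure \<nu> {a} + measure \<nu> {b}"
    using assms finite_measure_Union[of "{a}" "{b}"] by (simp add: PD insert_commute)
  ultimately have "measure \<nu> {a} = 1 - \<alpha>" using assms by simp
  thus "measure (two \<alpha> a b) {x} = measure \<nu> {x}" if "x \<in> {a, b}" for x
    using that assms by (auto simp: measure_two)
qed (use assms two_in_P in auto)

definition T :: "'a measure \<Rightarrow> 'a \<Rightarrow> real" where "T \<mu> a = (\<integral>x. h (x - a) \<partial>\<mu>)"

text \<open>Extra cost of sending mass at \<open>x\<close> to \<open>b\<close> rather than to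
  \<open>a\<close>; cheap transport to a two-point measure sends the points of small
  \<open>\<beta>\<close> to \<open>b\<close>.\<close>

definition \<beta> :: "'a \<Rightarrow> 'a \<Rightarrow> 'a \<Rightarrow> real" where "\<beta> a b x = h (x - b) - h (x - a)"

text \<open>As \<open>c\<close> varies, the lower bounds of \<open>C_two_lower\<close> form a
  Legendre transform of \<open>U\<close> in the weight \<open>\<alpha>\<close>.\<close>

definition U :: "'a measure \<Rightarrow> 'a \<Rightarrow> 'a \<Rightarrow> real \<Rightarrow> real" where
  "U \<mu> a b c = (\<integral>x. max 0 (c - \<beta> a b x) \<partial>\<mu>)"

lemma \<beta>_measurable [measurable]: "\<beta> a b \<in> borel_measurable borel"
  unfolding \<beta>_def[abs_def] by measurable

lemma \<beta>_integrable: "\<mu> \<in> P \<Longrightarrow> integrable \<mu> (\<beta> a b)"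
  unfolding \<beta>_def[abs_def] by (intro Bochner_Integration.integrable_diff P_integrable_shift)

lemma U_integrable: assumes \<mu>: "\<mu> \<in> P" shows "integrable \<mu> (\<lambda>x. max 0 (c - \<beta> a b x))"
proof (rule Bochner_Integration.integrable_bound)
  interpret prob_space \<mu> using PD[OF \<mu>] by simp
  show "integrable \<mu> (\<lambda>x. \<bar>c\<bar> + \<bar>\<beta> a b x\<bar>)" using \<beta>_integrable[OF \<mu>] by auto
  show "(\<lambda>x. max 0 (c - \<beta> a b x)) \<in> borel_measurable \<mu>" by (rule P_measurable[OF \<mu>]) measurable
qed auto

text \<open>The coupling sends the fraction \<open>s\<close> of the mass in \<open>A\<close> to
  \<open>b\<close> and everything else to \<open>a\<close>, which forces
  \<open>\<alpha> = s * measure \<nu> A\<close>. Taking \<open>s < 1\<close> keeps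
  \<open>\<alpha> < 1\<close> and the density bounded.\<close>

lemma C_two_upper:
  assumes \<nu>: "\<nu> \<in> P" and ab: "a \<noteq> b" and A[measurable]: "A \<in> sets borel" and s: "0 < s" "s < 1"
    and \<alpha>: "\<alpha> = s * measure \<nu> A" "0 < \<alpha>"
  shows "C \<nu> (two \<alpha> a b) \<le> T \<nu> a + s * (\<integral>x. indicator A x * \<beta> a b x \<partial>\<nu>)"
proof -
  interpret Nu: prob_space \<nu> using PD[OF \<nu>] by simp
  interpret S: prob_space "two \<alpha> a b" by (rule prob_two)
  interpret pair_prob_space \<nu> "two \<alpha> a b" ..
  note [measurable_cong] = PD(2)[OF \<nu>] sets_two
  have \<alpha>1: "\<alpha> < 1"
  proof -
    have "s * measure \<nu> A \<le> s * 1" using s by (intro mult_left_mono) auto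
    thus ?thesis using s \<alpha> by linarith
  qed
  \<comment> \<open>Density of this coupling with respect to the product: the conditional
    probability of the target point divided by its weight.\<close>
  define k where "k z = (if snd z = b then s * indicator A (fst z) / \<alpha> else (1 - s * indicator A (fst z)) / (1 - \<alpha>))"
    for z :: "'a \<times> 'a"
  have km[measurable]: "k \<in> borel_measurable (borel \<Otimes>\<^sub>M borel)" unfolding k_def[abs_def] by measurable
  have k0: "0 \<le> k z" for z using s \<alpha> \<alpha>1 by (auto simp: k_def indicator_def)
  have kB: "k z \<le> 1 / \<alpha> + 1 / (1 - \<alpha>)" for z
  proof -
    have "k z \<le> 1 / \<alpha> \<or> k z \<le> 1 / (1 - \<alpha>)"
      using s \<alpha>(2) \<alpha>1 by (auto simp: k_def indicator_def intro!: divide_right_mono)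
    thus ?thesis using \<alpha>(2) \<alpha>1 by (smt (verit) divide_pos_pos)
  qed
  have i1: "(\<integral>\<^sup>+y. ennreal (k (x, y)) \<partial>two \<alpha> a b) = 1" for x
  proof -
    have "(\<integral>\<^sup>+y. ennreal (k (x, y)) \<partial>two \<alpha> a b) = ennreal \<alpha> * ennreal (k (x, b)) + ennreal (1 - \<alpha>) * ennreal (k (x, a))"
      using \<alpha> \<alpha>1 by (subst nn_integral_two) auto
    also have "\<dots> = ennreal (\<alpha> * k (x, b) + (1 - \<alpha>) * k (x, a))"
      using \<alpha> \<alpha>1 k0 by (simp add: ennreal_mult ennreal_plus)
    also have "\<alpha> * k (x, b) + (1 - \<alpha>) * k (x, a) = 1" using \<alpha>(2) \<alpha>1 ab by (simp add: k_def)
    finally show ?thesis by simp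
  qed
  have mA: "(\<integral>x. indicator A x \<partial>\<nu>) = measure \<nu> A" by (simp add: PD[OF \<nu>])
  have i2: "(\<integral>\<^sup>+x. ennreal (k (x, y)) \<partial>\<nu>) = 1" for y
  proof -
    have kb: "integrable \<nu> (\<lambda>x. k (x, y))"
      by (rule Nu.integrable_const_bound[where B="1 / \<alpha> + 1 / (1 - \<alpha>)"]) (auto simp: k0 kB)
    have "(\<integral>x. k (x, y) \<partial>\<nu>) = 1"
    proof (cases "y = b")
      case True
      have "(\<integral>x. k (x, y) \<partial>\<nu>) = (\<integral>x. (s / \<alpha>) * indicator A x \<partial>\<nu>)"
        using True by (intro Bochner_Integration.integral_cong) (auto simp: k_def)
      also have "\<dots> = (s / \<alpha>) * measure \<nu> A" by (simp only: integral_mult_right_zero mA)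
      also have "\<dots> = (s * measure \<nu> A) / \<alpha>" by simp
      also have "\<dots> = 1" using \<alpha>(2) by (simp add: \<alpha>(1)[symmetric])
      finally show ?thesis .
    next
      case False
      have "integrable \<nu> (\<lambda>x. indicator A x :: real)"
        by (rule Nu.integrable_const_bound[where B=1]) (auto simp: indicator_def)
      hence "integrable \<nu> (\<lambda>x. s * indicator A x)" by (rule integrable_mult_right)
      from Bochner_Integration.integral_diff[OF Nu.integrable_const this, of 1]
      have "(\<integral>x. 1 - s * indicator A x \<partial>\<nu>) = 1 - s * measure \<nu> A"
        by (simp only: mA Nu.prob_space lebesgue_integral_const integral_mult_right_zero scaleR_one)
      hence "(\<integral>x. k (x, y) \<partial>\<nu>) = (1 - s * measure \<nu> A) / (1 - \<alpha>)"
        using False by (simp add: k_def)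
      thus ?thesis using \<alpha> \<alpha>1 by simp
    qed
    thus ?thesis using nn_integral_eq_integral[OF kb] k0 by simp
  qed
  note dc = density_coupling[OF \<nu> two_in_P km k0 i1 i2]
  have hi: "integrable (\<nu> \<Otimes>\<^sub>M two \<alpha> a b) (\<lambda>z. h (fst z - snd z))"
    by (rule cost_integrable[OF product_coupling[OF \<nu> two_in_P] \<nu> two_in_P])
  have "integrable (\<nu> \<Otimes>\<^sub>M two \<alpha> a b) (\<lambda>z. k z * h (fst z - snd z))"
  proof (rule Bochner_Integration.integrable_bound)
    show "integrable (\<nu> \<Otimes>\<^sub>M two \<alpha> a b) (\<lambda>z. (1 / \<alpha> + 1 / (1 - \<alpha>)) * h (fst z - snd z))" using hi by auto
    show "(\<lambda>z. k z * h (fst z - snd z)) \<in> borel_measurable (\<nu> \<Otimes>\<^sub>M two \<alpha> a b)" by measurable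
    show "AE z in \<nu> \<Otimes>\<^sub>M two \<alpha> a b. norm (k z * h (fst z - snd z)) \<le> norm ((1 / \<alpha> + 1 / (1 - \<alpha>)) * h (fst z - snd z))"
    proof (rule AE_I2)
      fix z
      have "k z * h (fst z - snd z) \<le> (1 / \<alpha> + 1 / (1 - \<alpha>)) * h (fst z - snd z)" by (rule mult_right_mono[OF kB h_nonneg])
      moreover have "0 \<le> k z * h (fst z - snd z)" using k0 by simp
      ultimately show "norm (k z * h (fst z - snd z)) \<le> norm ((1 / \<alpha> + 1 / (1 - \<alpha>)) * h (fst z - snd z))" unfolding real_norm_def by linarith
    qed
  qed
  hence "(\<integral>z. k z * h (fst z - snd z) \<partial>(\<nu> \<Otimes>\<^sub>M two \<alpha> a b)) = (\<integral>x. \<integral>y. k (x, y) * h (x - y) \<partial>two \<alpha> a b \<partial>\<nu>)"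
    by (subst integral_fst'[symmetric]) auto
  also have "\<dots> = (\<integral>x. h (x - a) + s * (indicator A x * \<beta> a b x) \<partial>\<nu>)"
  proof (intro Bochner_Integration.integral_cong refl)
    fix x
    have "(\<integral>y. k (x, y) * h (x - y) \<partial>two \<alpha> a b) = \<alpha> * (k (x, b) * h (x - b)) + (1 - \<alpha>) * (k (x, a) * h (x - a))"
      using \<alpha>(2) \<alpha>1 by (subst integral_two) auto
    also have "\<dots> = h (x - a) + s * (indicator A x * \<beta> a b x)"
    proof -
      have kk: "\<alpha> * k (x, b) = s * indicator A x" "(1 - \<alpha>) * k (x, a) = 1 - s * indicator A x"
        using ab \<alpha>(2) \<alpha>1 by (auto simp: k_def)
      have "\<alpha> * (k (x, b) * h (x - b)) + (1 - \<alpha>) * (k (x, a) * h (x - a)) =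
        (\<alpha> * k (x, b)) * h (x - b) + ((1 - \<alpha>) * k (x, a)) * h (x - a)" by simp
      also have "\<dots> = h (x - a) + s * (indicator A x * \<beta> a b x)"
        unfolding kk by (simp add: \<beta>_def algebra_simps)
      finally show ?thesis .
    qed
    finally show "(\<integral>y. k (x, y) * h (x - y) \<partial>two \<alpha> a b) = h (x - a) + s * (indicator A x * \<beta> a b x)" .
  qed
  also have "\<dots> = T \<nu> a + s * (\<integral>x. indicator A x * \<beta> a b x \<partial>\<nu>)"
  proof -
    have "integrable \<nu> (\<lambda>x. indicator A x * \<beta> a b x)"
      using integrable_mult_indicator[of A \<nu> "\<beta> a b"] \<beta>_integrable[OF \<nu>, of a b] A by (simp add: PD[OF \<nu>])
    thus ?thesis unfolding T_def using P_integrable_shift[OF \<nu>, of a] by simp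
  qed
  finally show ?thesis using C_le_cost[OF dc(1)] dc(2) by simp
qed

text \<open>Kantorovich duality with the potential \<open>c\<close> at \<open>b\<close> and 0 at
  \<open>a\<close>: for \<open>y\<close> in \<open>{a, b}\<close> the dual integrand stays below
  \<open>h (x - y)\<close> pointwise.\<close>

lemma C_two_lower:
  assumes \<mu>: "\<mu> \<in> P" and ab: "a \<noteq> b" and \<alpha>: "0 \<le> \<alpha>" "\<alpha> \<le> 1"
  shows "T \<mu> a + c * \<alpha> - U \<mu> a b c \<le> C \<mu> (two \<alpha> a b)"
proof (rule C_ge[OF \<mu> two_in_P])
  fix \<pi> assume \<pi>: "\<pi> \<in> cpl \<mu> (two \<alpha> a b)"
  interpret prob_space \<pi> using cplD[OF \<pi>] by simp
  have ae: "AE z in \<pi>. snd z \<in> {a, b}"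
    by (rule cpl_AE(2)[OF \<pi> _ AE_two]) auto
  have e1: "(\<integral>z. h (fst z - a) \<partial>\<pi>) = T \<mu> a" "integrable \<pi> (\<lambda>z. h (fst z - a))"
    unfolding T_def using cpl_integral(1)[OF \<pi>, of "\<lambda>x. h (x - a)"] cpl_integrable(1)[OF \<pi>, of "\<lambda>x. h (x - a)"]
    by (auto intro: P_integrable_shift \<mu>)
  have e2: "(\<integral>z. indicator {b} (snd z) \<partial>\<pi>) = \<alpha>" "integrable \<pi> (\<lambda>z. indicator {b} (snd z) :: real)"
    using cpl_integral(2)[OF \<pi>, of "indicator {b}"] cpl_integrable(2)[OF \<pi>, of "indicator {b}"] \<alpha> ab
    by (auto simp: measure_two integrable_two)
  have e3: "(\<integral>z. max 0 (c - \<beta> a b (fst z)) \<partial>\<pi>) = U \<mu> a b c" "integrable \<pi> (\<lambda>z. max 0 (c - \<beta> a b (fst z)))"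
    unfolding U_def using cpl_integral(1)[OF \<pi>, of "\<lambda>x. max 0 (c - \<beta> a b x)"]
      cpl_integrable(1)[OF \<pi>, of "\<lambda>x. max 0 (c - \<beta> a b x)"] by (auto intro: U_integrable \<mu>)
  have "(\<integral>z. h (fst z - a) + c * indicator {b} (snd z) - max 0 (c - \<beta> a b (fst z)) \<partial>\<pi>) \<le> cost \<pi>"
    unfolding cost_def
  proof (rule integral_mono_AE)
    show "AE z in \<pi>. h (fst z - a) + c * indicator {b} (snd z) - max 0 (c - \<beta> a b (fst z)) \<le> h (fst z - snd z)"
      using ae by eventually_elim (auto simp: \<beta>_def indicator_def)
  qed (use e1 e2 e3 cost_integrable[OF \<pi> \<mu> two_in_P] in auto)
  thus "T \<mu> a + c * \<alpha> - U \<mu> a b c \<le> cost \<pi>" using e1 e2 e3 by simp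
qed

text \<open>The weight \<open>1/2\<close> may be left out because the weights used are \<open>s * m\<close> with \<open>s\<close> close to 1.\<close>

lemma U_le:
  assumes P: "\<mu> \<in> P" "\<nu> \<in> P" and ab: "a \<noteq> b" and T: "T \<mu> a = T \<nu> a"
    and C: "\<And>\<alpha>. 0 < \<alpha> \<Longrightarrow> \<alpha> < 1 \<Longrightarrow> \<alpha> \<noteq> 1/2 \<Longrightarrow> C \<mu> (two \<alpha> a b) = C \<nu> (two \<alpha> a b)"
  shows "U \<nu> a b c \<le> U \<mu> a b c"
proof -
  interpret prob_space \<nu> using PD[OF P(2)] by simp
  note [measurable_cong] = PD(2)[OF P(2)]
  \<comment> \<open>The set where the dual integrand \<open>max 0 (c - \<beta> a b x)\<close> is
    positive; with it the upper and the lower bound differ only by the factor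
    \<open>s\<close>.\<close>
  define A where "A = {x. \<beta> a b x < c}"
  have A[measurable]: "A \<in> sets borel" unfolding A_def by measurable
  define m where "m = measure \<nu> A"
  have Uindic: "max 0 (c - \<beta> a b x) = c * indicator A x - indicator A x * \<beta> a b x" for x
    by (auto simp: A_def indicator_def)
  have i: "integrable \<nu> (\<lambda>x. indicator A x * \<beta> a b x)"
    using integrable_mult_indicator[of A \<nu> "\<beta> a b"] \<beta>_integrable[OF P(2), of a b] A by (simp add: PD[OF P(2)])
  have Um: "U \<nu> a b c = c * m - (\<integral>x. indicator A x * \<beta> a b x \<partial>\<nu>)"
  proof -
    have "integrable \<nu> (\<lambda>x. c * indicator A x)" using A by (auto simp: PD[OF P(2)] emeasure_eq_measure)
    thus ?thesis unfolding U_def Uindic m_def using i A by (simp add: PD[OF P(2)])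
  qed
  have U0: "0 \<le> U \<mu> a b c" unfolding U_def by (intro Bochner_Integration.integral_nonneg) auto
  have step: "s * U \<nu> a b c \<le> U \<mu> a b c" if s: "0 < s" "s < 1" "s * m \<noteq> 1/2" and m: "0 < m" for s
  proof -
    have sm: "0 < s * m" "s * m < 1"
    proof -
      have "s * m \<le> s * 1" unfolding m_def using s by (intro mult_left_mono) auto
      thus "s * m < 1" using s by linarith
    qed (use s m in simp)
    have "T \<mu> a + c * (s * m) - U \<mu> a b c \<le> C \<mu> (two (s * m) a b)"
      by (rule C_two_lower[OF P(1) ab]) (use sm in auto)
    also have "\<dots> = C \<nu> (two (s * m) a b)" by (rule C[OF sm s(3)])
    also have "\<dots> \<le> T \<nu> a + s * (\<integral>x. indicator A x * \<beta> a b x \<partial>\<nu>)"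
      by (rule C_two_upper[OF P(2) ab A s(1,2)]) (use sm in \<open>auto simp: m_def\<close>)
    finally have "c * (s * m) - s * (\<integral>x. indicator A x * \<beta> a b x \<partial>\<nu>) \<le> U \<mu> a b c" using T by simp
    thus ?thesis by (simp add: Um algebra_simps)
  qed
  show ?thesis
  proof (cases "m = 0")
    case True
    hence "AE x in \<nu>. x \<notin> A" unfolding m_def by (subst (asm) prob_eq_0) (auto simp: PD[OF P(2)])
    hence "U \<nu> a b c = (\<integral>x. 0 \<partial>\<nu>)" unfolding U_def
      by (intro integral_cong_AE) (auto simp: A_def elim!: eventually_mono)
    thus ?thesis using U0 by simp
  next
    case False
    hence m: "0 < m" by (simp add: m_def zero_less_measure_iff)
    show ?thesis
    proof (rule ccontr)
      assume "\<not> ?thesis"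
      hence lt: "U \<mu> a b c < U \<nu> a b c" and pos: "0 < U \<nu> a b c" using U0 by auto
      define r where "r = U \<mu> a b c / U \<nu> a b c"
      have r: "0 \<le> r" "r < 1" using lt pos U0 by (auto simp: r_def)
      \<comment> \<open>Any \<open>s\<close> strictly between \<open>r\<close> and 1 contradicts the
        scaled inequality; there are two candidates because one of them may produce the excluded
        weight 1/2.\<close>
      define s where "s = (if (1 + r) / 2 * m \<noteq> 1/2 then (1 + r) / 2 else (3 + r) / 4)"
      have "s * m \<noteq> 1/2"
      proof (cases "(1 + r) / 2 * m = 1/2")
        case True
        have "(1 + r) / 2 * m < (3 + r) / 4 * m" using r m by (intro mult_strict_right_mono) auto
        hence "(3 + r) / 4 * m \<noteq> 1/2" using True by linarith
        thus ?thesis using True by (simp add: s_def)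
      qed (simp add: s_def)
      moreover have "0 < s" "s < 1" "r < s" using r by (auto simp: s_def)
      ultimately have "s * U \<nu> a b c \<le> U \<mu> a b c" using step m by blast
      hence "s \<le> r" using pos by (simp add: r_def field_simps)
      thus False using \<open>r < s\<close> by simp
    qed
  qed
qed

text \<open>\<open>U\<close> is an integrated distribution function of \<open>\<beta> a b\<close>; its second differences are integrals of tents,
  which isolate single values of \<open>\<beta> a b\<close>.\<close>

definition tent :: "real \<Rightarrow> real \<Rightarrow> real \<Rightarrow> real" where
  "tent c e t = max 0 (c + e - t) - 2 * max 0 (c - t) + max 0 (c - e - t)"

lemma tent: assumes "0 < e"
  shows "0 \<le> tent c e t" "\<bar>t - c\<bar> < e \<Longrightarrow> 0 < tent c e t" "e \<le> \<bar>t - c\<bar> \<Longrightarrow> tent c e t = 0" "tent c e c = e"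
  using assms by (auto simp: tent_def max_def)

lemma tent_measurable [measurable]: "tent c e \<in> borel_measurable borel"
  unfolding tent_def[abs_def] by measurable

lemma integral_tent:
  assumes "\<mu> \<in> P"
  shows "integrable \<mu> (\<lambda>x. tent c e (\<beta> a b x))"
    and "(\<integral>x. tent c e (\<beta> a b x) \<partial>\<mu>) = U \<mu> a b (c + e) - 2 * U \<mu> a b c + U \<mu> a b (c - e)"
  unfolding tent_def U_def using U_integrable[OF assms] by auto

lemma T_invariant:
  assumes "cost_isometry \<Psi>" "\<And>x. \<Psi> (return borel x) = return borel x" "\<mu> \<in> P"
  shows "T (\<Psi> \<mu>) a = T \<mu> a"
  using cost_isometryD(2)[OF assms(1,3) return_in_P[of a]] cost_isometryD(1)[OF assms(1,3)]
  by (simp add: T_def assms(2,3) C_return)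

end

section \<open>Strict convexity of the cost and finitely supported measures\<close>

context strict_cost begin

text \<open>Two sources of strictness: for equal norms the strict convexity of \<open>N\<close>,
  otherwise that of the power, which needs \<open>p > 1\<close>.\<close>

lemma h_midpoint_strict:
  assumes "1 < p" "x \<noteq> y" shows "h ((1/2) *\<^sub>R (x + y)) < (h x + h y) / 2"
proof (cases "N x = N y")
  case True
  have x0: "N x \<noteq> 0" using assms True by auto
  have "N ((1/2) *\<^sub>R (x + y)) < N x"
  proof -
    have "N y *\<^sub>R x \<noteq> N x *\<^sub>R y" using True x0 assms by auto
    hence "N (x + y) < N x + N y" using True x0 by (intro N_add_strict) auto
    thus ?thesis using True by (simp add: N_scale)
  qed
  hence "h ((1/2) *\<^sub>R (x + y)) < h x" unfolding h_def using assms by (intro powr_less_mono2) auto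
  moreover have "h y = h x" using True by (simp add: h_def)
  ultimately show ?thesis by simp
next
  case False
  have "N ((1/2) *\<^sub>R (x + y)) \<le> (N x + N y) / 2" using N_triangle[of x y] by (simp add: N_scale)
  hence "h ((1/2) *\<^sub>R (x + y)) \<le> ((N x + N y) / 2) powr p" unfolding h_def using assms by (intro powr_mono2) auto
  also have "\<dots> < (h x + h y) / 2" unfolding h_def using assms False by (intro powr_midpoint_less) auto
  finally show ?thesis .
qed

lemma h_convex_strict:
  assumes p: "1 < p" and xy: "x \<noteq> y" and l: "0 < l" "l < 1"
  shows "h ((1 - l) *\<^sub>R x + l *\<^sub>R y) < (1 - l) * h x + l * h y"
proof -
  have *: "h ((1 - l) *\<^sub>R x + l *\<^sub>R y) < (1 - l) * h x + l * h y" if "x \<noteq> y" "0 < l" "l \<le> 1/2" for x y l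
  proof -
    have "(1 - l) *\<^sub>R x + l *\<^sub>R y = (1 - 2 * l) *\<^sub>R x + (2 * l) *\<^sub>R ((1/2) *\<^sub>R (x + y))"
      by (simp add: algebra_simps) (simp only: mult_2 mult_2_right scaleR_add_left)
    hence "h ((1 - l) *\<^sub>R x + l *\<^sub>R y) \<le> (1 - 2 * l) * h x + (2 * l) * h ((1/2) *\<^sub>R (x + y))"
      using h_convex[of "2 * l" x "(1/2) *\<^sub>R (x + y)"] that by simp
    also have "\<dots> < (1 - 2 * l) * h x + (2 * l) * ((h x + h y) / 2)"
      using h_midpoint_strict[OF p that(1)] that(2) by (intro add_strict_left_mono mult_strict_left_mono) auto
    also have "\<dots> = (1 - l) * h x + l * h y" by (simp add: field_simps)
    finally show ?thesis .
  qed
  show ?thesis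
  proof (cases "l \<le> 1/2")
    case False
    show ?thesis using *[of y x "1 - l"] xy l False by (simp add: add.commute)
  qed (use * xy l in auto)
qed

text \<open>The two points on the left are convex combinations of the two outer points with
  complementary weights, so the two strict convexity inequalities add up to the claim.\<close>

lemma h_four_points:
  assumes "1 < p" "u \<noteq> 0" "0 < t"
  shows "h w + h (w + (1 - t) *\<^sub>R u) < h (w - t *\<^sub>R u) + h (w + u)"
proof -
  define l where "l = t / (1 + t)"
  have l: "0 < l" "l < 1" "1 - l = 1 / (1 + t)" using assms by (auto simp: l_def field_simps)
  have ne: "w - t *\<^sub>R u \<noteq> w + u"
  proof
    assume "w - t *\<^sub>R u = w + u"
    hence "(1 + t) *\<^sub>R u = 0" by (simp add: algebra_simps)
    thus False using assms by simp
  qed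
  have lt: "l * (1 + t) = t" using assms by (simp add: l_def)
  have "(1 - l) *\<^sub>R (w - t *\<^sub>R u) + l *\<^sub>R (w + u) = w + (l * (1 + t) - t) *\<^sub>R u" by (simp add: algebra_simps)
  hence a: "(1 - l) *\<^sub>R (w - t *\<^sub>R u) + l *\<^sub>R (w + u) = w" using lt by simp
  have "l *\<^sub>R (w - t *\<^sub>R u) + (1 - l) *\<^sub>R (w + u) = w + (1 - l * (1 + t)) *\<^sub>R u" by (simp add: algebra_simps)
  hence b: "l *\<^sub>R (w - t *\<^sub>R u) + (1 - l) *\<^sub>R (w + u) = w + (1 - t) *\<^sub>R u" using lt by simp
  have "h w < (1 - l) * h (w - t *\<^sub>R u) + l * h (w + u)"
    using h_convex_strict[OF assms(1) ne l(1,2)] a by simp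
  moreover have "h (w + (1 - t) *\<^sub>R u) < l * h (w - t *\<^sub>R u) + (1 - l) * h (w + u)"
    using h_convex_strict[OF assms(1) ne, of "1 - l"] l(1,2) b by simp
  ultimately show ?thesis by (simp add: algebra_simps)
qed

text \<open>For each \<open>x\<close> the points \<open>b\<close> that fail to separate
  \<open>x\<close> from \<open>z\<close> form a closed set \<open>B x\<close>. By
  \<open>h_four_points\<close> a small shift of \<open>b\<close> along \<open>x - z\<close> leaves
  \<open>B x\<close>, so it has no interior, and finitely many such sets do not cover the
  space.\<close>

lemma exists_separating:
  assumes p: "1 < p" and G: "finite G" "z \<notin> G"
  shows "\<exists>b. b \<noteq> a \<and> (\<forall>x\<in>G. \<beta> a b z \<noteq> \<beta> a b x)"
proof -
  define B where "B x = {b. h (z - b) - h (x - b) = h (z - a) - h (x - a)}" for x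
  have cl: "closed (B x)" for x unfolding B_def
    by (intro closed_Collect_eq continuous_intros h_continuous_on_comp)
  have int: "interior (B x) = {}" if "x \<noteq> z" for x
  proof (rule ccontr)
    assume "interior (B x) \<noteq> {}"
    then obtain b e where be: "0 < e" "ball b e \<subseteq> B x" by (auto simp: mem_interior)
    define u where "u = x - z"
    have u: "u \<noteq> 0" using that by (simp add: u_def)
    define t where "t = e / (2 * norm u)"
    have t: "0 < t" "norm (t *\<^sub>R u) < e" using be u by (auto simp: t_def)
    have "b \<in> B x" "b + t *\<^sub>R u \<in> B x" using be t by (auto simp: subset_iff dist_norm)
    hence "h (z - b) - h (x - b) = h (z - (b + t *\<^sub>R u)) - h (x - (b + t *\<^sub>R u))" by (simp add: B_def)
    moreover have "x - b = (z - b) + u" "z - (b + t *\<^sub>R u) = (z - b) - t *\<^sub>R u"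
      "x - (b + t *\<^sub>R u) = (z - b) + (1 - t) *\<^sub>R u" by (auto simp: u_def algebra_simps)
    ultimately show False using h_four_points[OF p u t(1), of "z - b"] by simp
  qed
  have "interior ({a} \<union> \<Union>(B ` G)) = {}" using G
  proof (induction G)
    case (insert x F)
    have "{a} \<union> \<Union>(B ` insert x F) = ({a} \<union> \<Union>(B ` F)) \<union> B x" by auto
    moreover have "closed ({a} \<union> \<Union>(B ` F))" using cl insert by (intro closed_Un closed_UN) auto
    moreover have "interior (B x) = {}" "interior ({a} \<union> \<Union>(B ` F)) = {}" using insert int by auto
    ultimately show ?case using interior_closed_Un_empty_interior by metis
  qed simp
  hence "{a} \<union> \<Union>(B ` G) \<noteq> UNIV" by (metis interior_UNIV UNIV_not_empty)
  then obtain b where "b \<notin> {a} \<union> \<Union>(B ` G)" by blast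
  thus ?thesis by (intro exI[of _ b]) (auto simp: B_def \<beta>_def)
qed

text \<open>A pair \<open>a\<close>, \<open>b\<close> separating \<open>z\<close> from the rest of
  \<open>F\<close> turns a tent around \<open>\<beta> a b z\<close> into a multiple of the indicator
  of \<open>z\<close> on \<open>F\<close>. This serves twice: for points outside \<open>F\<close>,
  to confine the support of \<open>\<nu>\<close>, and then for the atoms.\<close>

lemma finite_measure_determined:
  assumes p: "1 < p" and P: "\<mu> \<in> P" "\<nu> \<in> P" and F: "finite F" "AE x in \<mu>. x \<in> F"
    and U: "\<And>a b c. a \<noteq> b \<Longrightarrow> U \<nu> a b c = U \<mu> a b c"
  shows "\<nu> = \<mu>"
proof -
  interpret M: prob_space \<mu> using PD[OF P(1)] by simp
  interpret Nu: prob_space \<nu> using PD[OF P(2)] by simp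
  note [measurable_cong] = PD(2)[OF P(1)] PD(2)[OF P(2)]
  have sep: "\<exists>a b e. 0 < e \<and> a \<noteq> b \<and> (\<forall>x\<in>F - {z}. e \<le> \<bar>\<beta> a b x - \<beta> a b z\<bar>)" for z
  proof -
    obtain b where b': "b \<noteq> z" "\<forall>x\<in>F - {z}. \<beta> z b z \<noteq> \<beta> z b x"
      using exists_separating[OF p, of "F - {z}" z z] F(1) by auto
    hence b: "b \<noteq> z" "\<forall>x\<in>F - {z}. \<beta> z b x \<noteq> \<beta> z b z" by metis+
    define e where "e = Min (insert 1 ((\<lambda>x. \<bar>\<beta> z b x - \<beta> z b z\<bar>) ` (F - {z})))"
    have "0 < e" unfolding e_def using F b by (subst Min_gr_iff) auto
    moreover have "\<forall>x\<in>F - {z}. e \<le> \<bar>\<beta> z b x - \<beta> z b z\<bar>" unfolding e_def using F by (auto intro!: Min_le)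
    ultimately show ?thesis using b by metis
  qed
  have tent_eq: "(\<integral>x. tent c e (\<beta> a b x) \<partial>\<nu>) = (\<integral>x. tent c e (\<beta> a b x) \<partial>\<mu>)" if "a \<noteq> b" for a b c e
    using that by (simp add: integral_tent[OF P(1)] integral_tent[OF P(2)] U)
  have tent_F: "AE x in m. tent (\<beta> a b z) e (\<beta> a b x) = e * indicator {z} x"
    if "AE x in m. x \<in> F" "0 < e" "\<forall>x\<in>F - {z}. e \<le> \<bar>\<beta> a b x - \<beta> a b z\<bar>" for m a b e z
    using that(1)
  proof eventually_elim
    case (elim x)
    thus ?case using that tent[OF that(2)] by (cases "x = z") auto
  qed
  have "supp \<nu> \<subseteq> F"
  proof
    fix z assume z: "z \<in> supp \<nu>"
    show "z \<in> F"
    proof (rule ccontr)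
      assume zF: "z \<notin> F"
      obtain a b e where abe: "0 < e" "a \<noteq> b" "\<forall>x\<in>F - {z}. e \<le> \<bar>\<beta> a b x - \<beta> a b z\<bar>" using sep by blast
      have "(\<integral>x. tent (\<beta> a b z) e (\<beta> a b x) \<partial>\<mu>) = (\<integral>x. 0 \<partial>\<mu>)"
        using F(2) abe zF tent(3)[OF abe(1)] by (intro integral_cong_AE) (auto elim!: eventually_mono)
      hence "(\<integral>x. tent (\<beta> a b z) e (\<beta> a b x) \<partial>\<nu>) = 0" using tent_eq[OF abe(2)] by simp
      hence "AE x in \<nu>. tent (\<beta> a b z) e (\<beta> a b x) = 0"
        using tent(1)[OF abe(1)] integral_tent[OF P(2)] by (subst (asm) integral_nonneg_eq_0_iff_AE) auto
      hence "AE x in \<nu>. x \<in> {x. e \<le> \<bar>\<beta> a b x - \<beta> a b z\<bar>}"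
        by eventually_elim (use tent(2)[OF abe(1)] in \<open>force simp: not_less[symmetric]\<close>)
      moreover have "closed {x. e \<le> \<bar>\<beta> a b x - \<beta> a b z\<bar>}" unfolding \<beta>_def
        by (intro closed_Collect_le continuous_intros h_continuous_on_comp)
      ultimately have "z \<in> {x. e \<le> \<bar>\<beta> a b x - \<beta> a b z\<bar>}"
        using supp_subset_closed z P(2) PD(2) by blast
      thus False using abe by simp
    qed
  qed
  hence F': "AE x in \<nu>. x \<in> F" using P_AE_supp[OF P(2)] by (auto elim!: eventually_mono)
  show ?thesis
  proof (rule finite_measure_eqI[OF P F])
    fix z assume "z \<in> F"
    obtain a b e where abe: "0 < e" "a \<noteq> b" "\<forall>x\<in>F - {z}. e \<le> \<bar>\<beta> a b x - \<beta> a b z\<bar>" using sep by blast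
    have "(\<integral>x. tent (\<beta> a b z) e (\<beta> a b x) \<partial>m) = e * measure m {z}" if "m \<in> P" "AE x in m. x \<in> F" for m
    proof -
      interpret prob_space m using PD[OF that(1)] by simp
      note [measurable_cong] = PD(2)[OF that(1)]
      have "(\<integral>x. tent (\<beta> a b z) e (\<beta> a b x) \<partial>m) = (\<integral>x. e * indicator {z} x \<partial>m)"
        using tent_F[OF that(2) abe(1,3)] by (intro integral_cong_AE) auto
      thus ?thesis by (simp add: PD[OF that(1)])
    qed
    from this[OF P(1) F(2)] this[OF P(2) F'] show "measure \<nu> {z} = measure \<mu> {z}"
      using tent_eq[OF abe(2)] abe(1) by simp
  qed
qed

lemma identity_if_finite_fixed:
  assumes \<Psi>: "cost_isometry \<Psi>"
    and fin: "\<And>\<mu> F. \<mu> \<in> P \<Longrightarrow> finite F \<Longrightarrow> AE x in \<mu>. x \<in> F \<Longrightarrow> \<Psi> \<mu> = \<mu>" and \<mu>: "\<mu> \<in> P"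
  shows "\<Psi> \<mu> = \<mu>"
proof -
  obtain \<nu> where \<nu>: "\<And>i. \<nu> i \<in> P" "\<And>i. \<exists>F. finite F \<and> (AE x in \<nu> i. x \<in> F)" "(\<lambda>i. C \<mu> (\<nu> i)) \<longlonglongrightarrow> 0"
    using finite_approx[OF \<mu>] by blast
  have "C (\<Psi> \<mu>) (\<nu> i) = C \<mu> (\<nu> i)" for i
    using cost_isometryD(2)[OF \<Psi> \<mu> \<nu>(1)[of i]] fin[OF \<nu>(1)] \<nu>(2)[of i] by auto
  thus ?thesis using C_limit_unique[OF cost_isometryD(1)[OF \<Psi> \<mu>] \<mu> \<nu>(1)] \<nu>(3) by simp
qed

lemma identity_if_two_fixed:
  assumes p: "1 < p" and \<Psi>: "cost_isometry \<Psi>" and D: "\<And>x. \<Psi> (return borel x) = return borel x"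
    and two: "\<And>\<alpha> a b. 0 < \<alpha> \<Longrightarrow> \<alpha> < 1 \<Longrightarrow> \<alpha> \<noteq> 1/2 \<Longrightarrow> a \<noteq> b \<Longrightarrow> \<Psi> (two \<alpha> a b) = two \<alpha> a b" and \<mu>: "\<mu> \<in> P"
  shows "\<Psi> \<mu> = \<mu>"
proof (rule identity_if_finite_fixed[OF \<Psi> _ \<mu>])
  fix \<mu> F assume \<mu>: "\<mu> \<in> P" and F: "finite F" "AE x in \<mu>. x \<in> F"
  note \<Psi>P = cost_isometryD(1)[OF \<Psi> \<mu>]
  have C: "C (\<Psi> \<mu>) (two \<alpha> a b) = C \<mu> (two \<alpha> a b)" if "0 < \<alpha>" "\<alpha> < 1" "\<alpha> \<noteq> 1/2" "a \<noteq> b" for \<alpha> a b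
    using cost_isometryD(2)[OF \<Psi> \<mu> two_in_P[of \<alpha> a b]] two that by simp
  show "\<Psi> \<mu> = \<mu>"
  proof (rule finite_measure_determined[OF p \<mu> \<Psi>P F])
    fix a b c assume ab: "a \<noteq> (b::'a)"
    note T = T_invariant[OF \<Psi> D \<mu>, of a]
    show "U (\<Psi> \<mu>) a b c = U \<mu> a b c"
      by (intro antisym; rule U_le) (use \<mu> \<Psi>P ab T C in auto)
  qed
qed

end

context power_cost begin

subsection \<open>Optimality of the product coupling\<close>

definition I :: "'a measure \<Rightarrow> 'a measure \<Rightarrow> real" where "I \<mu> \<nu> = cost (\<mu> \<Otimes>\<^sub>M \<nu>)"

lemma I_eq:
  assumes P: "\<mu> \<in> P" "\<nu> \<in> P"
  shows "I \<mu> \<nu> = (\<integral>y. T \<mu> y \<partial>\<nu>)" "I \<mu> \<nu> = (\<integral>x. T \<nu> x \<partial>\<mu>)"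
proof -
  interpret M: prob_space \<mu> using PD[OF P(1)] by simp
  interpret Nu: prob_space \<nu> using PD[OF P(2)] by simp
  interpret pair_prob_space \<mu> \<nu> ..
  have i: "integrable (\<mu> \<Otimes>\<^sub>M \<nu>) (\<lambda>(x, y). h (x - y))"
    using cost_integrable[OF product_coupling[OF P] P] by (simp add: case_prod_beta')
  have e: "I \<mu> \<nu> = (\<integral>(x, y). h (x - y) \<partial>(\<mu> \<Otimes>\<^sub>M \<nu>))" by (simp add: I_def cost_def case_prod_beta')
  show "I \<mu> \<nu> = (\<integral>y. T \<mu> y \<partial>\<nu>)" unfolding e T_def by (rule integral_snd[OF i, symmetric])
  have "(\<integral>(x, y). h (x - y) \<partial>(\<mu> \<Otimes>\<^sub>M \<nu>)) = (\<integral>x. \<integral>y. h (x - y) \<partial>\<nu> \<partial>\<mu>)" by (rule integral_fst[OF i, symmetric])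
  thus "I \<mu> \<nu> = (\<integral>x. T \<nu> x \<partial>\<mu>)" unfolding e T_def by (simp add: h_diff_commute)
qed

definition perp :: "'a measure \<Rightarrow> 'a measure \<Rightarrow> bool" where "perp \<mu> \<nu> \<longleftrightarrow> C \<mu> \<nu> = I \<mu> \<nu>"

text \<open>On the supports the cost is a function of the second point plus a multiple of the
  indicator of \<open>b\<close>, so its integral depends on the marginals only and all couplings
  cost the same.\<close>

lemma perp_two:
  assumes \<nu>: "\<nu> \<in> P" and \<alpha>: "0 \<le> \<alpha>" "\<alpha> \<le> 1"
    and const: "\<And>z z'. z \<in> supp \<nu> \<Longrightarrow> z' \<in> supp \<nu> \<Longrightarrow> h (z - a) - h (z - b) = h (z' - a) - h (z' - b)"
  shows "perp (two \<alpha> a b) \<nu>"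
proof -
  obtain z0 where z0: "z0 \<in> supp \<nu>" using supp_nonempty[OF \<nu>] by auto
  define \<kappa> where "\<kappa> = h (z0 - a) - h (z0 - b)"
  have \<kappa>: "h (z - a) - h (z - b) = \<kappa>" if "z \<in> supp \<nu>" for z using const[OF that z0] by (simp add: \<kappa>_def)
  have c: "cost \<pi> = (\<integral>x. h (x - a) \<partial>\<nu>) - \<kappa> * measure (two \<alpha> a b) {b}" if \<pi>: "\<pi> \<in> cpl (two \<alpha> a b) \<nu>" for \<pi>
  proof -
    have ae1: "AE z in \<pi>. fst z \<in> {a, b}" by (rule cpl_AE(1)[OF \<pi> _ AE_two]) auto
    have ae2: "AE z in \<pi>. snd z \<in> supp \<nu>" by (rule cpl_AE(2)[OF \<pi> _ P_AE_supp[OF \<nu>]]) (auto simp: closed_supp)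
    have i1: "integrable \<pi> (\<lambda>z. h (snd z - a))"
      by (rule cpl_integrable(2)[OF \<pi>, of "\<lambda>x. h (x - a)"]) (auto intro: P_integrable_shift \<nu>)
    have i2: "integrable \<pi> (\<lambda>z. indicator {b} (fst z) :: real)"
      by (rule cpl_integrable(1)[OF \<pi>, of "indicator {b}"]) (auto intro!: integrable_two)
    have "cost \<pi> = (\<integral>z. h (snd z - a) - \<kappa> * indicator {b} (fst z) \<partial>\<pi>)" unfolding cost_def
    proof (rule integral_cong_AE)
      show "AE z in \<pi>. h (fst z - snd z) = h (snd z - a) - \<kappa> * indicator {b} (fst z)"
        using ae1 ae2
      proof eventually_elim
        case (elim z)
        thus ?case using \<kappa>[of "snd z"] by (auto simp: indicator_def h_diff_commute)
      qed
    qed (rule cpl_measurable[OF \<pi>], measurable)+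
    also have "\<dots> = (\<integral>z. h (snd z - a) \<partial>\<pi>) - \<kappa> * (\<integral>z. indicator {b} (fst z) \<partial>\<pi>)" using i1 i2 by simp
    also have "(\<integral>z. h (snd z - a) \<partial>\<pi>) = (\<integral>x. h (x - a) \<partial>\<nu>)" by (rule cpl_integral[OF \<pi>]) measurable
    also have "(\<integral>z. indicator {b} (fst z) \<partial>\<pi>) = (\<integral>x. (indicator {b} x :: real) \<partial>two \<alpha> a b)"
      by (rule cpl_integral(1)[OF \<pi>, of "indicator {b}"]) measurable
    also have "\<dots> = measure (two \<alpha> a b) {b}" by simp
    finally show ?thesis .
  qed
  show ?thesis unfolding perp_def I_def
    by (rule C_eqI[OF two_in_P \<nu>]) (simp add: c c[OF product_coupling[OF two_in_P \<nu>]])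
qed

lemma h_close:
  assumes "0 < e" shows "\<exists>r>0. \<forall>a b. dist a y < r \<longrightarrow> dist b z < r \<longrightarrow> \<bar>h (a - b) - h (y - z)\<bar> < e"
proof -
  obtain d where d: "d > 0" "\<And>w. dist w (y - z) < d \<Longrightarrow> dist (h w) (h (y - z)) < e"
    using h_isCont[of "y - z"] assms unfolding continuous_at_eps_delta by meson
  show ?thesis
  proof (intro exI[of _ "d / 2"] conjI allI impI)
    fix a b assume ab: "dist a y < d / 2" "dist b z < d / 2"
    have "dist (a - b) (y - z) \<le> dist a y + dist b z"
      unfolding dist_norm using norm_triangle_ineq4[of "a - y" "b - z"] by (simp add: algebra_simps)
    hence "dist (a - b) (y - z) < d" using ab by simp
    thus "\<bar>h (a - b) - h (y - z)\<bar> < e" using d(2) by (simp add: dist_real_def)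
  qed (use d in simp)
qed

text \<open>The product coupling is perturbed by the density \<open>1 + s * u x * v w\<close>, where \<open>u\<close> and \<open>v\<close> are
  differences of normalised indicators; this moves mass towards the two cheaper pairs.\<close>

lemma perp_supp_le:
  assumes P: "\<mu> \<in> P" "\<nu> \<in> P" and perp: "perp \<mu> \<nu>"
    and y: "y \<in> supp \<mu>" "y' \<in> supp \<mu>" and z: "z \<in> supp \<nu>" "z' \<in> supp \<nu>"
  shows "h (y - z') + h (y' - z) \<le> h (y - z) + h (y' - z')"
proof (rule ccontr)
  assume "\<not> ?thesis"
  hence lt: "h (y - z) + h (y' - z') < h (y - z') + h (y' - z)" by simp
  \<comment> \<open>One eighth of the gap: each of the four neighbourhood estimates loses
    \<open>e\<close>, and a deficit of \<open>4 * e\<close> remains.\<close>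
  define e where "e = (h (y - z') + h (y' - z) - (h (y - z) + h (y' - z'))) / 8"
  have e: "0 < e" using lt by (simp add: e_def)
  obtain r1 where r1: "r1 > 0" "\<And>a b. dist a y < r1 \<Longrightarrow> dist b z < r1 \<Longrightarrow> \<bar>h (a - b) - h (y - z)\<bar> < e"
    using h_close[OF e, of y z] by blast
  obtain r2 where r2: "r2 > 0" "\<And>a b. dist a y' < r2 \<Longrightarrow> dist b z' < r2 \<Longrightarrow> \<bar>h (a - b) - h (y' - z')\<bar> < e"
    using h_close[OF e, of y' z'] by blast
  obtain r3 where r3: "r3 > 0" "\<And>a b. dist a y < r3 \<Longrightarrow> dist b z' < r3 \<Longrightarrow> \<bar>h (a - b) - h (y - z')\<bar> < e"
    using h_close[OF e, of y z'] by blast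
  obtain r4 where r4: "r4 > 0" "\<And>a b. dist a y' < r4 \<Longrightarrow> dist b z < r4 \<Longrightarrow> \<bar>h (a - b) - h (y' - z)\<bar> < e"
    using h_close[OF e, of y' z] by blast
  note c = r1(2) r2(2) r3(2) r4(2) and r = r1(1) r2(1) r3(1) r4(1)
  define r where "r = min (min r1 r2) (min r3 r4)"
  have r0: "0 < r" using r by (simp add: r_def)
  define A where "A = ball y r"
  define A' where "A' = ball y' r"
  define B where "B = ball z r"
  define B' where "B' = ball z' r"
  have sets[measurable]: "A \<in> sets borel" "A' \<in> sets borel" "B \<in> sets borel" "B' \<in> sets borel"
    by (auto simp: A_def A'_def B_def B'_def)
  interpret M: prob_space \<mu> using PD[OF P(1)] by simp
  interpret Nu: prob_space \<nu> using PD[OF P(2)] by simp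
  interpret pair_prob_space \<mu> \<nu> ..
  note [measurable_cong] = PD(2)[OF P(1)] PD(2)[OF P(2)]
  define ma ma' mb mb' where "ma = measure \<mu> A" and "ma' = measure \<mu> A'" and "mb = measure \<nu> B" and "mb' = measure \<nu> B'"
  have pos: "0 < ma" "0 < ma'" "0 < mb" "0 < mb'"
    unfolding ma_def ma'_def mb_def mb'_def A_def A'_def B_def B'_def
    using supp_measure_pos[OF P(1)] supp_measure_pos[OF P(2)] y z r0 by auto
  \<comment> \<open>Both summands have integral 1, so \<open>u\<close>, and likewise
    \<open>v\<close>, has mean 0 and the perturbed density keeps both marginals.\<close>
  define u where "u x = indicator A x / ma - indicator A' x / ma'" for x
  define v where "v x = indicator B x / mb - indicator B' x / mb'" for x
  have [measurable]: "u \<in> borel_measurable borel" "v \<in> borel_measurable borel"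
    unfolding u_def[abs_def] v_def[abs_def] by measurable
  define Mu where "Mu = 1 / ma + 1 / ma'"
  define Mv where "Mv = 1 / mb + 1 / mb'"
  have Mpos: "0 < Mu" "0 < Mv" using pos by (auto simp: Mu_def Mv_def intro!: add_pos_pos)
  have uB: "\<bar>u x\<bar> \<le> Mu" for x
  proof -
    have "0 \<le> indicator A x / ma" "indicator A x / ma \<le> 1 / ma" "0 \<le> indicator A' x / ma'" "indicator A' x / ma' \<le> 1 / ma'"
      using pos by (auto simp: indicator_def)
    thus ?thesis unfolding u_def Mu_def by linarith
  qed
  have vB: "\<bar>v x\<bar> \<le> Mv" for x
  proof -
    have "0 \<le> indicator B x / mb" "indicator B x / mb \<le> 1 / mb" "0 \<le> indicator B' x / mb'" "indicator B' x / mb' \<le> 1 / mb'"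
      using pos by (auto simp: indicator_def)
    thus ?thesis unfolding v_def Mv_def by linarith
  qed
  have ind: "integrable \<mu> (\<lambda>x. indicator S x :: real)" "(\<integral>x. indicator S x \<partial>\<mu>) = measure \<mu> S" if "S \<in> sets borel" for S
    using that by (auto simp: PD[OF P(1)] M.emeasure_eq_measure)
  have ind': "integrable \<nu> (\<lambda>x. indicator S x :: real)" "(\<integral>x. indicator S x \<partial>\<nu>) = measure \<nu> S" if "S \<in> sets borel" for S
    using that by (auto simp: PD[OF P(2)] Nu.emeasure_eq_measure)
  have ui: "integrable \<mu> u" "(\<integral>x. u x \<partial>\<mu>) = 0"
    using ind[OF sets(1)] ind[OF sets(2)] pos unfolding u_def[abs_def] by (auto simp: ma_def ma'_def)
  have vi: "integrable \<nu> v" "(\<integral>x. v x \<partial>\<nu>) = 0"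
    using ind'[OF sets(3)] ind'[OF sets(4)] pos unfolding v_def[abs_def] by (auto simp: mb_def mb'_def)
  \<comment> \<open>Small enough for \<open>1 + s * u x * v w\<close> to stay nonnegative.\<close>
  define s where "s = 1 / (Mu * Mv)"
  have s: "0 < s" using Mpos by (simp add: s_def)
  define k where "k z = 1 + s * u (fst z) * v (snd z)" for z
  have [measurable]: "k \<in> borel_measurable (borel \<Otimes>\<^sub>M borel)" unfolding k_def[abs_def] by measurable
  have suv: "\<bar>s * u x * v w\<bar> \<le> 1" for x w
  proof -
    have "\<bar>u x\<bar> * \<bar>v w\<bar> \<le> Mu * Mv" using uB vB Mpos by (intro mult_mono) auto
    thus ?thesis using Mpos s by (simp add: abs_mult s_def field_simps)
  qed
  have k0: "0 \<le> k z" for z using suv[of "fst z" "snd z"] by (simp add: k_def abs_le_iff)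
  have k1: "(\<integral>\<^sup>+y. ennreal (k (x, y)) \<partial>\<nu>) = 1" for x
  proof -
    have i: "integrable \<nu> (\<lambda>y. k (x, y))" using vi(1) by (simp add: k_def)
    have "(\<integral>y. k (x, y) \<partial>\<nu>) = 1" using vi by (simp add: k_def Nu.prob_space)
    thus ?thesis using nn_integral_eq_integral[OF i] k0 by simp
  qed
  have k2: "(\<integral>\<^sup>+x. ennreal (k (x, y)) \<partial>\<mu>) = 1" for y
  proof -
    have i: "integrable \<mu> (\<lambda>x. k (x, y))" using ui(1) by (simp add: k_def)
    have "(\<integral>x. k (x, y) \<partial>\<mu>) = 1" using ui by (simp add: k_def M.prob_space)
    thus ?thesis using nn_integral_eq_integral[OF i] k0 by simp
  qed
  have km: "k \<in> borel_measurable (borel \<Otimes>\<^sub>M borel)" by measurable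
  note dc = density_coupling[OF P km k0 k1 k2]
  note hi = cost_integrable[OF product_coupling[OF P] P]
  let ?uvh = "\<lambda>q. u (fst q) * v (snd q) * h (fst q - snd q)"
  have uvhi: "integrable (\<mu> \<Otimes>\<^sub>M \<nu>) ?uvh"
  proof (rule Bochner_Integration.integrable_bound)
    show "integrable (\<mu> \<Otimes>\<^sub>M \<nu>) (\<lambda>q. Mu * Mv * h (fst q - snd q))" using hi by auto
    show "?uvh \<in> borel_measurable (\<mu> \<Otimes>\<^sub>M \<nu>)" by measurable
    show "AE q in \<mu> \<Otimes>\<^sub>M \<nu>. norm (?uvh q) \<le> norm (Mu * Mv * h (fst q - snd q))"
    proof (rule AE_I2)
      fix q
      have "\<bar>u (fst q)\<bar> * \<bar>v (snd q)\<bar> * h (fst q - snd q) \<le> Mu * Mv * h (fst q - snd q)"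
        using uB vB Mpos by (intro mult_right_mono mult_mono) auto
      thus "norm (?uvh q) \<le> norm (Mu * Mv * h (fst q - snd q))" using Mpos by (simp add: abs_mult)
    qed
  qed
  have "(\<integral>q. k q * h (fst q - snd q) \<partial>(\<mu> \<Otimes>\<^sub>M \<nu>)) = (\<integral>q. h (fst q - snd q) + s * ?uvh q \<partial>(\<mu> \<Otimes>\<^sub>M \<nu>))"
    by (intro Bochner_Integration.integral_cong) (auto simp: k_def algebra_simps)
  also have "\<dots> = I \<mu> \<nu> + s * (\<integral>q. ?uvh q \<partial>(\<mu> \<Otimes>\<^sub>M \<nu>))" using hi uvhi by (simp add: I_def cost_def)
  finally have "I \<mu> \<nu> \<le> I \<mu> \<nu> + s * (\<integral>q. ?uvh q \<partial>(\<mu> \<Otimes>\<^sub>M \<nu>))"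
    using C_le_cost[OF dc(1)] dc(2) perp by (simp add: perp_def)
  hence ge0: "0 \<le> (\<integral>q. ?uvh q \<partial>(\<mu> \<Otimes>\<^sub>M \<nu>))" using s by (simp add: zero_le_mult_iff)
  define J where "J S S' q = indicator S (fst q) * (indicator S' (snd q) :: real)" for S S' :: "'a set" and q
  have Ji: "integrable (\<mu> \<Otimes>\<^sub>M \<nu>) (J S S')" "(\<integral>q. J S S' q \<partial>(\<mu> \<Otimes>\<^sub>M \<nu>)) = measure \<mu> S * measure \<nu> S'"
    if SS: "S \<in> sets borel" "S' \<in> sets borel" for S S'
  proof -
    have J: "J S S' = indicator (S \<times> S')" by (auto simp: J_def fun_eq_iff indicator_def)
    have st: "S \<times> S' \<in> sets (\<mu> \<Otimes>\<^sub>M \<nu>)" using SS by (auto simp: PD[OF P(1)] PD[OF P(2)] intro!: pair_measureI)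
    have "emeasure (\<mu> \<Otimes>\<^sub>M \<nu>) (S \<times> S') = emeasure \<mu> S * emeasure \<nu> S'"
      using SS by (intro Nu.emeasure_pair_measure_Times) (auto simp: PD[OF P(1)] PD[OF P(2)])
    hence "measure (\<mu> \<Otimes>\<^sub>M \<nu>) (S \<times> S') = measure \<mu> S * measure \<nu> S'"
      by (simp add: measure_def enn2real_mult)
    thus "integrable (\<mu> \<Otimes>\<^sub>M \<nu>) (J S S')" "(\<integral>q. J S S' q \<partial>(\<mu> \<Otimes>\<^sub>M \<nu>)) = measure \<mu> S * measure \<nu> S'"
      unfolding J using st by (auto simp: emeasure_eq_measure space_pair_measure PD[OF P(1)] PD[OF P(2)])
  qed
  let ?W = "\<lambda>q. ((h (y - z) + e) / (ma * mb)) * J A B q + ((h (y' - z') + e) / (ma' * mb')) * J A' B' q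
     - ((h (y - z') - e) / (ma * mb')) * J A B' q - ((h (y' - z) - e) / (ma' * mb)) * J A' B q"
  note Js = Ji[OF sets(1,3)] Ji[OF sets(2,4)] Ji[OF sets(1,4)] Ji[OF sets(2,3)]
  have "(\<integral>q. ?uvh q \<partial>(\<mu> \<Otimes>\<^sub>M \<nu>)) \<le> (\<integral>q. ?W q \<partial>(\<mu> \<Otimes>\<^sub>M \<nu>))"
  proof (intro integral_mono uvhi)
    show "integrable (\<mu> \<Otimes>\<^sub>M \<nu>) ?W" using Js by auto
    fix q
    let ?h = "h (fst q - snd q)"
    have 1: "J A B q * ?h \<le> J A B q * (h (y - z) + e)"
      using c(1)[of "fst q" "snd q"] by (auto simp: J_def indicator_def A_def B_def r_def dist_commute)
    have 2: "J A' B' q * ?h \<le> J A' B' q * (h (y' - z') + e)"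
      using c(2)[of "fst q" "snd q"] by (auto simp: J_def indicator_def A'_def B'_def r_def dist_commute)
    have 3: "J A B' q * (h (y - z') - e) \<le> J A B' q * ?h"
      using c(3)[of "fst q" "snd q"] by (auto simp: J_def indicator_def A_def B'_def r_def dist_commute)
    have 4: "J A' B q * (h (y' - z) - e) \<le> J A' B q * ?h"
      using c(4)[of "fst q" "snd q"] by (auto simp: J_def indicator_def A'_def B_def r_def dist_commute)
    have "?uvh q = J A B q * ?h / (ma * mb) + J A' B' q * ?h / (ma' * mb') - J A B' q * ?h / (ma * mb') - J A' B q * ?h / (ma' * mb)"
      by (simp add: u_def v_def J_def algebra_simps diff_divide_distrib)
    also have "\<dots> \<le> J A B q * (h (y - z) + e) / (ma * mb) + J A' B' q * (h (y' - z') + e) / (ma' * mb')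
        - J A B' q * (h (y - z') - e) / (ma * mb') - J A' B q * (h (y' - z) - e) / (ma' * mb)"
      using pos by (intro diff_mono add_mono divide_right_mono 1 2 3 4) auto
    also have "\<dots> = ?W q" by (simp add: algebra_simps)
    finally show "?uvh q \<le> ?W q" .
  qed
  also have "\<dots> = ((h (y - z) + e) / (ma * mb)) * (ma * mb) + ((h (y' - z') + e) / (ma' * mb')) * (ma' * mb')
     - ((h (y - z') - e) / (ma * mb')) * (ma * mb') - ((h (y' - z) - e) / (ma' * mb)) * (ma' * mb)"
    using Js by (simp add: ma_def ma'_def mb_def mb'_def)
  also have "\<dots> = (h (y - z) + e) + (h (y' - z') + e) - (h (y - z') - e) - (h (y' - z) - e)" using pos by simp
  also have "\<dots> = - 4 * e" by (simp add: e_def field_simps)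
  finally show False using ge0 e by simp
qed

text \<open>Exchanging \<open>z\<close> and \<open>z'\<close> turns the inequality into an equality;
  this is the converse of \<open>perp_two\<close>.\<close>

lemma perp_supp:
  assumes P: "\<mu> \<in> P" "\<nu> \<in> P" and perp: "perp \<mu> \<nu>"
    and y: "y \<in> supp \<mu>" "y' \<in> supp \<mu>" and z: "z \<in> supp \<nu>" "z' \<in> supp \<nu>"
  shows "h (z - y) - h (z - y') = h (z' - y) - h (z' - y')"
  using perp_supp_le[OF assms] perp_supp_le[OF P perp y z(2,1)] by (simp add: h_diff_commute)

section \<open>Isometries that fix the Dirac measures\<close>

definition Dirac_fixing :: "('a measure \<Rightarrow> 'a measure) \<Rightarrow> bool" where
  "Dirac_fixing \<Psi> \<longleftrightarrow> cost_isometry \<Psi> \<and> (\<forall>x. \<Psi> (return borel x) = return borel x)"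

lemma Dirac_fixingD:
  assumes "Dirac_fixing \<Psi>"
  shows "\<mu> \<in> P \<Longrightarrow> \<Psi> \<mu> \<in> P" "\<mu> \<in> P \<Longrightarrow> \<nu> \<in> P \<Longrightarrow> C (\<Psi> \<mu>) (\<Psi> \<nu>) = C \<mu> \<nu>" "\<Psi> (return borel x) = return borel x"
    "cost_isometry \<Psi>"
  using assms cost_isometryD by (auto simp: Dirac_fixing_def)

lemma Dirac_fixing_inv:
  assumes "Dirac_fixing \<Psi>"
  shows "Dirac_fixing (inv_into P \<Psi>)" "\<mu> \<in> P \<Longrightarrow> \<Psi> (inv_into P \<Psi> \<mu>) = \<mu>" "\<mu> \<in> P \<Longrightarrow> inv_into P \<Psi> (\<Psi> \<mu>) = \<mu>"
proof -
  note D = Dirac_fixingD[OF assms]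
  note J = cost_isometry_inv[OF D(4)]
  show "\<mu> \<in> P \<Longrightarrow> \<Psi> (inv_into P \<Psi> \<mu>) = \<mu>" "\<mu> \<in> P \<Longrightarrow> inv_into P \<Psi> (\<Psi> \<mu>) = \<mu>" using J by auto
  show "Dirac_fixing (inv_into P \<Psi>)" unfolding Dirac_fixing_def using J(1) J(3)[OF return_in_P] D(3) by simp
qed

lemma Dirac_fixing_T:
  assumes "Dirac_fixing \<Psi>" "\<mu> \<in> P" shows "T (\<Psi> \<mu>) = T \<mu>"
  using T_invariant[OF _ _ assms(2)] Dirac_fixingD(3,4)[OF assms(1)] by blast

text \<open>\<open>I \<mu> \<nu>\<close> integrates the potential of one measure against the other, so replacing one measure at a time
  by its image does not change it.\<close>

lemma Dirac_fixing_perp: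
  assumes \<Psi>: "Dirac_fixing \<Psi>" and P: "\<mu> \<in> P" "\<nu> \<in> P"
  shows "perp (\<Psi> \<mu>) (\<Psi> \<nu>) \<longleftrightarrow> perp \<mu> \<nu>"
proof -
  note D = Dirac_fixingD[OF \<Psi>] and T = Dirac_fixing_T[OF \<Psi>]
  have "I (\<Psi> \<mu>) (\<Psi> \<nu>) = (\<integral>y. T \<mu> y \<partial>\<Psi> \<nu>)" by (simp add: I_eq(1) D P T)
  also have "\<dots> = I \<mu> (\<Psi> \<nu>)" by (simp add: I_eq(1) D P)
  also have "\<dots> = (\<integral>x. T \<nu> x \<partial>\<mu>)" by (simp add: I_eq(2) D P T)
  also have "\<dots> = I \<mu> \<nu>" by (simp add: I_eq(2) P)
  finally show ?thesis by (simp add: perp_def D P)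
qed

text \<open>A round trip: the product of \<open>\<mu>\<close> with \<open>\<omega>\<close> on
  \<open>{z, z'}\<close> is optimal, hence so is that of the images, hence that of the image of
  \<open>\<omega>\<close> with any pair \<open>y\<close>, \<open>y'\<close> in the support of
  \<open>\<Psi> \<mu>\<close>; pulling the pair back returns to \<open>\<omega>\<close>. Thus level
  sets of the difference function of \<open>a\<close>, \<open>b\<close> lie in level sets of that of
  \<open>x\<close>, \<open>x'\<close>.\<close>

lemma perp_transfer:
  assumes \<Psi>: "Dirac_fixing \<Psi>" and \<mu>: "\<mu> = two \<alpha> a b" "0 \<le> \<alpha>" "\<alpha> \<le> 1"
    and y: "y \<in> supp (\<Psi> \<mu>)" "y' \<in> supp (\<Psi> \<mu>)"
    and x: "x \<in> supp (inv_into P \<Psi> (two (1/2) y y'))" "x' \<in> supp (inv_into P \<Psi> (two (1/2) y y'))"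
    and z: "h (z - a) - h (z - b) = h (z' - a) - h (z' - b)"
  shows "h (z - x) - h (z - x') = h (z' - x) - h (z' - x')"
proof -
  note D = Dirac_fixingD[OF \<Psi>] and J = Dirac_fixing_inv[OF \<Psi>]
  note D' = Dirac_fixingD[OF J(1)]
  define \<omega> where "\<omega> = two (1/2) z z'"
  have \<omega>P: "\<omega> \<in> P" by (simp add: \<omega>_def two_in_P)
  have \<mu>P: "\<mu> \<in> P" by (simp add: \<mu> two_in_P)
  have \<omega>: "supp \<omega> \<subseteq> {z, z'}" unfolding \<omega>_def by (rule supp_subset_closed[OF _ AE_two]) auto
  have "perp \<mu> \<omega>" unfolding \<mu>(1)
  proof (rule perp_two[OF \<omega>P \<mu>(2,3)])
    fix w w' assume "w \<in> supp \<omega>" "w' \<in> supp \<omega>"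
    hence "w = z \<or> w = z'" "w' = z \<or> w' = z'" using \<omega> by auto
    thus "h (w - a) - h (w - b) = h (w' - a) - h (w' - b)" using z by auto
  qed
  hence 1: "perp (\<Psi> \<mu>) (\<Psi> \<omega>)" by (simp add: Dirac_fixing_perp[OF \<Psi>] \<mu>P \<omega>P)
  have "perp (two (1/2) y y') (\<Psi> \<omega>)"
  proof (rule perp_two[OF D(1)[OF \<omega>P]])
    fix w w' assume "w \<in> supp (\<Psi> \<omega>)" "w' \<in> supp (\<Psi> \<omega>)"
    thus "h (w - y) - h (w - y') = h (w' - y) - h (w' - y')" by (rule perp_supp[OF D(1)[OF \<mu>P] D(1)[OF \<omega>P] 1 y])
  qed simp_all
  hence "perp (inv_into P \<Psi> (two (1/2) y y')) (inv_into P \<Psi> (\<Psi> \<omega>))"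
    by (simp only: Dirac_fixing_perp[OF J(1) two_in_P D(1)[OF \<omega>P]])
  hence "perp (inv_into P \<Psi> (two (1/2) y y')) \<omega>" by (simp add: J(3)[OF \<omega>P])
  note r = perp_supp[OF D'(1)[OF two_in_P] \<omega>P this x]
  have "z \<in> supp \<omega>" "z' \<in> supp \<omega>" unfolding \<omega>_def by (rule in_supp_two, simp, simp)+
  thus ?thesis by (rule r)
qed

end

subsection \<open>Differentiability of the cost\<close>

locale smooth_cost = strict_cost +
  assumes C2: "C2_smooth_norm N"
begin

lemma N_gradient:
  assumes "x \<noteq> 0"
  obtains n where "\<forall>\<^sub>F y in nhds x. (N has_derivative (\<lambda>v. n y \<bullet> v)) (at y)" "n differentiable (at x)"
proof -
  from C2 assms obtain f' :: "'a \<Rightarrow> 'a \<Rightarrow>\<^sub>L real" where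
    f': "\<forall>\<^sub>F y in nhds x. (N has_derivative blinfun_apply (f' y)) (at y)" "f' differentiable (at x)"
    unfolding C2_smooth_norm_def twice_differentiable_at_def by blast
  define n where "n y = (\<Sum>b\<in>Basis. blinfun_apply (f' y) b *\<^sub>R b)" for y
  have "blinfun_apply (f' y) v = n y \<bullet> v" for y v
  proof -
    have "blinfun_apply (f' y) v = blinfun_apply (f' y) (\<Sum>b\<in>Basis. (v \<bullet> b) *\<^sub>R b)" by (simp add: euclidean_representation)
    also have "\<dots> = (\<Sum>b\<in>Basis. (v \<bullet> b) * blinfun_apply (f' y) b)"
      by (simp add: blinfun.sum_right blinfun.scaleR_right)
    also have "\<dots> = n y \<bullet> v" by (simp add: n_def inner_sum_left inner_commute[of v] mult.commute)
    finally show ?thesis .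
  qed
  hence "blinfun_apply (f' y) = (\<lambda>v. n y \<bullet> v)" for y by auto
  hence "\<forall>\<^sub>F y in nhds x. (N has_derivative (\<lambda>v. n y \<bullet> v)) (at y)" using f'(1) by simp
  moreover have "n differentiable (at x)"
  proof -
    obtain f'' where f'': "(f' has_derivative f'') (at x)" using f'(2) by (auto simp: differentiable_def)
    have "(n has_derivative (\<lambda>v. \<Sum>b\<in>Basis. blinfun_apply (f'' v) b *\<^sub>R b)) (at x)"
      unfolding n_def[abs_def]
      by (intro has_derivative_sum has_derivative_scaleR_left
          bounded_linear.has_derivative[OF blinfun.bounded_linear_left] f'')
    thus ?thesis by (auto simp: differentiable_def)
  qed
  ultimately show ?thesis using that by blast
qed

lemma N_has_derivative:
  assumes "x \<noteq> 0" obtains a where "(N has_derivative (\<lambda>v. a \<bullet> v)) (at x)"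
  using N_gradient[OF assms] eventually_nhds_x_imp_x by metis

lemma line_derivative:
  assumes "(f has_derivative (\<lambda>v. a \<bullet> v)) (at (x + t *\<^sub>R v))"
  shows "((\<lambda>t. f (x + t *\<^sub>R v)) has_real_derivative a \<bullet> v) (at t)"
proof -
  have "((\<lambda>t. x + t *\<^sub>R v) has_derivative (\<lambda>s. s *\<^sub>R v)) (at t)" by (auto intro!: derivative_eq_intros)
  from has_derivative_compose[OF this assms] show ?thesis
    by (simp add: has_field_derivative_def mult.commute[of _ "a \<bullet> v"])
qed

lemma difference_quotient_seq:
  fixes f :: "real \<Rightarrow> real"
  assumes "(f has_real_derivative D) (at 0)"
  shows "(\<lambda>n. real (Suc n) * (f (1 / real (Suc n)) - f 0)) \<longlonglongrightarrow> D"
proof -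
  have "((\<lambda>y. (f y - f 0) / (y - 0)) \<longlongrightarrow> D) (at 0)" using assms by (simp add: has_field_derivative_iff)
  moreover have "filterlim (\<lambda>n. 1 / real (Suc n)) (at 0) sequentially"
    unfolding filterlim_at using LIMSEQ_inverse_real_of_nat by (auto simp: inverse_eq_divide)
  ultimately have "(\<lambda>n. (f (1 / real (Suc n)) - f 0) / (1 / real (Suc n) - 0)) \<longlonglongrightarrow> D"
    by (rule filterlim_compose)
  thus ?thesis by (simp add: mult.commute)
qed

lemma line_quotient_seq:
  assumes "(f has_derivative (\<lambda>v. a \<bullet> v)) (at x)"
  shows "(\<lambda>n. real (Suc n) * (f (x + (1 / real (Suc n)) *\<^sub>R v) - f x)) \<longlonglongrightarrow> a \<bullet> v"
  using difference_quotient_seq[OF line_derivative[of f a x 0 v]] assms by simp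

section \<open>Recovery of atoms for exponent one\<close>

lemma atoms_determined_p1:
  assumes p: "p = 1" and P: "\<mu> \<in> P" "\<nu> \<in> P" and T: "T \<mu> = T \<nu>"
  shows "measure \<mu> {x} = measure \<nu> {x}"
proof -
  have hN: "h y = N y" for y
  proof -
    have "h y = N y powr p" by (rule h_def)
    also have "\<dots> = N y" using p by simp
    finally show ?thesis .
  qed
  obtain v :: 'a where v: "v \<noteq> 0" using nonempty_Basis nonzero_Basis by (metis ex_in_conv)
  define \<tau> where "\<tau> n = 1 / real (Suc n)" for n
  \<comment> \<open>The second difference is divided by the step only once: it tends to 0 wherever
    \<open>N\<close> is differentiable and survives at the kink in 0, so in the limit it acts as an
    indicator of \<open>{x}\<close>.\<close>
  define S where "S n w = real (Suc n) * (N (w + \<tau> n *\<^sub>R v) + N (w - \<tau> n *\<^sub>R v) - 2 * N w)" for n w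
  have S0: "S n 0 = 2 * N v" for n
    by (simp add: S_def N_scale \<tau>_def)
  have Slim: "(\<lambda>n. S n w) \<longlonglongrightarrow> 0" if "w \<noteq> 0" for w
  proof -
    obtain a where a: "(N has_derivative (\<lambda>v. a \<bullet> v)) (at w)" using N_has_derivative[OF \<open>w \<noteq> 0\<close>] .
    from tendsto_add[OF line_quotient_seq[OF a, of v] line_quotient_seq[OF a, of "- v"]]
    show ?thesis by (simp add: S_def[abs_def] \<tau>_def algebra_simps)
  qed
  have SB: "\<bar>S n w\<bar> \<le> 2 * N v" for n w
  proof -
    have "\<bar>N (w + \<tau> n *\<^sub>R v) - N w\<bar> \<le> N (\<tau> n *\<^sub>R v)" "\<bar>N (w - \<tau> n *\<^sub>R v) - N w\<bar> \<le> N (\<tau> n *\<^sub>R v)"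
      using N_triangle_diff[of "w + \<tau> n *\<^sub>R v" w] N_triangle_diff[of "w - \<tau> n *\<^sub>R v" w] by auto
    hence "\<bar>N (w + \<tau> n *\<^sub>R v) + N (w - \<tau> n *\<^sub>R v) - 2 * N w\<bar> \<le> 2 * N (\<tau> n *\<^sub>R v)" by linarith
    hence "real (Suc n) * \<bar>N (w + \<tau> n *\<^sub>R v) + N (w - \<tau> n *\<^sub>R v) - 2 * N w\<bar> \<le> real (Suc n) * (2 * N (\<tau> n *\<^sub>R v))"
      by (intro mult_left_mono) auto
    also have "\<dots> = 2 * N v" by (simp add: N_scale \<tau>_def)
    finally show ?thesis by (simp add: S_def abs_mult)
  qed
  have L: "(\<lambda>n. \<integral>y. S n (y - x) \<partial>m) \<longlonglongrightarrow> 2 * N v * measure m {x}" if m: "m \<in> P" for m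
  proof -
    interpret prob_space m using PD[OF m] by simp
    have "(\<lambda>n. \<integral>y. S n (y - x) \<partial>m) \<longlonglongrightarrow> (\<integral>y. 2 * N v * indicator {x} y \<partial>m)"
    proof (rule integral_dominated_convergence[where w="\<lambda>_. 2 * N v"])
      show "AE y in m. (\<lambda>n. S n (y - x)) \<longlonglongrightarrow> 2 * N v * indicator {x} y"
      proof (rule AE_I2)
        fix y show "(\<lambda>n. S n (y - x)) \<longlonglongrightarrow> 2 * N v * indicator {x} y"
          using Slim[of "y - x"] by (cases "y = x") (auto simp: S0)
      qed
      show "(\<lambda>y. 2 * N v * indicator {x} y) \<in> borel_measurable m" by (rule P_measurable[OF m]) measurable
      show "(\<lambda>y. S n (y - x)) \<in> borel_measurable m" for n
        by (rule P_measurable[OF m], unfold S_def) measurable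
    qed (use SB in auto)
    thus ?thesis by (simp add: PD[OF m])
  qed
  have E: "(\<integral>y. S n (y - x) \<partial>m) = real (Suc n) * (T m (x - \<tau> n *\<^sub>R v) + T m (x + \<tau> n *\<^sub>R v) - 2 * T m x)"
    if m: "m \<in> P" for m n
  proof -
    have e: "y - x + \<tau> n *\<^sub>R v = y - (x - \<tau> n *\<^sub>R v)" "y - x - \<tau> n *\<^sub>R v = y - (x + \<tau> n *\<^sub>R v)" for y
      by (auto simp: algebra_simps)
    note i = P_integrable_shift[OF m, unfolded hN]
    show ?thesis unfolding S_def T_def hN e using i by simp
  qed
  have "(\<integral>y. S n (y - x) \<partial>\<mu>) = (\<integral>y. S n (y - x) \<partial>\<nu>)" for n unfolding E[OF P(1)] E[OF P(2)] T ..
  hence "2 * N v * measure \<mu> {x} = 2 * N v * measure \<nu> {x}" using LIMSEQ_unique[OF L[OF P(1)]] L[OF P(2)] by simp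
  thus ?thesis using v by simp
qed

lemma identity_p1:
  assumes p: "p = 1" and \<Psi>: "Dirac_fixing \<Psi>" and \<mu>: "\<mu> \<in> P"
  shows "\<Psi> \<mu> = \<mu>"
proof (rule identity_if_finite_fixed[OF Dirac_fixingD(4)[OF \<Psi>] _ \<mu>])
  fix \<mu> F assume \<mu>: "\<mu> \<in> P" and F: "finite F" "AE x in \<mu>. x \<in> F"
  note \<Psi>P = Dirac_fixingD(1)[OF \<Psi> \<mu>]
  show "\<Psi> \<mu> = \<mu>"
    by (rule finite_measure_eqI[OF \<mu> \<Psi>P F]) (rule atoms_determined_p1[OF p \<Psi>P \<mu> Dirac_fixing_T[OF \<Psi> \<mu>]])
qed

end

section \<open>The gradient of the cost for exponents above one\<close>

locale smooth_power_cost = smooth_cost +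
  assumes p_gt_1: "1 < p"
begin

text \<open>A gradient field on the whole space: for \<open>p > 1\<close> the power smooths the kink
  of \<open>N\<close>, so \<open>h\<close> is differentiable at 0 as well.\<close>

definition g :: "'a \<Rightarrow> 'a" where "g x = (SOME a. (h has_derivative (\<lambda>v. a \<bullet> v)) (at x))"

lemma h_gradient_nonzero:
  assumes "x \<noteq> 0"
  obtains a where "\<forall>\<^sub>F y in nhds x. (h has_derivative (\<lambda>v. a y \<bullet> v)) (at y)" "a differentiable (at x)"
proof -
  obtain n where n: "\<forall>\<^sub>F y in nhds x. (N has_derivative (\<lambda>v. n y \<bullet> v)) (at y)" "n differentiable (at x)"
    using N_gradient[OF assms] .
  define a where "a y = (p * N y powr (p - 1)) *\<^sub>R n y" for y
  have "\<forall>\<^sub>F y in nhds x. y \<noteq> 0" using assms t1_space_nhds by blast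
  with n(1) have "\<forall>\<^sub>F y in nhds x. (h has_derivative (\<lambda>v. a y \<bullet> v)) (at y)"
  proof eventually_elim
    case (elim y)
    have "((\<lambda>y. N y powr p) has_derivative (\<lambda>v. a y \<bullet> v)) (at y)"
      unfolding a_def using elim
      by (auto intro!: derivative_eq_intros simp: powr_diff)
    thus ?case by (simp add: h_def[abs_def])
  qed
  moreover have "a differentiable (at x)"
  proof -
    have "(N has_derivative (\<lambda>v. n x \<bullet> v)) (at x)" using n(1) by (rule eventually_nhds_x_imp_x)
    hence "((\<lambda>y. N y powr (p - 1)) has_derivative
      (\<lambda>v. N x powr (p - 1) * (0 * ln (N x) + (n x \<bullet> v) * (p - 1) / N x))) (at x)"
      using assms by (intro has_derivative_powr has_derivative_const) auto
    hence "(\<lambda>y. p * N y powr (p - 1)) differentiable (at x)"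
      by (intro differentiable_mult differentiable_const) (auto simp: differentiable_def)
    thus ?thesis unfolding a_def[abs_def] using n(2) by (rule differentiable_scaleR)
  qed
  ultimately show ?thesis using that by blast
qed

lemma h_upper: "\<exists>K>0. \<forall>x. h x \<le> K * norm x powr p"
proof -
  obtain K where K: "K > 0" "\<And>x. N x \<le> K * norm x" using N_upper by blast
  have "h x \<le> K powr p * norm x powr p" for x
    unfolding h_def using K p_gt_1 by (simp add: powr_mono2 flip: powr_mult)
  thus ?thesis using K by (intro exI[of _ "K powr p"]) auto
qed

lemma h_lower: "\<exists>k>0. \<forall>x. k * norm x powr p \<le> h x"
proof -
  obtain k where k: "k > 0" "\<And>x. k * norm x \<le> N x" using N_lower by blast
  have "k powr p * norm x powr p \<le> h x" for x
    unfolding h_def using k p_gt_1 by (simp add: powr_mono2 flip: powr_mult)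
  thus ?thesis using k by (intro exI[of _ "k powr p"]) auto
qed

lemma h_derivative_0: "(h has_derivative (\<lambda>v. 0 \<bullet> v)) (at 0)"
proof -
  obtain K where K: "K > 0" "\<And>x. h x \<le> K * norm x powr p" using h_upper by blast
  have "((\<lambda>y. K * norm y powr (p - 1)) \<longlongrightarrow> K * 0 powr (p - 1)) (at (0::'a))"
    using p_gt_1 by (intro tendsto_mult tendsto_const tendsto_powr' tendsto_norm_zero) (auto intro: tendsto_ident_at)
  hence lim: "((\<lambda>y. K * norm y powr (p - 1)) \<longlongrightarrow> 0) (at (0::'a))" by simp
  have "((\<lambda>y. (1 / norm (y - 0)) *\<^sub>R (h y - (h 0 + 0 \<bullet> (y - 0)))) \<longlongrightarrow> 0) (at 0)"
  proof (rule tendsto_sandwich[OF _ _ tendsto_const lim])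
    show "\<forall>\<^sub>F y in at 0. 0 \<le> (1 / norm (y - 0)) *\<^sub>R (h y - (h 0 + 0 \<bullet> (y - 0)))" by simp
    show "\<forall>\<^sub>F y in at 0. (1 / norm (y - 0)) *\<^sub>R (h y - (h 0 + 0 \<bullet> (y - 0))) \<le> K * norm y powr (p - 1)"
      unfolding eventually_at_filter
    proof (rule always_eventually, intro allI impI)
      fix y :: 'a assume "y \<noteq> 0"
      hence "h y / norm y \<le> (K * norm y powr p) / norm y" using K by (intro divide_right_mono) auto
      also have "\<dots> = K * norm y powr (p - 1)" using \<open>y \<noteq> 0\<close> by (simp add: powr_diff)
      finally show "(1 / norm (y - 0)) *\<^sub>R (h y - (h 0 + 0 \<bullet> (y - 0))) \<le> K * norm y powr (p - 1)" by simp
    qed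
  qed
  thus ?thesis by (simp add: has_derivative_at_within has_derivative_def has_derivative_iff_norm
       tendsto_norm_zero_iff divide_inverse bounded_linear_zero abs_inverse)
qed

lemma h_derivative: "(h has_derivative (\<lambda>v. g x \<bullet> v)) (at x)"
proof -
  have "\<exists>a. (h has_derivative (\<lambda>v. a \<bullet> v)) (at x)"
  proof (cases "x = 0")
    case True thus ?thesis using h_derivative_0 by blast
  next
    case False thus ?thesis using h_gradient_nonzero eventually_nhds_x_imp_x by metis
  qed
  thus ?thesis unfolding g_def by (rule someI_ex)
qed

lemma g_unique: "(h has_derivative (\<lambda>v. a \<bullet> v)) (at x) \<Longrightarrow> g x = a"
  using has_derivative_unique[OF h_derivative[of x]] by (metis inner_commute vector_eq_ldot)

lemma g_0 [simp]: "g 0 = 0"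
  by (rule g_unique[OF h_derivative_0])

lemma g_differentiable: assumes "x \<noteq> 0" shows "g differentiable (at x)"
proof -
  obtain a where a: "\<forall>\<^sub>F y in nhds x. (h has_derivative (\<lambda>v. a y \<bullet> v)) (at y)" "a differentiable (at x)"
    using h_gradient_nonzero[OF assms] .
  obtain a' where "(a has_derivative a') (at x)" using a(2) by (auto simp: differentiable_def)
  moreover have "\<forall>\<^sub>F y in nhds x. a y = g y" using a(1) by eventually_elim (simp add: g_unique)
  ultimately have "(g has_derivative a') (at x)"
    by (intro has_derivative_transform_eventually[of a a' x UNIV g])
       (auto simp: eventually_at_filter elim: eventually_mono dest: eventually_nhds_x_imp_x)
  thus ?thesis by (auto simp: differentiable_def)
qed

lemma g_isCont: "x \<noteq> 0 \<Longrightarrow> isCont g x"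
  by (rule differentiable_imp_continuous_within[OF g_differentiable])

lemma h_line_derivative: "((\<lambda>t. h (x + t *\<^sub>R v)) has_real_derivative g (x + t *\<^sub>R v) \<bullet> v) (at t)"
  by (rule line_derivative[OF h_derivative])

lemma h_mvt: "\<exists>t\<in>{0<..<1}. h (x + v) - h x = g (x + t *\<^sub>R v) \<bullet> v"
proof -
  obtain t where "0 < t" "t < 1" "h (x + 1 *\<^sub>R v) - h (x + 0 *\<^sub>R v) = (1 - 0) * (g (x + t *\<^sub>R v) \<bullet> v)"
    using MVT2[of 0 1 "\<lambda>t. h (x + t *\<^sub>R v)", OF _ h_line_derivative] by auto
  thus ?thesis by (intro bexI[of _ t]) auto
qed

lemma h_tangent: "h x + g x \<bullet> (y - x) \<le> h y"
proof -
  have lim: "(\<lambda>n. real (Suc n) * (h (x + (1 / real (Suc n)) *\<^sub>R (y - x)) - h x)) \<longlonglongrightarrow> g x \<bullet> (y - x)"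
    by (rule line_quotient_seq[OF h_derivative])
  have "real (Suc n) * (h (x + (1 / real (Suc n)) *\<^sub>R (y - x)) - h x) \<le> h y - h x" for n
  proof -
    let ?t = "1 / real (Suc n)"
    have "x + ?t *\<^sub>R (y - x) = (1 - ?t) *\<^sub>R x + ?t *\<^sub>R y" by (simp add: algebra_simps)
    hence "h (x + ?t *\<^sub>R (y - x)) - h x \<le> ?t * (h y - h x)"
      using h_convex[of ?t x y] by (simp add: algebra_simps)
    from mult_left_mono[OF this, of "real (Suc n)"] show ?thesis by simp
  qed
  hence "g x \<bullet> (y - x) \<le> h y - h x" by (intro LIMSEQ_le_const2[OF lim]) auto
  thus ?thesis by simp
qed

lemma h_tangent_strict: assumes "x \<noteq> y" shows "h x + g x \<bullet> (y - x) < h y"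
proof -
  have "(1/2) *\<^sub>R (x + y) - x = (1/2) *\<^sub>R (y - x)" by (simp add: algebra_simps flip: scaleR_add_left)
  hence "h x + g x \<bullet> (y - x) / 2 \<le> h ((1/2) *\<^sub>R (x + y))" using h_tangent[of x "(1/2) *\<^sub>R (x + y)"] by simp
  also have "\<dots> < (h x + h y) / 2" by (rule h_midpoint_strict[OF p_gt_1 assms])
  finally show ?thesis by simp
qed

lemma g_strict_mono: assumes "x \<noteq> y" shows "0 < (g y - g x) \<bullet> (y - x)"
  using h_tangent_strict[OF assms] h_tangent_strict[OF assms[symmetric]]
  by (simp add: inner_diff_left inner_diff_right)

text \<open>A minimiser of \<open>h x - \<xi> \<bullet> x\<close> is a solution, and it exists
  because \<open>h\<close> grows faster than linearly. So every linear functional occurs in the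
  expansion of \<open>h\<close> at some point.\<close>

lemma g_surj: "\<exists>x. g x = \<xi>"
proof -
  obtain k where k: "k > 0" "\<And>x. k * norm x powr p \<le> h x" using h_lower by blast
  define F where "F x = h x - \<xi> \<bullet> x" for x
  \<comment> \<open>Radius at which \<open>k * norm x powr (p - 1)\<close> reaches
    \<open>norm \<xi> + 1\<close>; beyond it \<open>F\<close> is nonnegative and cannot beat its
    value at 0.\<close>
  define R where "R = ((norm \<xi> + 1) / k) powr (1 / (p - 1))"
  have R: "0 < R" using k add_nonneg_pos[OF norm_ge_zero[of \<xi>] zero_less_one] by (simp add: R_def)
  have out: "0 \<le> F x" if "R \<le> norm x" for x
  proof -
    have "(norm \<xi> + 1) / k = R powr (p - 1)"
    proof -
      have "0 \<le> (norm \<xi> + 1) / k" "norm \<xi> + 1 \<noteq> 0" using k norm_ge_zero[of \<xi>] by (simp, linarith)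
      thus ?thesis using p_gt_1 k(1) unfolding R_def powr_powr by simp
    qed
    also have "\<dots> \<le> norm x powr (p - 1)" using that R p_gt_1 by (intro powr_mono2) auto
    finally have "norm \<xi> \<le> k * norm x powr (p - 1)" using k by (simp add: field_simps)
    hence "norm \<xi> * norm x \<le> k * norm x powr (p - 1) * norm x" by (intro mult_right_mono) auto
    also have "\<dots> = k * norm x powr p" using that R by (auto simp: powr_diff)
    also have "\<dots> \<le> h x" by (rule k)
    finally show ?thesis using norm_cauchy_schwarz[of \<xi> x] by (simp add: F_def)
  qed
  have "continuous_on (cball 0 R) F" unfolding F_def by (intro continuous_intros h_continuous_on)
  then obtain x where x: "x \<in> cball 0 R" "\<And>y. y \<in> cball 0 R \<Longrightarrow> F x \<le> F y"
    using continuous_attains_inf[of "cball 0 R" F] R by auto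
  have "F x \<le> F y" for y
  proof (cases "norm y \<le> R")
    case False
    have "F x \<le> F 0" using R by (intro x) auto
    also have "\<dots> = 0" by (simp add: F_def)
    also have "\<dots> \<le> F y" using False by (intro out) auto
    finally show ?thesis .
  qed (use x in auto)
  moreover have "(F has_derivative (\<lambda>v. g x \<bullet> v - \<xi> \<bullet> v)) (at x)"
    unfolding F_def[abs_def] by (intro has_derivative_diff h_derivative has_derivative_inner_right has_derivative_ident)
  ultimately have "(\<lambda>v. g x \<bullet> v - \<xi> \<bullet> v) = (\<lambda>v. 0)" by (intro differential_zero_maxmin[of x UNIV F]) auto
  hence "(g x - \<xi>) \<bullet> (g x - \<xi>) = 0" by (metis inner_diff_left)
  thus ?thesis by auto
qed

text \<open>Far away, at \<open>R \<zeta>\<close>, the function \<open>h (z - y1) - h (z - y2)\<close> behaves like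
  \<open>R powr (p - 1) * (g \<zeta> \<bullet> (y2 - y1))\<close>, and \<open>g\<close> is onto. The intermediate value theorem along
  \<open>y2 - y1\<close> turns limiting equal values into exactly equal ones.\<close>

lemma bisectors_parallel:
  assumes y: "y1 \<noteq> y2"
    and lev: "\<And>z z'. h (z - y1) - h (z - y2) = h (z' - y1) - h (z' - y2) \<Longrightarrow>
      h (z - x1) - h (z - x2) = h (z' - x1) - h (z' - x2)"
  shows "\<exists>c. x2 - x1 = c *\<^sub>R (y2 - y1)"
proof -
  define e where "e = y2 - y1"
  define e2 where "e2 = x2 - x1"
  \<comment> \<open>Component of \<open>e2\<close> orthogonal to \<open>e\<close>; it has to
    vanish.\<close>
  define d where "d = e2 - ((e2 \<bullet> e) / (e \<bullet> e)) *\<^sub>R e"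
  have e0: "e \<noteq> 0" using y by (simp add: e_def)
  have de: "d \<bullet> e = 0" using e0 by (simp add: d_def inner_diff_left)
  have de2: "d \<bullet> e2 = d \<bullet> d" using de by (simp add: d_def inner_diff_right)
  have "d = 0"
  proof (rule ccontr)
    assume d0: "d \<noteq> 0"
    \<comment> \<open>The gradients \<open>e\<close> and \<open>e + d\<close> agree when paired with
      \<open>e\<close> but not with \<open>e2\<close>, so these two directions have asymptotically
      equal values of the first difference function and different ones of the second.\<close>
    obtain \<zeta> where \<zeta>: "g \<zeta> = e" using g_surj by blast
    obtain \<zeta>' where \<zeta>': "g \<zeta>' = e + d" using g_surj by blast
    have "e + d \<noteq> 0"
    proof
      assume "e + d = 0"
      hence "(e + d) \<bullet> e = 0" by simp
      thus False using de e0 by (simp add: inner_add_left)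
    qed
    hence nz: "\<zeta> \<noteq> 0" "\<zeta>' \<noteq> 0" using \<zeta> \<zeta>' e0 by auto
    define m where "m = e \<bullet> e2 + (d \<bullet> d) / 2"
    have dd: "0 < d \<bullet> d" using d0 by simp
    have lt: "g \<zeta> \<bullet> e2 < m" "m < g \<zeta>' \<bullet> e2" using dd by (auto simp: m_def \<zeta> \<zeta>' inner_add_left de2)
    have "isCont (\<lambda>q. g q \<bullet> e2) \<zeta>" "isCont (\<lambda>q. g q \<bullet> e2) \<zeta>'" using g_isCont nz by (auto intro!: continuous_intros)
    hence t: "((\<lambda>q. g q \<bullet> e2) \<longlongrightarrow> g \<zeta> \<bullet> e2) (nhds \<zeta>)" "((\<lambda>q. g q \<bullet> e2) \<longlongrightarrow> g \<zeta>' \<bullet> e2) (nhds \<zeta>')"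
      unfolding isCont_def by (simp_all only: tendsto_at_iff_tendsto_nhds[of "\<lambda>q. g q \<bullet> e2"])
    have "\<forall>\<^sub>F q in nhds \<zeta>. g q \<bullet> e2 < m" "\<forall>\<^sub>F q in nhds \<zeta>'. m < g q \<bullet> e2"
      by (rule order_tendstoD(2)[OF t(1) lt(1)], rule order_tendstoD(1)[OF t(2) lt(2)])
    then obtain r1 r2 where r12: "r1 > 0" "\<And>q. dist q \<zeta> < r1 \<Longrightarrow> g q \<bullet> e2 < m"
      "r2 > 0" "\<And>q. dist q \<zeta>' < r2 \<Longrightarrow> m < g q \<bullet> e2" unfolding eventually_nhds_metric by metis
    define r where "r = min r1 r2"
    have r: "r > 0" "\<And>q. dist q \<zeta> < r \<Longrightarrow> g q \<bullet> e2 < m" "\<And>q. dist q \<zeta>' < r \<Longrightarrow> m < g q \<bullet> e2"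
      using r12 by (auto simp: r_def)
    define \<delta> where "\<delta> = r / (4 * norm e)"
    have \<delta>: "0 < \<delta>" "\<delta> * norm e < r / 2" using r e0 by (auto simp: \<delta>_def)
    \<comment> \<open>By strict monotonicity of \<open>g\<close> the pairing with \<open>e\<close>
      crosses its value at \<open>\<zeta>\<close> along this segment, as the intermediate value
      theorem needs. The bound on \<open>\<delta>\<close> leaves \<open>r / 2\<close> for the mean
      value point below.\<close>
    define q where "q t = \<zeta>' + t *\<^sub>R e" for t
    have mono: "g (q (- \<delta>)) \<bullet> e < g \<zeta> \<bullet> e" "g \<zeta> \<bullet> e < g (q \<delta>) \<bullet> e"
    proof -
      have "0 < \<delta> * ((g (q \<delta>) - g \<zeta>') \<bullet> e)" "0 < \<delta> * ((g \<zeta>' - g (q (- \<delta>))) \<bullet> e)"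
        using g_strict_mono[of \<zeta>' "q \<delta>"] g_strict_mono[of "q (- \<delta>)" \<zeta>'] \<delta> e0 by (auto simp: q_def)
      hence "0 < (g (q \<delta>) - g \<zeta>') \<bullet> e" "0 < (g \<zeta>' - g (q (- \<delta>))) \<bullet> e" using \<delta> by (auto simp: zero_less_mult_iff)
      moreover have "g \<zeta>' \<bullet> e = g \<zeta> \<bullet> e" by (simp add: \<zeta> \<zeta>' inner_add_left de)
      ultimately show "g (q (- \<delta>)) \<bullet> e < g \<zeta> \<bullet> e" "g \<zeta> \<bullet> e < g (q \<delta>) \<bullet> e" by (auto simp: inner_diff_left)
    qed
    define bs where "bs n u1 u2 w = real (Suc n) * (h (w - (1 / real (Suc n)) *\<^sub>R u1) - h (w - (1 / real (Suc n)) *\<^sub>R u2))"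
      for n u1 u2 w
    have bs_lim: "(\<lambda>n. bs n u1 u2 w) \<longlonglongrightarrow> g w \<bullet> (u2 - u1)" for u1 u2 w
      using tendsto_diff[OF line_quotient_seq[OF h_derivative, of w "- u1"] line_quotient_seq[OF h_derivative, of w "- u2"]]
      by (simp add: bs_def[abs_def] algebra_simps inner_diff_right)
    have ev: "\<forall>\<^sub>F n in sequentially. bs n y1 y2 w < bs n y1 y2 w'" if "g w \<bullet> e < g w' \<bullet> e" for w w'
    proof -
      have "\<forall>\<^sub>F n in sequentially. 0 < bs n y1 y2 w' - bs n y1 y2 w"
        by (rule order_tendstoD(1)[OF tendsto_diff[OF bs_lim bs_lim]]) (use that in \<open>simp add: e_def\<close>)
      thus ?thesis by simp
    qed
    note ev1 = ev[OF mono(1)] and ev2 = ev[OF mono(2)]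
    have lim0: "(\<lambda>n. (1 / real (Suc n)) * (norm x1 + norm x2)) \<longlonglongrightarrow> 0"
      using tendsto_mult_left_zero[OF LIMSEQ_inverse_real_of_nat] by (simp add: inverse_eq_divide)
    have ev3: "\<forall>\<^sub>F n in sequentially. (1 / real (Suc n)) * (norm x1 + norm x2) < r / 2"
      by (rule order_tendstoD(2)[OF lim0]) (use r in simp)
    have "\<exists>n. bs n y1 y2 (q (- \<delta>)) < bs n y1 y2 \<zeta> \<and> bs n y1 y2 \<zeta> < bs n y1 y2 (q \<delta>) \<and>
       (1 / real (Suc n)) * (norm x1 + norm x2) < r / 2"
      using eventually_happens[OF eventually_conj[OF ev1 eventually_conj[OF ev2 ev3]]] by auto
    then obtain n where n: "bs n y1 y2 (q (- \<delta>)) < bs n y1 y2 \<zeta>" "bs n y1 y2 \<zeta> < bs n y1 y2 (q \<delta>)"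
       "(1 / real (Suc n)) * (norm x1 + norm x2) < r / 2" by blast
    define R where "R = real (Suc n)"
    have R: "0 < R" by (simp add: R_def)
    have cont: "continuous_on {- \<delta>..\<delta>} (\<lambda>t. bs n y1 y2 (q t))" unfolding bs_def q_def
      by (intro continuous_intros h_continuous_on_comp)
    obtain t where t: "- \<delta> \<le> t" "t \<le> \<delta>" "bs n y1 y2 (q t) = bs n y1 y2 \<zeta>"
      using IVT'[of "\<lambda>t. bs n y1 y2 (q t)" "- \<delta>" "bs n y1 y2 \<zeta>" \<delta>] n \<delta> cont by auto
    have scal: "h (R *\<^sub>R w - u1) - h (R *\<^sub>R w - u2) = R powr (p - 1) * bs n u1 u2 w" for w u1 u2
    proof -
      have "R *\<^sub>R w - u = R *\<^sub>R (w - (1 / R) *\<^sub>R u)" for u using R by (simp add: algebra_simps)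
      hence "h (R *\<^sub>R w - u) = R powr p * h (w - (1 / R) *\<^sub>R u)" for u using R by (simp add: h_scale)
      moreover have "bs n u1 u2 w = R * (h (w - (1 / R) *\<^sub>R u1) - h (w - (1 / R) *\<^sub>R u2))"
        by (simp only: bs_def R_def)
      ultimately show ?thesis using R by (simp add: powr_diff right_diff_distrib)
    qed
    have "h (R *\<^sub>R q t - x1) - h (R *\<^sub>R q t - x2) = h (R *\<^sub>R \<zeta> - x1) - h (R *\<^sub>R \<zeta> - x2)"
      by (rule lev) (use t in \<open>simp add: scal\<close>)
    hence eq: "bs n x1 x2 (q t) = bs n x1 x2 \<zeta>" using R by (simp add: scal)
    have mv: "\<exists>c. dist c w < r / 2 \<and> bs n x1 x2 w = g c \<bullet> e2" for w
    proof -
      let ?a = "w - (1 / R) *\<^sub>R x2" and ?v = "(1 / R) *\<^sub>R (x2 - x1)"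
      obtain s where s: "s \<in> {0<..<1}" "h (?a + ?v) - h ?a = g (?a + s *\<^sub>R ?v) \<bullet> ?v" using h_mvt by blast
      have av: "?a + ?v = w - (1 / R) *\<^sub>R x1" by (simp add: algebra_simps)
      have "bs n x1 x2 w = R * (h (?a + ?v) - h ?a)" unfolding av by (simp add: bs_def R_def)
      also have "\<dots> = g (?a + s *\<^sub>R ?v) \<bullet> e2" unfolding s(2) using R by (simp add: e2_def)
      finally have 1: "bs n x1 x2 w = g (?a + s *\<^sub>R ?v) \<bullet> e2" .
      have "?a + s *\<^sub>R ?v - w = - (1 / R) *\<^sub>R ((1 - s) *\<^sub>R x2 + s *\<^sub>R x1)" by (simp add: algebra_simps)
      hence "norm (?a + s *\<^sub>R ?v - w) = (1 / R) * norm ((1 - s) *\<^sub>R x2 + s *\<^sub>R x1)" using R by simp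
      also have "\<dots> \<le> (1 / R) * (norm x1 + norm x2)"
      proof (intro mult_left_mono)
        have "norm ((1 - s) *\<^sub>R x2 + s *\<^sub>R x1) \<le> (1 - s) * norm x2 + s * norm x1"
          using norm_triangle_ineq[of "(1 - s) *\<^sub>R x2" "s *\<^sub>R x1"] s(1) by simp
        also have "\<dots> \<le> 1 * norm x2 + 1 * norm x1" using s(1) by (intro add_mono mult_right_mono) auto
        finally show "norm ((1 - s) *\<^sub>R x2 + s *\<^sub>R x1) \<le> norm x1 + norm x2" by simp
      qed (use R in auto)
      also have "\<dots> < r / 2" using n(3) by (simp add: R_def)
      finally have "dist (?a + s *\<^sub>R ?v) w < r / 2" by (simp only: dist_norm)
      thus ?thesis using 1 by blast
    qed
    obtain c1 where c1: "dist c1 \<zeta> < r / 2" "bs n x1 x2 \<zeta> = g c1 \<bullet> e2" using mv by blast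
    obtain c2 where c2: "dist c2 (q t) < r / 2" "bs n x1 x2 (q t) = g c2 \<bullet> e2" using mv by blast
    have "dist (q t) \<zeta>' \<le> \<delta> * norm e" using t by (simp add: q_def dist_norm mult_right_mono)
    hence "dist c2 \<zeta>' < r" using dist_triangle[of c2 \<zeta>' "q t"] c2 \<delta> by simp
    hence "m < g c2 \<bullet> e2" by (rule r(3))
    moreover have "g c1 \<bullet> e2 < m" using c1 r by (intro r(2)) auto
    ultimately show False using eq c1 c2 by simp
  qed
  hence "e2 = ((e2 \<bullet> e) / (e \<bullet> e)) *\<^sub>R e" by (simp add: d_def)
  thus ?thesis unfolding e_def e2_def by blast
qed

subsection \<open>Second derivatives\<close>

text \<open>The Hessian of \<open>h\<close>. Differentiability of \<open>g\<close> is established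
  away from 0, hence the hypothesis \<open>x \<noteq> 0\<close> throughout.\<close>

definition G :: "'a \<Rightarrow> 'a \<Rightarrow> 'a" where "G x = frechet_derivative g (at x)"

definition q :: "'a \<Rightarrow> 'a \<Rightarrow> real" where "q x v = G x v \<bullet> v"

lemma G_derivative: "x \<noteq> 0 \<Longrightarrow> (g has_derivative G x) (at x)"
  unfolding G_def using g_differentiable frechet_derivative_works by blast

lemma G_linear: assumes "x \<noteq> 0"
  shows "G x (a + b) = G x a + G x b" "G x (a - b) = G x a - G x b" "G x (c *\<^sub>R a) = c *\<^sub>R G x a" "bounded_linear (G x)"
proof -
  interpret bounded_linear "G x" using G_derivative[OF assms] by (rule has_derivative_bounded_linear)
  show "G x (a + b) = G x a + G x b" "G x (a - b) = G x a - G x b" "G x (c *\<^sub>R a) = c *\<^sub>R G x a"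
    by (rule add diff scaleR)+
  show "bounded_linear (G x)" by (rule bounded_linear_axioms)
qed

lemma q_scale: "x \<noteq> 0 \<Longrightarrow> q x (c *\<^sub>R v) = c\<^sup>2 * q x v"
  by (simp add: q_def G_linear power2_eq_square)

lemma g_expansion:
  assumes "x \<noteq> 0" "0 < e"
  shows "\<exists>d>0. \<forall>v. norm v < d \<longrightarrow> norm (g (x + v) - g x - G x v) \<le> e * norm v"
proof -
  obtain d where d: "0 < d" "\<And>y. norm (y - x) < d \<Longrightarrow> norm (g y - g x - G x (y - x)) \<le> e * norm (y - x)"
    using G_derivative[OF assms(1)] assms(2) unfolding has_derivative_at_alt by blast
  show ?thesis
    by (intro exI[of _ d] conjI allI impI) (use d(1) d(2)[of "x + v" for v] in auto)
qed

text \<open>Second-order Taylor formula with Peano remainder. The Hessian need not be continuous, so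
  the mean value theorem is applied to \<open>h\<close> minus its quadratic polynomial, whose
  derivative is controlled by the expansion of \<open>g\<close> at \<open>x\<close>.\<close>

lemma h_expansion:
  assumes "x \<noteq> 0" "0 < e"
  shows "\<exists>d>0. \<forall>v. norm v < d \<longrightarrow> \<bar>h (x + v) - h x - g x \<bullet> v - q x v / 2\<bar> \<le> e * (norm v)\<^sup>2"
proof -
  obtain d where d: "0 < d" "\<And>v. norm v < d \<Longrightarrow> norm (g (x + v) - g x - G x v) \<le> e * norm v"
    using g_expansion[OF assms] by blast
  have "\<bar>h (x + v) - h x - g x \<bullet> v - q x v / 2\<bar> \<le> e * (norm v)\<^sup>2" if v: "norm v < d" for v
  proof -
    let ?\<phi> = "\<lambda>t. h (x + t *\<^sub>R v) - t * (g x \<bullet> v) - t\<^sup>2 * (q x v / 2)"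
    have der: "(?\<phi> has_real_derivative (g (x + t *\<^sub>R v) \<bullet> v - g x \<bullet> v - t * q x v)) (at t)" for t
      by (auto intro!: derivative_eq_intros h_line_derivative)
    obtain t where t: "0 < t" "t < 1" "?\<phi> 1 - ?\<phi> 0 = (1 - 0) * (g (x + t *\<^sub>R v) \<bullet> v - g x \<bullet> v - t * q x v)"
      using MVT2[of 0 1 ?\<phi>, OF _ der] by auto
    have "norm (t *\<^sub>R v) \<le> norm v" using t by (simp add: mult_left_le_one_le)
    hence tv: "norm (t *\<^sub>R v) < d" using v by linarith
    have "h (x + v) - h x - g x \<bullet> v - q x v / 2 = (g (x + t *\<^sub>R v) - g x - G x (t *\<^sub>R v)) \<bullet> v"
      using t(3) by (simp add: inner_diff_left q_def G_linear assms)
    hence "\<bar>h (x + v) - h x - g x \<bullet> v - q x v / 2\<bar> \<le> norm (g (x + t *\<^sub>R v) - g x - G x (t *\<^sub>R v)) * norm v"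
      by (simp only: Cauchy_Schwarz_ineq2)
    also have "\<dots> \<le> (e * norm (t *\<^sub>R v)) * norm v" by (intro mult_right_mono d tv) auto
    also have "\<dots> \<le> (e * norm v) * norm v" using \<open>norm (t *\<^sub>R v) \<le> norm v\<close> assms(2) by (intro mult_right_mono mult_left_mono) auto
    finally show ?thesis by (simp add: power2_eq_square)
  qed
  thus ?thesis using d(1) by blast
qed

text \<open>The mean value theorem is used in direction \<open>a\<close> only; expanding
  \<open>g\<close> from \<open>x\<close> to the two resulting points produces the Hessian in
  direction \<open>b\<close>.\<close>

lemma second_difference_bound:
  assumes x: "x \<noteq> 0" and e: "0 < e"
  shows "\<exists>d>0. \<forall>t. 0 < t \<longrightarrow> t < d \<longrightarrow>
    \<bar>h (x + t *\<^sub>R a + t *\<^sub>R b) - h (x + t *\<^sub>R a) - h (x + t *\<^sub>R b) + h x - t\<^sup>2 * (G x b \<bullet> a)\<bar> \<le> e * t\<^sup>2"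
proof -
  define M where "M = norm a + norm b + 1"
  have M: "0 < M" "norm a \<le> M" "norm b \<le> M" "norm a + norm b \<le> M" by (auto simp: M_def add_nonneg_pos)
  \<comment> \<open>Two expansion errors of size \<open>e' * t * M\<close>, paired with
    \<open>a\<close> and multiplied by \<open>t\<close>, add up to at most
    \<open>e * t^2\<close>.\<close>
  define e' where "e' = e / (2 * M * M)"
  have e': "0 < e'" using M e by (simp add: e'_def)
  obtain d where d: "0 < d" "\<And>v. norm v < d \<Longrightarrow> norm (g (x + v) - g x - G x v) \<le> e' * norm v"
    using g_expansion[OF x e'] by blast
  have "\<bar>h (x + t *\<^sub>R a + t *\<^sub>R b) - h (x + t *\<^sub>R a) - h (x + t *\<^sub>R b) + h x - t\<^sup>2 * (G x b \<bullet> a)\<bar> \<le> e * t\<^sup>2"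
    if t: "0 < t" "t < d / M" for t
  proof -
    let ?\<phi> = "\<lambda>s. h ((x + t *\<^sub>R b) + s *\<^sub>R a) - h (x + s *\<^sub>R a)"
    have der: "(?\<phi> has_real_derivative (g ((x + t *\<^sub>R b) + s *\<^sub>R a) \<bullet> a - g (x + s *\<^sub>R a) \<bullet> a)) (at s)" for s
      by (intro DERIV_diff h_line_derivative)
    obtain s where s: "0 < s" "s < t" "?\<phi> t - ?\<phi> 0 = (t - 0) * (g ((x + t *\<^sub>R b) + s *\<^sub>R a) \<bullet> a - g (x + s *\<^sub>R a) \<bullet> a)"
      using MVT2[OF t(1), of ?\<phi>, OF der] by auto
    define v1 where "v1 = t *\<^sub>R b + s *\<^sub>R a"
    define v2 where "v2 = s *\<^sub>R a"
    have n2: "norm v2 \<le> t * M"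
    proof -
      have "s * norm a \<le> t * M" using s M by (intro mult_mono) auto
      thus ?thesis using s by (simp add: v2_def)
    qed
    have n1: "norm v1 \<le> t * M"
    proof -
      have "norm v1 \<le> t * norm b + s * norm a" unfolding v1_def using norm_triangle_ineq[of "t *\<^sub>R b" "s *\<^sub>R a"] s t by simp
      also have "\<dots> \<le> t * norm b + t * norm a" using s by (intro add_mono mult_right_mono) auto
      also have "\<dots> = t * (norm a + norm b)" by (simp add: algebra_simps)
      also have "\<dots> \<le> t * M" using M t by (intro mult_left_mono) auto
      finally show ?thesis .
    qed
    have tM: "t * M < d" using t M by (simp add: field_simps)
    have r1: "norm (g (x + v1) - g x - G x v1) \<le> e' * (t * M)"
      using d(2)[of v1] n1 tM mult_left_mono[OF n1, of e'] e' by linarith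
    have r2: "norm (g (x + v2) - g x - G x v2) \<le> e' * (t * M)"
      using d(2)[of v2] n2 tM mult_left_mono[OF n2, of e'] e' by linarith
    have "h (x + t *\<^sub>R a + t *\<^sub>R b) - h (x + t *\<^sub>R a) - h (x + t *\<^sub>R b) + h x - t\<^sup>2 * (G x b \<bullet> a) =
      t * ((g (x + v1) - g (x + v2)) \<bullet> a - t * (G x b \<bullet> a))"
      using s(3) by (simp add: v1_def v2_def algebra_simps power2_eq_square)
    also have "\<dots> = t * (((g (x + v1) - g x - G x v1) - (g (x + v2) - g x - G x v2)) \<bullet> a)"
      by (simp add: v1_def v2_def G_linear x inner_diff_left inner_add_left algebra_simps)
    finally have "\<bar>h (x + t *\<^sub>R a + t *\<^sub>R b) - h (x + t *\<^sub>R a) - h (x + t *\<^sub>R b) + h x - t\<^sup>2 * (G x b \<bullet> a)\<bar>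
      = t * \<bar>((g (x + v1) - g x - G x v1) - (g (x + v2) - g x - G x v2)) \<bullet> a\<bar>"
      using t by (simp add: abs_mult)
    also have "\<dots> \<le> t * (norm ((g (x + v1) - g x - G x v1) - (g (x + v2) - g x - G x v2)) * norm a)"
      using t by (intro mult_left_mono Cauchy_Schwarz_ineq2) auto
    also have "\<dots> \<le> t * ((e' * (t * M) + e' * (t * M)) * M)"
      using t M e' by (intro mult_left_mono mult_mono order_trans[OF norm_triangle_ineq4 add_mono[OF r1 r2]]) auto
    also have "\<dots> = e * t\<^sup>2" using M by (simp add: e'_def field_simps power2_eq_square)
    finally show ?thesis .
  qed
  thus ?thesis using d(1) M by (intro exI[of _ "d / M"]) auto
qed

text \<open>Schwarz's theorem for a gradient differentiable at the point: the second difference is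
  symmetric in \<open>a\<close> and \<open>b\<close> and determines both sides up to
  \<open>o(t^2)\<close>.\<close>

lemma G_symmetric:
  assumes x: "x \<noteq> 0" shows "G x a \<bullet> b = G x b \<bullet> a"
proof -
  have "\<bar>G x a \<bullet> b - G x b \<bullet> a\<bar> \<le> 0 + e" if e: "0 < e" for e
  proof -
    obtain d1 where d1: "0 < d1" "\<And>t. 0 < t \<Longrightarrow> t < d1 \<Longrightarrow>
      \<bar>h (x + t *\<^sub>R a + t *\<^sub>R b) - h (x + t *\<^sub>R a) - h (x + t *\<^sub>R b) + h x - t\<^sup>2 * (G x b \<bullet> a)\<bar> \<le> (e / 2) * t\<^sup>2"
      using second_difference_bound[OF x, of "e / 2" a b] e by auto
    obtain d2 where d2: "0 < d2" "\<And>t. 0 < t \<Longrightarrow> t < d2 \<Longrightarrow>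
      \<bar>h (x + t *\<^sub>R b + t *\<^sub>R a) - h (x + t *\<^sub>R b) - h (x + t *\<^sub>R a) + h x - t\<^sup>2 * (G x a \<bullet> b)\<bar> \<le> (e / 2) * t\<^sup>2"
      using second_difference_bound[OF x, of "e / 2" b a] e by auto
    define t where "t = min d1 d2 / 2"
    have t: "0 < t" "t < d1" "t < d2" using d1 d2 by (auto simp: t_def)
    have c: "x + t *\<^sub>R b + t *\<^sub>R a = x + t *\<^sub>R a + t *\<^sub>R b" by simp
    have "\<bar>t\<^sup>2 * (G x a \<bullet> b) - t\<^sup>2 * (G x b \<bullet> a)\<bar> \<le> e * t\<^sup>2"
      using d1(2)[OF t(1,2)] d2(2)[OF t(1,3)] unfolding c by linarith
    hence "t\<^sup>2 * \<bar>G x a \<bullet> b - G x b \<bullet> a\<bar> \<le> t\<^sup>2 * e" by (simp add: abs_mult mult.commute flip: right_diff_distrib)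
    thus ?thesis using t by simp
  qed
  hence "\<bar>G x a \<bullet> b - G x b \<bullet> a\<bar> \<le> 0" by (rule field_le_epsilon)
  thus ?thesis by simp
qed

lemma g_line_derivative:
  assumes "x + t *\<^sub>R v \<noteq> 0"
  shows "((\<lambda>t. g (x + t *\<^sub>R v) \<bullet> w) has_real_derivative G (x + t *\<^sub>R v) v \<bullet> w) (at t)"
proof -
  have "((\<lambda>t. x + t *\<^sub>R v) has_derivative (\<lambda>s. s *\<^sub>R v)) (at t)" by (auto intro!: derivative_eq_intros)
  from has_derivative_compose[OF this G_derivative[OF assms]]
  have "((\<lambda>t. g (x + t *\<^sub>R v) \<bullet> w) has_derivative (\<lambda>s. G (x + t *\<^sub>R v) (s *\<^sub>R v) \<bullet> w)) (at t)"
    by (rule has_derivative_inner_left)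
  thus ?thesis by (simp add: has_field_derivative_def G_linear assms mult.commute[of _ "G (x + t *\<^sub>R v) v \<bullet> w"])
qed

text \<open>Computes the Hessian form from any expression for \<open>h\<close> on a segment around
  \<open>x\<close>, by differentiating that expression twice.\<close>

lemma q_eqI:
  assumes x: "x \<noteq> 0" and r: "0 < r" and \<phi>: "\<And>t. \<bar>t\<bar> < r \<Longrightarrow> h (x + t *\<^sub>R v) = \<phi> t"
    and \<psi>: "\<And>t. \<bar>t\<bar> < r \<Longrightarrow> (\<phi> has_real_derivative \<psi> t) (at t)" and D: "(\<psi> has_real_derivative D) (at 0)"
  shows "q x v = D"
proof -
  have eq: "g (x + t *\<^sub>R v) \<bullet> v = \<psi> t" if "\<bar>t\<bar> < r" for t
  proof -
    have "(\<phi> has_real_derivative g (x + t *\<^sub>R v) \<bullet> v) (at t)"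
      by (rule has_field_derivative_transform_within_open[OF h_line_derivative, where S="{-r<..<r}"])
         (use that \<phi> in auto)
    thus ?thesis using \<psi>[OF that] by (rule DERIV_unique)
  qed
  have "((\<lambda>t. g (x + t *\<^sub>R v) \<bullet> v) has_real_derivative q x v) (at 0)"
    using g_line_derivative[of x 0 v v] x by (simp add: q_def)
  hence "(\<psi> has_real_derivative q x v) (at 0)"
    by (rule has_field_derivative_transform_within_open[where S="{-r<..<r}"]) (use r eq in auto)
  thus ?thesis using D by (rule DERIV_unique)
qed

text \<open>Euler's relation for the homogeneous function \<open>h\<close>. It provides the
  positivity that replaces definiteness of the Hessian, which may fail in other directions.\<close>

lemma q_self: assumes "x \<noteq> 0" shows "q x x = p * (p - 1) * h x"
proof (rule q_eqI[OF assms, of 1 _ "\<lambda>t. (1 + t) powr p * h x" "\<lambda>t. p * (1 + t) powr (p - 1) * h x"])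
  fix t :: real assume t: "\<bar>t\<bar> < 1"
  have "x + t *\<^sub>R x = (1 + t) *\<^sub>R x" by (simp add: scaleR_add_left)
  thus "h (x + t *\<^sub>R x) = (1 + t) powr p * h x" using t by (simp add: h_scale)
  show "((\<lambda>t. (1 + t) powr p * h x) has_real_derivative p * (1 + t) powr (p - 1) * h x) (at t)"
    using t by (auto intro!: derivative_eq_intros simp: powr_diff)
next
  show "((\<lambda>t. p * (1 + t) powr (p - 1) * h x) has_real_derivative p * (p - 1) * h x) (at 0)"
    by (auto intro!: derivative_eq_intros)
qed simp

lemma q_self_pos: "x \<noteq> 0 \<Longrightarrow> 0 < q x x"
  using p_gt_1 by (simp add: q_self)

text \<open>The hypothesis makes the mixed second derivative of \<open>h\<close> along \<open>e + f\<close> and \<open>e - f\<close> vanish.\<close>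

lemma separable:
  assumes q: "\<And>x. x \<noteq> 0 \<Longrightarrow> q x e = q x f" and e: "e \<noteq> 0" and np: "\<And>c. f \<noteq> c *\<^sub>R e"
  shows "h (x *\<^sub>R (e + f) + y *\<^sub>R (e - f)) = \<bar>x\<bar> powr p * h (e + f) + \<bar>y\<bar> powr p * h (e - f)"
proof -
  define s where "s = e + f"
  define d where "d = e - f"
  have G0: "G v d \<bullet> s = 0" if "v \<noteq> 0" for v
    using q[OF that] G_symmetric[OF that, of e f] that
    by (simp add: s_def d_def G_linear inner_diff_left inner_add_right q_def)
  \<comment> \<open>A line in direction \<open>d\<close> through a nonzero multiple of
    \<open>s\<close> avoids the origin, so \<open>g\<close> is differentiable along all of
    it.\<close>
  have nz: "x *\<^sub>R s + y *\<^sub>R d \<noteq> 0" if "x \<noteq> 0" for x y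
  proof
    assume "x *\<^sub>R s + y *\<^sub>R d = 0"
    hence eq: "(x + y) *\<^sub>R e + (x - y) *\<^sub>R f = 0" by (simp add: s_def d_def algebra_simps)
    show False
    proof (cases "x - y = 0")
      case True
      thus False using eq e that by auto
    next
      case False
      have "(x - y) *\<^sub>R f = - ((x + y) *\<^sub>R e)" using eq by (simp add: eq_neg_iff_add_eq_0 add.commute)
      hence "(1 / (x - y)) *\<^sub>R ((x - y) *\<^sub>R f) = (- ((x + y) / (x - y))) *\<^sub>R e" by simp
      thus False using np[of "- ((x + y) / (x - y))"] False by simp
    qed
  qed
  have gconst: "g (x *\<^sub>R s + y *\<^sub>R d) \<bullet> s = g (x *\<^sub>R s) \<bullet> s" if "x \<noteq> 0" for x y
  proof -
    have "((\<lambda>y. g (x *\<^sub>R s + y *\<^sub>R d) \<bullet> s) has_real_derivative 0) (at y)" for y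
      using g_line_derivative[of "x *\<^sub>R s" y d s] nz[OF that, of y] G0 by simp
    hence "g (x *\<^sub>R s + y *\<^sub>R d) \<bullet> s = g (x *\<^sub>R s + 0 *\<^sub>R d) \<bullet> s" by (rule DERIV_isconst_all[OF allI])
    thus ?thesis by simp
  qed
  \<comment> \<open>Its derivative is known to vanish only off \<open>x = 0\<close>; continuity
    carries the constancy across.\<close>
  define k where "k x = h (y *\<^sub>R d + x *\<^sub>R s) - h (0 + x *\<^sub>R s)" for x
  have kder: "(k has_real_derivative 0) (at x)" if "x \<noteq> 0" for x
  proof -
    have "(k has_real_derivative g (y *\<^sub>R d + x *\<^sub>R s) \<bullet> s - g (0 + x *\<^sub>R s) \<bullet> s) (at x)"
      unfolding k_def[abs_def] by (intro DERIV_diff h_line_derivative)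
    thus ?thesis using gconst[OF that, of y] by (simp add: add.commute)
  qed
  have kcont: "isCont k x" for x
    unfolding k_def[abs_def] by (intro continuous_intros isCont_o2[OF _ h_isCont])
  have "k x = k 0"
  proof (cases x "0::real" rule: linorder_cases)
    case less
    have "k 0 = k x" by (rule DERIV_isconst_end[OF less]) (use kder kcont in \<open>auto intro: continuous_at_imp_continuous_on\<close>)
    thus ?thesis by simp
  next
    case greater
    show ?thesis by (rule DERIV_isconst_end[OF greater]) (use kder kcont in \<open>auto intro: continuous_at_imp_continuous_on\<close>)
  qed simp
  thus ?thesis by (simp add: k_def s_def[symmetric] d_def[symmetric] h_scale add.commute)
qed

section \<open>Hessians of split costs\<close>

lemma abs_powr_derivative:
  fixes r :: real assumes "1 < r"
  shows "((\<lambda>t. \<bar>t\<bar> powr r) has_real_derivative r * \<bar>t\<bar> powr (r - 1) * sgn t) (at t)"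
proof (cases t "0::real" rule: linorder_cases)
  case less
  have "((\<lambda>t. (- t) powr r) has_real_derivative r * \<bar>t\<bar> powr (r - 1) * sgn t) (at t)"
    using less by (auto intro!: derivative_eq_intros simp: powr_diff)
  thus ?thesis
    by (rule has_field_derivative_transform_within_open[where S="{..<0}"]) (use less in auto)
next
  case greater
  have "((\<lambda>t. t powr r) has_real_derivative r * \<bar>t\<bar> powr (r - 1) * sgn t) (at t)"
    using greater by (auto intro!: derivative_eq_intros simp: powr_diff)
  thus ?thesis
    by (rule has_field_derivative_transform_within_open[where S="{0<..}"]) (use greater in auto)
next
  case equal
  have "((\<lambda>t. \<bar>t\<bar> powr (r - 1) * sgn t) \<longlongrightarrow> 0) (at (0::real))"
  proof (rule Lim_null_comparison)
    show "\<forall>\<^sub>F t in at 0. norm (\<bar>t\<bar> powr (r - 1) * sgn t) \<le> \<bar>t\<bar> powr (r - 1)"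
      by (intro always_eventually allI) (auto simp: abs_mult sgn_if)
    have "((\<lambda>t. \<bar>t\<bar> powr (r - 1)) \<longlongrightarrow> 0 powr (r - 1)) (at (0::real))"
      using assms by (intro tendsto_powr' tendsto_rabs_zero tendsto_ident_at) auto
    thus "((\<lambda>t. \<bar>t\<bar> powr (r - 1)) \<longlongrightarrow> 0) (at (0::real))" by simp
  qed
  moreover have "\<bar>t\<bar> powr (r - 1) * sgn t = (\<bar>t\<bar> powr r - \<bar>0\<bar> powr r) / (t - 0)" if "t \<noteq> 0" for t :: real
    using that assms by (auto simp: powr_diff sgn_if abs_if)
  hence "\<forall>\<^sub>F t in at 0. \<bar>t\<bar> powr (r - 1) * sgn t = (\<bar>t\<bar> powr r - \<bar>0\<bar> powr r) / (t - 0)"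
    unfolding eventually_at_filter by (intro always_eventually allI impI)
  ultimately have "((\<lambda>t. (\<bar>t\<bar> powr r - \<bar>0\<bar> powr r) / (t - 0)) \<longlongrightarrow> 0) (at (0::real))"
    by (rule Lim_transform_eventually)
  thus ?thesis using equal by (simp add: has_field_derivative_iff)
qed

text \<open>Starting from \<open>s\<close>, the cost in direction \<open>d\<close> is a constant
  plus \<open>|t|^p h d\<close>. For \<open>p < 2\<close> the difference quotients of its derivative
  blow up, against differentiability of \<open>g\<close> at \<open>s\<close>.\<close>

lemma separable_imp_p_gt_2:
  assumes sep: "\<And>x y. h (x *\<^sub>R s + y *\<^sub>R d) = \<bar>x\<bar> powr p * h s + \<bar>y\<bar> powr p * h d"
    and nz: "s \<noteq> 0" "d \<noteq> 0" and p: "p \<noteq> 2"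
  shows "2 < p"
proof (rule ccontr)
  assume "\<not> 2 < p"
  hence p2: "p < 2" using p by simp
  have "((\<lambda>t. h (s + t *\<^sub>R d)) has_real_derivative p * \<bar>t\<bar> powr (p - 1) * sgn t * h d) (at t)" for t
  proof -
    have e: "h (s + t *\<^sub>R d) = h s + \<bar>t\<bar> powr p * h d" for t using sep[of 1 t] by simp
    show ?thesis unfolding e
      using DERIV_add[OF DERIV_const[of "h s"] DERIV_cmult_right[OF abs_powr_derivative[OF p_gt_1, of t], of "h d"]] by simp
  qed
  hence ge: "g (s + t *\<^sub>R d) \<bullet> d = p * \<bar>t\<bar> powr (p - 1) * sgn t * h d" for t
    using DERIV_unique[OF h_line_derivative] by blast
  have "((\<lambda>t. g (s + t *\<^sub>R d) \<bullet> d) has_real_derivative G s d \<bullet> d) (at 0)"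
    using g_line_derivative[of s 0 d d] nz by simp
  from difference_quotient_seq[OF this]
  have lim: "(\<lambda>n. real (Suc n) * (p * (1 / real (Suc n)) powr (p - 1) * h d)) \<longlonglongrightarrow> G s d \<bullet> d"
    unfolding ge by simp
  have "real (Suc n) * (p * (1 / real (Suc n)) powr (p - 1) * h d) = (p * h d) * real (Suc n) powr (2 - p)" for n
    by (simp add: powr_diff powr_divide field_simps power2_eq_square)
  from lim[unfolded this] have "(\<lambda>n. (p * h d) * real (Suc n) powr (2 - p)) \<longlonglongrightarrow> G s d \<bullet> d" .
  moreover have "filterlim (\<lambda>n. real (Suc n)) at_top sequentially"
    using filterlim_compose[OF filterlim_real_sequentially filterlim_Suc] .
  hence "(\<lambda>n. real (Suc n) powr (p - 2)) \<longlonglongrightarrow> 0" using p2 by (intro tendsto_neg_powr) auto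
  ultimately have lim2: "(\<lambda>n. (p * h d) * real (Suc n) powr (2 - p) * real (Suc n) powr (p - 2)) \<longlonglongrightarrow> (G s d \<bullet> d) * 0"
    by (rule tendsto_mult)
  have "(p * h d) * real (Suc n) powr (2 - p) * real (Suc n) powr (p - 2) = p * h d" for n
    by (simp add: mult.assoc flip: powr_add)
  from lim2[unfolded this] have "p * h d = 0" by (simp add: LIMSEQ_const_iff)
  thus False using p_gt_1 nz by simp
qed

text \<open>For \<open>p > 2\<close> the term \<open>|t|^p\<close> has second derivative 0 at 0, so
  the Hessian at \<open>s\<close> sees only the coordinate along \<open>s\<close>.\<close>

lemma q_separable:
  assumes sep: "\<And>x y. h (x *\<^sub>R s + y *\<^sub>R d) = \<bar>x\<bar> powr p * h s + \<bar>y\<bar> powr p * h d"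
    and s: "s \<noteq> 0" and p: "2 < p"
  shows "q s (a *\<^sub>R s + b *\<^sub>R d) = p * (p - 1) * a\<^sup>2 * h s"
proof -
  define r where "r = 1 / (\<bar>a\<bar> + 1)"
  let ?K = "\<bar>b\<bar> powr p * h d"
  have pos: "0 < 1 + t * a" if "\<bar>t\<bar> < r" for t
  proof -
    have "\<bar>t\<bar> * (\<bar>a\<bar> + 1) < 1" using that by (simp add: r_def field_simps add_nonneg_pos)
    hence "\<bar>t * a\<bar> < 1" by (simp add: abs_mult algebra_simps)
    thus ?thesis by (simp add: abs_less_iff)
  qed
  have "q s (a *\<^sub>R s + b *\<^sub>R d) = (p * (p - 1) * a\<^sup>2 * h s)"
  proof (rule q_eqI[OF s, of r _ "\<lambda>t. (1 + t * a) powr p * h s + \<bar>t\<bar> powr p * ?K"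
        "\<lambda>t. p * a * (1 + t * a) powr (p - 1) * h s + (p * \<bar>t\<bar> powr (p - 1) * sgn t) * ?K"])
    show "0 < r" by (simp add: r_def add_nonneg_pos)
    fix t :: real assume t: "\<bar>t\<bar> < r"
    have "s + t *\<^sub>R (a *\<^sub>R s + b *\<^sub>R d) = (1 + t * a) *\<^sub>R s + (t * b) *\<^sub>R d" by (simp add: algebra_simps)
    thus "h (s + t *\<^sub>R (a *\<^sub>R s + b *\<^sub>R d)) = (1 + t * a) powr p * h s + \<bar>t\<bar> powr p * ?K"
      using pos[OF t] by (simp add: sep abs_mult powr_mult)
    have 1: "((\<lambda>t. (1 + t * a) powr p * h s) has_real_derivative p * a * (1 + t * a) powr (p - 1) * h s) (at t)"
      using pos[OF t] by (auto intro!: derivative_eq_intros simp: powr_diff)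
    show "((\<lambda>t. (1 + t * a) powr p * h s + \<bar>t\<bar> powr p * ?K) has_real_derivative
        p * a * (1 + t * a) powr (p - 1) * h s + (p * \<bar>t\<bar> powr (p - 1) * sgn t) * ?K) (at t)"
      by (intro DERIV_add 1 DERIV_cmult_right abs_powr_derivative p_gt_1)
  next
    have 1: "((\<lambda>t. p * a * (1 + t * a) powr (p - 1) * h s) has_real_derivative p * (p - 1) * a\<^sup>2 * h s) (at 0)"
      by (auto intro!: derivative_eq_intros simp: power2_eq_square)
    have "((\<lambda>t. \<bar>t\<bar> powr (p - 1) * sgn t) has_real_derivative 0) (at 0)"
    proof -
      have "((\<lambda>t. \<bar>t\<bar> powr (p - 2)) \<longlongrightarrow> 0 powr (p - 2)) (at (0::real))"
        using p by (intro tendsto_powr' tendsto_rabs_zero tendsto_ident_at) auto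
      hence "((\<lambda>t. \<bar>t\<bar> powr (p - 2)) \<longlongrightarrow> 0) (at (0::real))" by simp
      moreover have "\<bar>t\<bar> powr (p - 2) = (\<bar>t\<bar> powr (p - 1) * sgn t - \<bar>0\<bar> powr (p - 1) * sgn 0) / (t - 0)" if "t \<noteq> 0" for t :: real
      proof -
        have "\<bar>t\<bar> powr (p - 1) = \<bar>t\<bar> powr (p - 2) * \<bar>t\<bar>" using that powr_add[of "\<bar>t\<bar>" "p - 2" 1] by simp
        thus ?thesis using that by (auto simp: sgn_if abs_if)
      qed
      hence "\<forall>\<^sub>F t in at 0. \<bar>t\<bar> powr (p - 2) = (\<bar>t\<bar> powr (p - 1) * sgn t - \<bar>0\<bar> powr (p - 1) * sgn 0) / (t - 0)"
        unfolding eventually_at_filter by (intro always_eventually allI impI)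
      ultimately have "((\<lambda>t. (\<bar>t\<bar> powr (p - 1) * sgn t - \<bar>0\<bar> powr (p - 1) * sgn 0) / (t - 0)) \<longlongrightarrow> 0) (at (0::real))"
        by (rule Lim_transform_eventually)
      thus ?thesis by (simp add: has_field_derivative_iff)
    qed
    from DERIV_add[OF 1 DERIV_cmult_right[OF DERIV_cmult[OF this, of p], of ?K]]
    show "((\<lambda>t. p * a * (1 + t * a) powr (p - 1) * h s + (p * \<bar>t\<bar> powr (p - 1) * sgn t) * ?K)
       has_real_derivative p * (p - 1) * a\<^sup>2 * h s) (at 0)"
      by (simp add: mult.assoc)
  qed
  thus ?thesis .
qed

text \<open>In the coordinates \<open>s = e + f\<close>, \<open>d = e - f\<close> the Hessians at
  \<open>s\<close> and at \<open>d\<close> see one coordinate each. They give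
  \<open>(A + B)^2 = 1 = (A - B)^2\<close>, hence \<open>A * B = 0\<close>.\<close>

lemma no_third_direction:
  assumes p: "p \<noteq> 2" and e: "e \<noteq> 0" and np: "\<And>c. f \<noteq> c *\<^sub>R e"
    and q1: "\<And>x. x \<noteq> 0 \<Longrightarrow> q x e = q x f" and q2: "\<And>x. x \<noteq> 0 \<Longrightarrow> q x e = q x (A *\<^sub>R e + B *\<^sub>R f)"
  shows "A = 0 \<or> B = 0"
proof -
  define s where "s = e + f"
  define d where "d = e - f"
  have nz: "s \<noteq> 0" "d \<noteq> 0" using np[of "-1"] np[of 1] by (auto simp: s_def d_def add_eq_0_iff)
  have sep: "h (x *\<^sub>R s + y *\<^sub>R d) = \<bar>x\<bar> powr p * h s + \<bar>y\<bar> powr p * h d" for x y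
    unfolding s_def d_def by (rule separable[OF q1 e np])
  have sep': "h (x *\<^sub>R d + y *\<^sub>R s) = \<bar>x\<bar> powr p * h d + \<bar>y\<bar> powr p * h s" for x y
    using sep[of y x] by (simp add: add.commute)
  have p2: "2 < p" by (rule separable_imp_p_gt_2[OF sep nz p])
  have ee: "e = (1/2) *\<^sub>R s + (1/2) *\<^sub>R d" "e = (1/2) *\<^sub>R d + (1/2) *\<^sub>R s"
    by (simp_all add: s_def d_def algebra_simps flip: scaleR_add_left)
  have ff: "A *\<^sub>R e + B *\<^sub>R f = ((A + B) / 2) *\<^sub>R s + ((A - B) / 2) *\<^sub>R d"
    by (simp add: s_def d_def algebra_simps add_divide_distrib diff_divide_distrib) (simp flip: scaleR_add_left)
  have ff': "A *\<^sub>R e + B *\<^sub>R f = ((A - B) / 2) *\<^sub>R d + ((A + B) / 2) *\<^sub>R s" using ff by (simp add: add.commute)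
  have "p * (p - 1) * (1/2)\<^sup>2 * h s = p * (p - 1) * ((A + B) / 2)\<^sup>2 * h s"
    using q2[OF nz(1)] unfolding ff by (subst (asm) ee(1)) (simp only: q_separable[OF sep nz(1) p2])
  moreover have "p * (p - 1) * (1/2)\<^sup>2 * h d = p * (p - 1) * ((A - B) / 2)\<^sup>2 * h d"
    using q2[OF nz(2)] unfolding ff' by (subst (asm) ee(2)) (simp only: q_separable[OF sep' nz(2) p2])
  ultimately have "(A + B)\<^sup>2 = 1" "(A - B)\<^sup>2 = 1" using nz p2 by (auto simp: power_divide)
  moreover have "(A + B)\<^sup>2 - (A - B)\<^sup>2 = 4 * (A * B)" by (simp add: power2_eq_square algebra_simps)
  ultimately have "4 * (A * B) = 0" by simp
  thus ?thesis by simp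
qed

subsection \<open>Second moments from expansions at infinity\<close>

text \<open>Second-order Taylor remainder at \<open>v\<close> for the step \<open>- z / R\<close>,
  multiplied by \<open>R^2\<close>, where \<open>R = Suc n\<close>. By homogeneity and up to a power
  of \<open>R\<close>, it is the cost from \<open>z\<close> to the distant point \<open>R v\<close>
  with its affine part in \<open>z\<close> removed.\<close>

definition E :: "nat \<Rightarrow> 'a \<Rightarrow> 'a \<Rightarrow> real" where
  "E n v z = (real (Suc n))\<^sup>2 * (h (v - (1 / real (Suc n)) *\<^sub>R z) - h v + g v \<bullet> ((1 / real (Suc n)) *\<^sub>R z))"

lemma E_nonneg: "0 \<le> E n v z"
  using h_tangent[of v "v - (1 / real (Suc n)) *\<^sub>R z"] by (simp add: E_def)

lemma E_lim: assumes v: "v \<noteq> 0" shows "(\<lambda>n. E n v z) \<longlonglongrightarrow> q v z / 2"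
proof (rule LIMSEQ_I)
  fix r :: real assume r: "0 < r"
  define e where "e = r / (2 * ((norm z)\<^sup>2 + 1))"
  have z1: "0 < (norm z)\<^sup>2 + 1" by (simp add: add_nonneg_pos)
  have e: "0 < e" using r z1 by (simp add: e_def)
  obtain d where d: "0 < d" "\<And>w. norm w < d \<Longrightarrow> \<bar>h (v + w) - h v - g v \<bullet> w - q v w / 2\<bar> \<le> e * (norm w)\<^sup>2"
    using h_expansion[OF v e] by blast
  obtain n0 :: nat where n0: "norm z / d < real n0" using reals_Archimedean2 by blast
  show "\<exists>no. \<forall>n\<ge>no. norm (E n v z - q v z / 2) < r"
  proof (intro exI allI impI)
    fix n assume n: "n0 \<le> n"
    define R where "R = real (Suc n)"
    have R: "0 < R" by (simp add: R_def)
    define w where "w = - ((1 / R) *\<^sub>R z)"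
    have "norm z / d < R" using n0 n by (simp add: R_def)
    hence "norm w < d" using R d(1) by (simp add: w_def field_simps)
    from d(2)[OF this] have b: "\<bar>h (v + w) - h v - g v \<bullet> w - q v w / 2\<bar> \<le> e * (norm w)\<^sup>2" .
    have qw: "q v w = q v z / R\<^sup>2" using q_scale[OF v, of "- 1 / R" z] by (simp add: w_def power_divide)
    have E1: "E n v z = R\<^sup>2 * (h (v + w) - h v - g v \<bullet> w)"
      by (simp add: E_def R_def w_def del: of_nat_Suc)
    have "E n v z - q v z / 2 = R\<^sup>2 * (h (v + w) - h v - g v \<bullet> w - q v w / 2)"
      unfolding E1 qw using R by (simp add: field_simps)
    hence "\<bar>E n v z - q v z / 2\<bar> = R\<^sup>2 * \<bar>h (v + w) - h v - g v \<bullet> w - q v w / 2\<bar>" by (simp add: abs_mult)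
    also have "\<dots> \<le> R\<^sup>2 * (e * (norm w)\<^sup>2)" using b by (intro mult_left_mono) auto
    also have "\<dots> = e * (norm z)\<^sup>2" using R by (simp add: w_def power_divide)
    also have "\<dots> < r"
    proof -
      have "e * (norm z)\<^sup>2 \<le> e * ((norm z)\<^sup>2 + 1)" using e by (intro mult_left_mono) auto
      also have "\<dots> = r / 2"
      proof -
        have "r / (2 * X) * X = r / 2" if "X \<noteq> 0" for X using that by simp
        from this[of "(norm z)\<^sup>2 + 1"] z1 show ?thesis by (simp only: e_def)
      qed
      finally show ?thesis using r by simp
    qed
    finally show "norm (E n v z - q v z / 2) < r" by simp
  qed
qed

lemma q_nonneg: "v \<noteq> 0 \<Longrightarrow> 0 \<le> q v z"
  using LIMSEQ_le_const[OF E_lim, of v 0 z] E_nonneg by fastforce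

text \<open>Near 0 the Taylor formula applies, elsewhere the growth of \<open>h\<close>. The p-th
  power is tolerated only for \<open>2 <= p\<close>, since only then does it absorb the factor
  \<open>R^2\<close> in \<open>E_bound\<close>; for \<open>p < 2\<close> it is dominated by the
  square.\<close>

lemma remainder_bound:
  assumes v: "v \<noteq> 0"
  shows "\<exists>B\<ge>0. \<forall>w. h (v + w) - h v - g v \<bullet> w \<le> B * (norm w)\<^sup>2 \<or> (h (v + w) - h v - g v \<bullet> w \<le> B * norm w powr p \<and> 2 \<le> p)"
proof -
  obtain d where d: "0 < d" "\<And>w. norm w < d \<Longrightarrow> \<bar>h (v + w) - h v - g v \<bullet> w - q v w / 2\<bar> \<le> 1 * (norm w)\<^sup>2"
    using h_expansion[OF v, of 1] by auto
  obtain K0 where K0: "\<And>w. norm (G v w) \<le> norm w * K0"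
    using bounded_linear.bounded[OF G_linear(4)[OF v]] by blast
  obtain K where K: "K > 0" "\<And>x. h x \<le> K * norm x powr p" using h_upper by blast
  define c where "c = norm v / d + 1"
  have c: "0 < c" "0 \<le> c" using d by (auto simp: c_def add_nonneg_pos)
  define B1 where "B1 = 1 + \<bar>K0\<bar>"
  define B2 where "B2 = K * c powr p + norm (g v) * d powr (1 - p)"
  define B3 where "B3 = B2 * d powr (p - 2)"
  define B where "B = B1 + B2 + B3"
  have Bs: "0 \<le> B1" "0 \<le> B2" "0 \<le> B3" using K by (auto simp: B1_def B2_def B3_def)
  have "h (v + w) - h v - g v \<bullet> w \<le> B * (norm w)\<^sup>2 \<or> (h (v + w) - h v - g v \<bullet> w \<le> B * norm w powr p \<and> 2 \<le> p)" for w
  proof (cases "norm w < d")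
    case True
    have "q v w \<le> norm (G v w) * norm w" unfolding q_def by (rule norm_cauchy_schwarz)
    also have "\<dots> \<le> (norm w * K0) * norm w" by (intro mult_right_mono K0) auto
    also have "\<dots> \<le> (norm w * \<bar>K0\<bar>) * norm w" by (intro mult_right_mono mult_left_mono) auto
    finally have qle: "q v w \<le> \<bar>K0\<bar> * (norm w)\<^sup>2" by (simp add: power2_eq_square mult_ac)
    have "h (v + w) - h v - g v \<bullet> w \<le> (norm w)\<^sup>2 + q v w / 2" using d(2)[OF True] by linarith
    also have "\<dots> \<le> (norm w)\<^sup>2 + \<bar>K0\<bar> * (norm w)\<^sup>2"
    proof -
      have "0 \<le> \<bar>K0\<bar> * (norm w)\<^sup>2" by simp
      thus ?thesis using qle by linarith
    qed
    also have "\<dots> = B1 * (norm w)\<^sup>2" by (simp add: B1_def algebra_simps)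
    also have "\<dots> \<le> B * (norm w)\<^sup>2" using Bs by (intro mult_right_mono) (auto simp: B_def)
    finally show ?thesis by blast
  next
    case False
    hence wd: "d \<le> norm w" "0 < norm w" using d(1) by auto
    have "norm v / d * d \<le> norm v / d * norm w" using wd d by (intro mult_left_mono) auto
    hence "norm (v + w) \<le> c * norm w" using norm_triangle_ineq[of v w] d by (simp add: c_def algebra_simps)
    hence "norm (v + w) powr p \<le> (c * norm w) powr p" using p_gt_1 by (intro powr_mono2) auto
    hence "h (v + w) \<le> K * (c powr p * norm w powr p)"
      using K(1) c by (intro order_trans[OF K(2) mult_left_mono]) (auto simp: powr_mult)
    moreover have "- (g v \<bullet> w) \<le> norm (g v) * d powr (1 - p) * norm w powr p"
    proof -
      have "- (g v \<bullet> w) \<le> norm (g v) * norm w" using Cauchy_Schwarz_ineq2[of "g v" w] by simp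
      also have "norm w = norm w powr (1 - p) * norm w powr p" using wd by (simp flip: powr_add)
      also have "norm (g v) * (norm w powr (1 - p) * norm w powr p) \<le> norm (g v) * (d powr (1 - p) * norm w powr p)"
        using wd d p_gt_1 by (intro mult_left_mono mult_right_mono powr_mono2') auto
      finally show ?thesis by (simp add: mult_ac)
    qed
    moreover have "0 \<le> h v" by simp
    moreover have "B2 * norm w powr p = K * (c powr p * norm w powr p) + norm (g v) * d powr (1 - p) * norm w powr p"
      by (simp add: B2_def algebra_simps)
    ultimately have le: "h (v + w) - h v - g v \<bullet> w \<le> B2 * norm w powr p" by linarith
    show ?thesis
    proof (cases "2 \<le> p")
      case True
      have "B2 * norm w powr p \<le> B * norm w powr p" using Bs by (intro mult_right_mono) (auto simp: B_def)
      thus ?thesis using le True by linarith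
    next
      case False
      have "norm w powr p = norm w powr (p - 2) * (norm w)\<^sup>2" using wd by (simp add: powr_diff flip: powr_numeral)
      also have "\<dots> \<le> d powr (p - 2) * (norm w)\<^sup>2" using wd d False by (intro mult_right_mono powr_mono2') auto
      finally have "B2 * norm w powr p \<le> B2 * (d powr (p - 2) * (norm w)\<^sup>2)" using Bs by (intro mult_left_mono) auto
      also have "\<dots> = B3 * (norm w)\<^sup>2" by (simp add: B3_def)
      also have "\<dots> \<le> B * (norm w)\<^sup>2" using Bs by (intro mult_right_mono) (auto simp: B_def)
      finally show ?thesis using le by linarith
    qed
  qed
  thus ?thesis using Bs by (intro exI[of _ B]) (auto simp: B_def)
qed

text \<open>Majorant uniform in \<open>n\<close> for the dominated convergence in
  \<open>integral_E_lim\<close>.\<close>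

lemma E_bound:
  assumes v: "v \<noteq> 0" shows "\<exists>B\<ge>0. \<forall>n z. E n v z \<le> B * ((norm z)\<^sup>2 + norm z powr p)"
proof -
  obtain B where B: "B \<ge> 0" "\<And>w. h (v + w) - h v - g v \<bullet> w \<le> B * (norm w)\<^sup>2 \<or>
      (h (v + w) - h v - g v \<bullet> w \<le> B * norm w powr p \<and> 2 \<le> p)"
    using remainder_bound[OF v] by blast
  have "E n v z \<le> B * ((norm z)\<^sup>2 + norm z powr p)" for n z
  proof -
    define R where "R = real (Suc n)"
    have R: "1 \<le> R" by (simp add: R_def)
    define w where "w = - ((1 / R) *\<^sub>R z)"
    have nw: "norm w = norm z / R" using R by (simp add: w_def)
    have E: "E n v z = R\<^sup>2 * (h (v + w) - h v - g v \<bullet> w)"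
      by (simp add: E_def R_def w_def del: of_nat_Suc)
    from B(2)[of w] show ?thesis
    proof
      assume "h (v + w) - h v - g v \<bullet> w \<le> B * (norm w)\<^sup>2"
      hence "E n v z \<le> R\<^sup>2 * (B * (norm w)\<^sup>2)" unfolding E by (intro mult_left_mono) auto
      also have "\<dots> = B * (norm z)\<^sup>2" using R by (simp add: nw power_divide)
      also have "\<dots> \<le> B * ((norm z)\<^sup>2 + norm z powr p)" using B(1) by (intro mult_left_mono) auto
      finally show ?thesis .
    next
      assume *: "h (v + w) - h v - g v \<bullet> w \<le> B * norm w powr p \<and> 2 \<le> p"
      hence "E n v z \<le> R\<^sup>2 * (B * norm w powr p)" unfolding E by (intro mult_left_mono) auto
      also have "\<dots> = B * norm z powr p * (R powr 2 / R powr p)" using R by (simp add: nw powr_divide)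
      also have "\<dots> \<le> B * norm z powr p * 1"
      proof (intro mult_left_mono)
        have "R powr 2 \<le> R powr p" using R * by (intro powr_mono) auto
        thus "R powr 2 / R powr p \<le> 1" using R by (intro divide_le_eq_1_pos[THEN iffD2]) auto
      qed (use B(1) in auto)
      also have "\<dots> \<le> B * ((norm z)\<^sup>2 + norm z powr p)" using B(1) by (simp add: distrib_left)
      finally show ?thesis .
    qed
  qed
  thus ?thesis using B(1) by blast
qed

section \<open>Moments recovered from the potential\<close>

lemma P_norm_powr_integrable: assumes "\<mu> \<in> P" shows "integrable \<mu> (\<lambda>z. norm (z - m) powr p)"
proof -
  obtain k where k: "k > 0" "\<And>x. k * norm x powr p \<le> h x" using h_lower by blast
  show ?thesis
  proof (rule Bochner_Integration.integrable_bound)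
    show "integrable \<mu> (\<lambda>z. h (z - m) / k)" using P_integrable_shift[OF assms, of m] by simp
    show "(\<lambda>z. norm (z - m) powr p) \<in> borel_measurable \<mu>" by (rule P_measurable[OF assms]) measurable
    show "AE z in \<mu>. norm (norm (z - m) powr p) \<le> norm (h (z - m) / k)"
    proof (rule AE_I2)
      fix z show "norm (norm (z - m) powr p) \<le> norm (h (z - m) / k)"
        using k(1) k(2)[of "z - m"] by (simp add: field_simps)
    qed
  qed
qed

lemma P_norm_integrable: assumes "\<mu> \<in> P" shows "integrable \<mu> (\<lambda>z. norm (z - m))"
proof (rule Bochner_Integration.integrable_bound)
  interpret prob_space \<mu> using PD[OF assms] by simp
  show "integrable \<mu> (\<lambda>z. 1 + norm (z - m) powr p)" using P_norm_powr_integrable[OF assms] by auto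
  show "(\<lambda>z. norm (z - m)) \<in> borel_measurable \<mu>" by (rule P_measurable[OF assms]) measurable
  have "x \<le> 1 + x powr p" if "0 \<le> x" for x :: real
  proof (cases "x \<le> 1")
    case False
    hence "x powr 1 \<le> x powr p" using p_gt_1 by (intro powr_mono) auto
    thus ?thesis using False by simp
  qed (simp add: add_increasing2)
  thus "AE z in \<mu>. norm (norm (z - m)) \<le> norm (1 + norm (z - m) powr p)" by auto
qed

lemma P_inner_integrable: assumes "\<mu> \<in> P" shows "integrable \<mu> (\<lambda>z. \<xi> \<bullet> (z - m))"
proof (rule Bochner_Integration.integrable_bound)
  show "integrable \<mu> (\<lambda>z. norm \<xi> * norm (z - m))" using P_norm_integrable[OF assms] by auto
  show "(\<lambda>z. \<xi> \<bullet> (z - m)) \<in> borel_measurable \<mu>" by (rule P_measurable[OF assms]) measurable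
qed (auto intro!: AE_I2 Cauchy_Schwarz_ineq2)

text \<open>Homogeneity turns the integral of the rescaled cost into a value of the potential far
  away; this links the expansions to an invariant of the isometry.\<close>

lemma scaled_T:
  assumes "\<mu> \<in> P" "0 < R"
  shows "integrable \<mu> (\<lambda>z. h (v - (1 / R) *\<^sub>R (z - m)))"
    and "(\<integral>z. h (v - (1 / R) *\<^sub>R (z - m)) \<partial>\<mu>) = R powr (- p) * T \<mu> (m + R *\<^sub>R v)"
proof -
  have e: "h (v - (1 / R) *\<^sub>R (z - m)) = R powr (- p) * h (z - (m + R *\<^sub>R v))" for z
  proof -
    have "v - (1 / R) *\<^sub>R (z - m) = (- 1 / R) *\<^sub>R (z - (m + R *\<^sub>R v))" using assms(2) by (simp add: algebra_simps)
    hence "h (v - (1 / R) *\<^sub>R (z - m)) = \<bar>- 1 / R\<bar> powr p * h (z - (m + R *\<^sub>R v))" by (simp only: h_scale)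
    also have "\<bar>- 1 / R\<bar> = R powr (- 1)" using assms(2) by (simp add: powr_minus_divide)
    finally show ?thesis by (simp only: powr_powr mult_minus_left mult_1_left)
  qed
  show "integrable \<mu> (\<lambda>z. h (v - (1 / R) *\<^sub>R (z - m)))" unfolding e
    using P_integrable_shift[OF assms(1), of "m + R *\<^sub>R v"] by auto
  show "(\<integral>z. h (v - (1 / R) *\<^sub>R (z - m)) \<partial>\<mu>) = R powr (- p) * T \<mu> (m + R *\<^sub>R v)"
    unfolding e T_def by simp
qed

text \<open>First-order term of the potential at infinity; since \<open>g\<close> is onto, every
  \<open>\<xi>\<close> occurs as a gradient there.\<close>

lemma mean_eq:
  assumes P: "\<mu> \<in> P" "\<nu> \<in> P" and T: "T \<mu> = T \<nu>"
  shows "(\<integral>z. \<xi> \<bullet> (z - m) \<partial>\<mu>) = (\<integral>z. \<xi> \<bullet> (z - m) \<partial>\<nu>)"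
proof -
  obtain v where v: "g v = \<xi>" using g_surj by blast
  define F where "F n z = real (Suc n) * (h (v - (1 / real (Suc n)) *\<^sub>R (z - m)) - h v)" for n z
  have lim: "(\<lambda>n. F n z) \<longlonglongrightarrow> - (\<xi> \<bullet> (z - m))" for z
    using line_quotient_seq[OF h_derivative, of v "- (z - m)"] unfolding F_def v inner_minus_right scaleR_minus_right add_uminus_conv_diff .
  \<comment> \<open>Below by the tangent, above by convexity, as the quotient of step 1 is the
    largest. The form \<open>1 / 1\<close> matches \<open>scaled_T\<close> with
    \<open>R = 1\<close>.\<close>
  have bd: "\<bar>F n z\<bar> \<le> norm \<xi> * norm (z - m) + h (v - (1 / 1) *\<^sub>R (z - m))" for n z
  proof -
    let ?t = "1 / real (Suc n)"
    have "- (?t * (\<xi> \<bullet> (z - m))) \<le> h (v - ?t *\<^sub>R (z - m)) - h v"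
      using h_tangent[of v "v - ?t *\<^sub>R (z - m)"] by (simp add: v del: of_nat_Suc)
    from mult_left_mono[OF this, of "real (Suc n)"] have "F n z \<ge> - (\<xi> \<bullet> (z - m))"
      by (simp add: F_def del: of_nat_Suc)
    hence lo: "- (norm \<xi> * norm (z - m)) \<le> F n z" using Cauchy_Schwarz_ineq2[of \<xi> "z - m"] by linarith
    have "v - ?t *\<^sub>R (z - m) = (1 - ?t) *\<^sub>R v + ?t *\<^sub>R (v - (z - m))" by (simp add: algebra_simps)
    hence "h (v - ?t *\<^sub>R (z - m)) - h v \<le> ?t * (h (v - (z - m)) - h v)"
      using h_convex[of ?t v "v - (z - m)"] by (simp add: algebra_simps)
    from mult_left_mono[OF this, of "real (Suc n)"] have "F n z \<le> h (v - (z - m)) - h v" by (simp add: F_def)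
    hence hi: "F n z \<le> h (v - (1 / 1) *\<^sub>R (z - m))" using h_nonneg[of v] by (simp only: div_by_1 scaleR_one)
    have "0 \<le> norm \<xi> * norm (z - m)" "0 \<le> h (v - (1 / 1) *\<^sub>R (z - m))" by auto
    thus ?thesis using lo hi by linarith
  qed
  have L: "(\<lambda>n. \<integral>z. F n z \<partial>m') \<longlonglongrightarrow> (\<integral>z. - (\<xi> \<bullet> (z - m)) \<partial>m')" if m': "m' \<in> P" for m'
  proof (rule integral_dominated_convergence[where w="\<lambda>z. norm \<xi> * norm (z - m) + h (v - (1 / 1) *\<^sub>R (z - m))"])
    show "integrable m' (\<lambda>z. norm \<xi> * norm (z - m) + h (v - (1 / 1) *\<^sub>R (z - m)))"
      by (intro Bochner_Integration.integrable_add integrable_mult_right P_norm_integrable[OF m'] scaled_T[OF m']) simp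
    show "(\<lambda>z. - (\<xi> \<bullet> (z - m))) \<in> borel_measurable m'" by (rule P_measurable[OF m']) measurable
    show "F n \<in> borel_measurable m'" for n by (rule P_measurable[OF m'], unfold F_def) measurable
  qed (use lim bd in auto)
  have "(\<integral>z. F n z \<partial>m') = real (Suc n) * (real (Suc n) powr (- p) * T m' (m + real (Suc n) *\<^sub>R v) - h v)" if m': "m' \<in> P" for m' n
  proof -
    interpret prob_space m' using PD[OF m'] by simp
    have R: "0 < real (Suc n)" by simp
    show ?thesis unfolding F_def using scaled_T[OF m' R, of v m] by (simp add: prob_space del: of_nat_Suc)
  qed
  from this[OF P(1)] this[OF P(2)] have e: "(\<integral>z. F n z \<partial>\<mu>) = (\<integral>z. F n z \<partial>\<nu>)" for n by (simp only: T)
  have "(\<integral>z. - (\<xi> \<bullet> (z - m)) \<partial>\<mu>) = (\<integral>z. - (\<xi> \<bullet> (z - m)) \<partial>\<nu>)"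
    by (rule LIMSEQ_unique[OF L[OF P(1), unfolded e] L[OF P(2)]])
  thus ?thesis by simp
qed

lemma E_measurable: "(\<lambda>z. E n v (z - m)) \<in> borel_measurable borel"
  unfolding E_def by measurable

lemma q_measurable: assumes "v \<noteq> 0" shows "(\<lambda>z. q v (z - m)) \<in> borel_measurable borel"
proof -
  have "continuous_on UNIV (G v)" by (rule linear_continuous_on[OF G_linear(4)[OF assms]])
  hence "continuous_on UNIV (\<lambda>z. G v (z - m))" by (rule continuous_on_compose2) (auto intro!: continuous_intros)
  thus ?thesis unfolding q_def by (intro borel_measurable_continuous_onI continuous_intros)
qed

lemma integral_E:
  assumes \<mu>: "\<mu> \<in> P"
  shows "integrable \<mu> (\<lambda>z. E n v (z - m))"
    and "(\<integral>z. E n v (z - m) \<partial>\<mu>) = (real (Suc n))\<^sup>2 * (real (Suc n) powr (- p) * T \<mu> (m + real (Suc n) *\<^sub>R v) - h v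
      + (1 / real (Suc n)) * (\<integral>z. g v \<bullet> (z - m) \<partial>\<mu>))"
proof -
  interpret prob_space \<mu> using PD[OF \<mu>] by simp
  have R: "0 < real (Suc n)" by simp
  have e: "E n v (z - m) = (real (Suc n))\<^sup>2 * (h (v - (1 / real (Suc n)) *\<^sub>R (z - m)) - h v + (1 / real (Suc n)) * (g v \<bullet> (z - m)))" for z
    unfolding E_def inner_scaleR_right ..
  note i = scaled_T[OF \<mu> R, of v m] P_inner_integrable[OF \<mu>, of "g v" m]
  show "integrable \<mu> (\<lambda>z. E n v (z - m))" unfolding e using i
    by (intro integrable_mult_right Bochner_Integration.integrable_add Bochner_Integration.integrable_diff) auto
  show "(\<integral>z. E n v (z - m) \<partial>\<mu>) = (real (Suc n))\<^sup>2 * (real (Suc n) powr (- p) * T \<mu> (m + real (Suc n) *\<^sub>R v) - h v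
      + (1 / real (Suc n)) * (\<integral>z. g v \<bullet> (z - m) \<partial>\<mu>))"
    unfolding e using i by (simp add: prob_space del: of_nat_Suc)
qed

lemma integral_E_lim:
  assumes \<mu>: "\<mu> \<in> P" and v: "v \<noteq> 0" and sq: "integrable \<mu> (\<lambda>z. (norm (z - m))\<^sup>2)"
  shows "integrable \<mu> (\<lambda>z. q v (z - m) / 2)"
    and "(\<lambda>n. \<integral>z. E n v (z - m) \<partial>\<mu>) \<longlonglongrightarrow> (\<integral>z. q v (z - m) / 2 \<partial>\<mu>)"
proof -
  obtain B where B: "B \<ge> 0" "\<And>n z. E n v z \<le> B * ((norm z)\<^sup>2 + norm z powr p)" using E_bound[OF v] by blast
  have w: "integrable \<mu> (\<lambda>z. B * ((norm (z - m))\<^sup>2 + norm (z - m) powr p))"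
    using sq P_norm_powr_integrable[OF \<mu>, of m] by auto
  have m1: "(\<lambda>z. q v (z - m) / 2) \<in> borel_measurable \<mu>" using P_measurable[OF \<mu> q_measurable[OF v]] by measurable
  have m2: "(\<lambda>z. E n v (z - m)) \<in> borel_measurable \<mu>" for n using P_measurable[OF \<mu> E_measurable] by measurable
  have a: "AE z in \<mu>. (\<lambda>n. E n v (z - m)) \<longlonglongrightarrow> q v (z - m) / 2" by (intro AE_I2 E_lim v)
  have b: "AE z in \<mu>. norm (E n v (z - m)) \<le> B * ((norm (z - m))\<^sup>2 + norm (z - m) powr p)" for n
    using B(2) E_nonneg by (intro AE_I2) simp
  show "integrable \<mu> (\<lambda>z. q v (z - m) / 2)" by (rule integrable_dominated_convergence[OF m1 m2 w a b])
  show "(\<lambda>n. \<integral>z. E n v (z - m) \<partial>\<mu>) \<longlonglongrightarrow> (\<integral>z. q v (z - m) / 2 \<partial>\<mu>)"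
    by (rule integral_dominated_convergence[OF m1 m2 w a b])
qed

text \<open>By \<open>integral_E\<close> the measure enters only through its potential and its
  mean.\<close>

lemma integral_E_eq:
  assumes P: "\<mu> \<in> P" "\<nu> \<in> P" and T: "T \<mu> = T \<nu>"
  shows "(\<integral>z. E n v (z - m) \<partial>\<mu>) = (\<integral>z. E n v (z - m) \<partial>\<nu>)"
  by (simp only: integral_E(2)[OF P(1)] integral_E(2)[OF P(2)] T mean_eq[OF P T])

lemma second_moment_eq:
  assumes P: "\<mu> \<in> P" "\<nu> \<in> P" and T: "T \<mu> = T \<nu>" and v: "v \<noteq> 0"
    and sq: "integrable \<mu> (\<lambda>z. (norm (z - m))\<^sup>2)" "integrable \<nu> (\<lambda>z. (norm (z - m))\<^sup>2)"
  shows "(\<integral>z. q v (z - m) \<partial>\<mu>) = (\<integral>z. q v (z - m) \<partial>\<nu>)"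
proof -
  have "(\<integral>z. q v (z - m) / 2 \<partial>\<mu>) = (\<integral>z. q v (z - m) / 2 \<partial>\<nu>)"
    by (rule LIMSEQ_unique[OF integral_E_lim(2)[OF P(1) v sq(1), unfolded integral_E_eq[OF P T]] integral_E_lim(2)[OF P(2) v sq(2)]])
  thus ?thesis by simp
qed

text \<open>For \<open>p < 2\<close> finiteness of the second moment is not part of the membership in \<open>P\<close>; it is
  inherited by Fatou's lemma.\<close>

lemma second_moment_le:
  assumes P: "\<mu> \<in> P" "\<nu> \<in> P" and T: "T \<mu> = T \<nu>" and v: "v \<noteq> 0"
    and sq: "integrable \<mu> (\<lambda>z. (norm (z - m))\<^sup>2)"
  shows "integrable \<nu> (\<lambda>z. q v (z - m))"
proof -
  have "(\<integral>\<^sup>+z. ennreal (q v (z - m) / 2) \<partial>\<nu>) = (\<integral>\<^sup>+z. liminf (\<lambda>n. ennreal (E n v (z - m))) \<partial>\<nu>)"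
  proof (intro nn_integral_cong)
    fix z
    have "(\<lambda>n. ennreal (E n v (z - m))) \<longlonglongrightarrow> ennreal (q v (z - m) / 2)" by (intro tendsto_ennrealI E_lim v)
    thus "ennreal (q v (z - m) / 2) = liminf (\<lambda>n. ennreal (E n v (z - m)))"
      using lim_imp_Liminf[OF sequentially_bot] by metis
  qed
  also have "\<dots> \<le> liminf (\<lambda>n. \<integral>\<^sup>+z. ennreal (E n v (z - m)) \<partial>\<nu>)"
    using P_measurable[OF P(2) E_measurable] by (intro nn_integral_liminf) measurable
  also have "(\<lambda>n. \<integral>\<^sup>+z. ennreal (E n v (z - m)) \<partial>\<nu>) = (\<lambda>n. ennreal (\<integral>z. E n v (z - m) \<partial>\<mu>))"
    unfolding integral_E_eq[OF P T]
    by (intro ext nn_integral_eq_integral integral_E(1)[OF P(2)] AE_I2 E_nonneg)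
  also have "liminf \<dots> = ennreal (\<integral>z. q v (z - m) / 2 \<partial>\<mu>)"
    by (intro lim_imp_Liminf[OF sequentially_bot] tendsto_ennrealI integral_E_lim P v sq)
  finally have "(\<integral>\<^sup>+z. ennreal (q v (z - m) / 2) \<partial>\<nu>) < \<infinity>" by (auto simp: less_top intro: le_less_trans)
  hence "integrable \<nu> (\<lambda>z. q v (z - m) / 2)"
    using P_measurable[OF P(2) q_measurable[OF v]] q_nonneg[OF v] by (intro integrableI_nonneg) auto
  from integrable_mult_right[OF this, of 2] show ?thesis by simp
qed

section \<open>Measures concentrated on a line\<close>

lemma two_sq_integrable: "integrable (two \<alpha> a b) (\<lambda>z. (norm (z - m))\<^sup>2)"
  by (rule integrable_two) measurable

text \<open>On a line \<open>q v (z - m)\<close> is the square of \<open>t z\<close> times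
  \<open>q v e\<close>, so equality of second moments makes \<open>q v (b - a)\<close> and
  \<open>q v e\<close> proportional with a factor independent of \<open>v\<close>.\<close>

lemma collinear_second_moment:
  assumes \<nu>: "\<nu> \<in> P" and T: "T \<nu> = T (two \<alpha> a b)" and \<alpha>: "0 \<le> \<alpha>" "\<alpha> \<le> 1"
    and m: "m = a + \<alpha> *\<^sub>R (b - a)" and e: "e \<noteq> 0" and line: "AE z in \<nu>. \<exists>c. z - m = c *\<^sub>R e"
  defines "t \<equiv> \<lambda>z. ((z - m) \<bullet> e) / (e \<bullet> e)"
  shows "integrable \<nu> (\<lambda>z. (t z)\<^sup>2)"
    and "\<And>v. v \<noteq> 0 \<Longrightarrow> \<alpha> * (1 - \<alpha>) * q v (b - a) = (\<integral>z. (t z)\<^sup>2 \<partial>\<nu>) * q v e"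
    and "AE z in \<nu>. z - m = t z *\<^sub>R e"
    and "(\<integral>z. t z \<partial>\<nu>) = 0"
proof -
  have ee: "e \<bullet> e \<noteq> 0" using e by simp
  show tl: "AE z in \<nu>. z - m = t z *\<^sub>R e" using line
  proof eventually_elim
    case (elim z)
    then obtain c where c: "z - m = c *\<^sub>R e" by blast
    thus ?case using ee by (simp add: t_def)
  qed
  note T' = T[symmetric]
  have tm: "(\<lambda>z. (t z)\<^sup>2) \<in> borel_measurable \<nu>" unfolding t_def by (rule P_measurable[OF \<nu>]) measurable
  have qt: "AE z in \<nu>. q v (z - m) = (t z)\<^sup>2 * q v e" if "v \<noteq> 0" for v
    using tl by eventually_elim (simp add: q_scale[OF that])
  have qe: "0 < q e e" by (rule q_self_pos[OF e])
  \<comment> \<open>At \<open>v = e\<close> itself the coefficient is positive by Euler's relation,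
    which gives square integrability of \<open>t\<close>.\<close>
  have "integrable \<nu> (\<lambda>z. q e (z - m) / q e e)"
    using second_moment_le[OF two_in_P \<nu> T' e two_sq_integrable, of m] by simp
  thus ti: "integrable \<nu> (\<lambda>z. (t z)\<^sup>2)"
    by (rule Bochner_Integration.integrable_cong_AE_imp[OF _ tm]) (use qt[OF e] qe in \<open>auto elim!: eventually_mono\<close>)
  have sq: "integrable \<nu> (\<lambda>z. (norm (z - m))\<^sup>2)"
  proof (rule Bochner_Integration.integrable_cong_AE_imp)
    show "integrable \<nu> (\<lambda>z. (t z)\<^sup>2 * (norm e)\<^sup>2)" using ti by auto
    show "(\<lambda>z. (norm (z - m))\<^sup>2) \<in> borel_measurable \<nu>" by (rule P_measurable[OF \<nu>]) measurable
    show "AE z in \<nu>. (t z)\<^sup>2 * (norm e)\<^sup>2 = (norm (z - m))\<^sup>2"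
      using tl by eventually_elim (metis norm_scaleR power2_abs power_mult_distrib)
  qed
  show "\<alpha> * (1 - \<alpha>) * q v (b - a) = (\<integral>z. (t z)\<^sup>2 \<partial>\<nu>) * q v e" if v: "v \<noteq> 0" for v
  proof -
    have bm: "b - m = (1 - \<alpha>) *\<^sub>R (b - a)" and am: "a - m = (- \<alpha>) *\<^sub>R (b - a)" by (auto simp: m algebra_simps)
    have "(\<integral>z. q v (z - m) \<partial>two \<alpha> a b) = \<alpha> * q v (b - m) + (1 - \<alpha>) * q v (a - m)"
      by (rule integral_two[OF \<alpha> q_measurable[OF v]])
    also have "\<dots> = \<alpha> * (1 - \<alpha>) * q v (b - a)"
      unfolding bm am q_scale[OF v] by (simp add: power2_eq_square algebra_simps)
    finally have 1: "\<alpha> * (1 - \<alpha>) * q v (b - a) = (\<integral>z. q v (z - m) \<partial>two \<alpha> a b)" by simp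
    also have "\<dots> = (\<integral>z. q v (z - m) \<partial>\<nu>)"
      by (rule second_moment_eq[OF two_in_P \<nu> T' v two_sq_integrable sq])
    also have "\<dots> = (\<integral>z. (t z)\<^sup>2 * q v e \<partial>\<nu>)"
      by (rule integral_cong_AE) (use P_measurable[OF \<nu> q_measurable[OF v]] tm qt[OF v] in auto)
    also have "\<dots> = (\<integral>z. (t z)\<^sup>2 \<partial>\<nu>) * q v e" by simp
    finally show ?thesis .
  qed
  have "(\<integral>z. e \<bullet> (z - m) \<partial>\<nu>) = (\<integral>z. e \<bullet> (z - m) \<partial>two \<alpha> a b)" by (rule mean_eq[OF \<nu> two_in_P T])
  also have "\<dots> = \<alpha> * (e \<bullet> (b - m)) + (1 - \<alpha>) * (e \<bullet> (a - m))" by (rule integral_two[OF \<alpha>]) measurable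
  also have "\<dots> = 0" by (simp add: m algebra_simps inner_diff_right inner_add_right)
  finally show "(\<integral>z. t z \<partial>\<nu>) = 0" by (simp add: t_def inner_commute)
qed

text \<open>The part of \<open>x0 - m\<close> orthogonal to \<open>e\<close> has a constant pairing
  with \<open>z - m\<close> along the line, and that pairing has mean 0 by \<open>mean_eq\<close>;
  hence this part vanishes.\<close>

lemma mean_on_line:
  assumes \<nu>: "\<nu> \<in> P" and T: "T \<nu> = T (two \<alpha> a b)" and \<alpha>: "0 \<le> \<alpha>" "\<alpha> \<le> 1"
    and m: "m = a + \<alpha> *\<^sub>R (b - a)" and e: "e \<noteq> 0" and line: "AE z in \<nu>. \<exists>c. z - x0 = c *\<^sub>R e"
  shows "AE z in \<nu>. \<exists>c. z - m = c *\<^sub>R e"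
proof -
  interpret prob_space \<nu> using PD[OF \<nu>] by simp
  define c0 where "c0 = ((x0 - m) \<bullet> e) / (e \<bullet> e)"
  define \<xi> where "\<xi> = (x0 - m) - c0 *\<^sub>R e"
  have \<xi>e: "\<xi> \<bullet> e = 0" using e by (simp add: \<xi>_def c0_def inner_diff_left)
  have "(\<integral>z. \<xi> \<bullet> (z - m) \<partial>\<nu>) = (\<integral>z. \<xi> \<bullet> (z - m) \<partial>two \<alpha> a b)" by (rule mean_eq[OF \<nu> two_in_P T])
  also have "\<dots> = \<alpha> * (\<xi> \<bullet> (b - m)) + (1 - \<alpha>) * (\<xi> \<bullet> (a - m))" by (rule integral_two[OF \<alpha>]) measurable
  also have "\<dots> = 0" by (simp add: m algebra_simps inner_diff_right inner_add_right)
  finally have 0: "(\<integral>z. \<xi> \<bullet> (z - m) \<partial>\<nu>) = 0" .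
  have "AE z in \<nu>. \<xi> \<bullet> (z - m) = \<xi> \<bullet> \<xi>" using line
  proof eventually_elim
    case (elim z)
    then obtain c where "z - x0 = c *\<^sub>R e" by blast
    hence "z - m = \<xi> + (c + c0) *\<^sub>R e" by (simp add: \<xi>_def algebra_simps)
    thus ?case by (simp add: inner_add_right \<xi>e)
  qed
  hence "(\<integral>z. \<xi> \<bullet> (z - m) \<partial>\<nu>) = (\<integral>z. \<xi> \<bullet> \<xi> \<partial>\<nu>)"
    by (intro integral_cong_AE) (auto intro!: P_measurable[OF \<nu>])
  hence "\<xi> \<bullet> \<xi> = 0" using 0 by (simp add: prob_space)
  hence x0: "x0 - m = c0 *\<^sub>R e" by (simp add: \<xi>_def)
  show ?thesis using line
  proof eventually_elim
    case (elim z)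
    then obtain c where "z - x0 = c *\<^sub>R e" by blast
    hence "z - m = (c + c0) *\<^sub>R e" using x0 by (simp add: algebra_simps)
    thus ?case by blast
  qed
qed

end

subsection \<open>Two-point measures are fixed\<close>

text \<open>This is where \<open>p \<noteq> 2\<close> matters: up to sign, \<open>x powr p - (p / 2) * (1/2) powr (p - 2) * x\<^sup>2\<close> has its strict
  minimum over \<open>x \<ge> 0\<close> at \<open>1/2\<close>.\<close>

lemma (in prob_space) double_well:
  fixes t :: "'a \<Rightarrow> real" and p :: real
  assumes p: "1 < p" "p \<noteq> 2"
    and i: "integrable M (\<lambda>z. \<bar>t z - c\<bar> powr p)" "integrable M (\<lambda>z. (t z - c)\<^sup>2)"
    and e: "(\<integral>z. \<bar>t z - c\<bar> powr p \<partial>M) = (1/2) powr p" "(\<integral>z. (t z - c)\<^sup>2 \<partial>M) = 1/4"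
  shows "AE z in M. \<bar>t z - c\<bar> = 1/2"
proof -
  \<comment> \<open>Normalised so that the wells \<open>|t z - c| = 1/2\<close> become
    \<open>u z = 1\<close>.\<close>
  define u where "u z = 4 * (t z - c)\<^sup>2" for z
  have u0: "0 \<le> u z" for z by (simp add: u_def)
  have up: "u z powr (p / 2) = 2 powr p * \<bar>t z - c\<bar> powr p" for z
  proof -
    have "u z = (2 * \<bar>t z - c\<bar>) powr 2" by (simp add: u_def power_mult_distrib)
    hence "u z powr (p / 2) = (2 * \<bar>t z - c\<bar>) powr (2 * (p / 2))" by (simp only: powr_powr)
    thus ?thesis by (simp add: powr_mult)
  qed
  \<comment> \<open>Bernoulli deficit for the exponent \<open>p / 2\<close>: its sign is constant,
    decided by whether \<open>p\<close> exceeds 2, and the two moments make its mean 0.\<close>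
  define D where "D z = u z powr (p / 2) - (1 + (p / 2) * (u z - 1))" for z
  have ui: "integrable M u" using i(2) by (simp add: u_def[abs_def])
  have upi: "integrable M (\<lambda>z. u z powr (p / 2))" unfolding up using i(1) by simp
  have Di: "integrable M D" unfolding D_def[abs_def] using ui upi by auto
  have "(\<integral>z. u z \<partial>M) = 1" using e(2) by (simp add: u_def)
  moreover have "(\<integral>z. u z powr (p / 2) \<partial>M) = 1"
    unfolding up using e(1) by (simp add: powr_divide)
  ultimately have D0: "(\<integral>z. D z \<partial>M) = 0" unfolding D_def using ui upi by (simp add: prob_space)
  have "AE z in M. D z = 0"
  proof (cases "2 < p")
    case True
    have "0 \<le> D z" for z using Bernoulli_powr_le[of "p / 2" "u z"] True u0 by (simp add: D_def)
    thus ?thesis using integral_nonneg_eq_0_iff_AE[OF Di] D0 by auto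
  next
    case False
    have "0 \<le> - D z" for z
      using Bernoulli_powr_greater[of "p / 2" "u z"] p False u0[of z] by (cases "u z = 1") (auto simp: D_def)
    hence "AE z in M. - D z = 0" using integral_nonneg_eq_0_iff_AE[of M "\<lambda>z. - D z"] Di D0 by auto
    thus ?thesis by simp
  qed
  thus ?thesis
  proof eventually_elim
    case (elim z)
    have "u z = 1"
    proof (rule ccontr)
      assume "u z \<noteq> 1"
      thus False using elim Bernoulli_powr_less[of "p / 2" "u z"] Bernoulli_powr_greater[of "p / 2" "u z"] p u0[of z]
        by (cases "2 < p") (auto simp: D_def)
    qed
    hence "\<bar>t z - c\<bar>\<^sup>2 = (1/2)\<^sup>2" by (simp add: u_def power_divide)
    thus ?case using power2_eq_iff_nonneg[of "\<bar>t z - c\<bar>" "1/2"] by simp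
  qed
qed

context smooth_power_cost begin

text \<open>\<open>perp_transfer\<close> supplies exactly the inclusion of level sets that
  \<open>bisectors_parallel\<close> turns into collinearity.\<close>

lemma preimage_collinear:
  assumes \<Psi>: "Dirac_fixing \<Psi>" and ab: "a \<noteq> b" and \<alpha>: "0 \<le> \<alpha>" "\<alpha> \<le> 1"
    and y: "y \<in> supp (\<Psi> (two \<alpha> a b))" "y' \<in> supp (\<Psi> (two \<alpha> a b))"
  defines "\<tau> \<equiv> inv_into P \<Psi> (two (1/2) y y')"
  assumes x0: "x0 \<in> supp \<tau>"
  shows "AE x in \<tau>. \<exists>c. x - x0 = c *\<^sub>R (b - a)"
proof -
  have \<tau>: "\<tau> \<in> P" unfolding \<tau>_def by (intro Dirac_fixingD(1)[OF Dirac_fixing_inv(1)[OF \<Psi>]] two_in_P)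
  show ?thesis using P_AE_supp[OF \<tau>]
  proof eventually_elim
    case (elim x)
    show ?case
    proof (rule bisectors_parallel[OF ab])
      fix z z' assume z: "h (z - a) - h (z - b) = h (z' - a) - h (z' - b)"
      show "h (z - x0) - h (z - x) = h (z' - x0) - h (z' - x)"
        by (rule perp_transfer[OF \<Psi> refl \<alpha> y x0[unfolded \<tau>_def] elim[unfolded \<tau>_def] z])
    qed
  qed
qed

text \<open>The symmetric measure on \<open>y\<close>, \<open>y'\<close> and its preimage have equal
  potentials, and the preimage lies on a line of direction \<open>b - a\<close>; their second
  moments compare the Hessian forms in the two directions.\<close>

lemma pair_direction:
  assumes \<Psi>: "Dirac_fixing \<Psi>" and ab: "a \<noteq> b" and \<alpha>: "0 \<le> \<alpha>" "\<alpha> \<le> 1"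
    and y: "y \<in> supp (\<Psi> (two \<alpha> a b))" "y' \<in> supp (\<Psi> (two \<alpha> a b))" "y \<noteq> y'"
  shows "\<exists>\<kappa>>0. \<forall>v. v \<noteq> 0 \<longrightarrow> q v (y' - y) = \<kappa> * q v (b - a)"
proof -
  note J = Dirac_fixing_inv[OF \<Psi>]
  define \<tau> where "\<tau> = inv_into P \<Psi> (two (1/2) y y')"
  have \<tau>: "\<tau> \<in> P" unfolding \<tau>_def by (intro Dirac_fixingD(1)[OF J(1)] two_in_P)
  have T: "T \<tau> = T (two (1/2) y y')" unfolding \<tau>_def by (rule Dirac_fixing_T[OF J(1) two_in_P])
  obtain x0 where x0: "x0 \<in> supp \<tau>" using supp_nonempty[OF \<tau>] by auto
  have e: "b - a \<noteq> 0" using ab by simp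
  have half: "0 \<le> (1/2::real)" "(1/2::real) \<le> 1" by auto
  have "AE x in \<tau>. \<exists>c. x - x0 = c *\<^sub>R (b - a)"
    unfolding \<tau>_def by (rule preimage_collinear[OF \<Psi> ab \<alpha> y(1,2) x0[unfolded \<tau>_def]])
  from mean_on_line[OF \<tau> T half refl e this]
  have line: "AE z in \<tau>. \<exists>c. z - (y + (1/2) *\<^sub>R (y' - y)) = c *\<^sub>R (b - a)" .
  note S = collinear_second_moment[OF \<tau> T half refl e line]
  define B where "B = (\<integral>z. ((z - (y + (1/2) *\<^sub>R (y' - y))) \<bullet> (b - a) / ((b - a) \<bullet> (b - a)))\<^sup>2 \<partial>\<tau>)"
  \<comment> \<open>The factor 4 inverts the variance \<open>1/2 * (1 - 1/2)\<close> of the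
    symmetric pair.\<close>
  have eq: "q v (y' - y) = (4 * B) * q v (b - a)" if "v \<noteq> 0" for v
    using S(2)[OF that] by (simp add: B_def)
  have "B \<noteq> 0" using eq[of "y' - y"] q_self_pos[of "y' - y"] y(3) by auto
  moreover have "0 \<le> B" unfolding B_def by (intro Bochner_Integration.integral_nonneg) auto
  ultimately show ?thesis using eq by (intro exI[of _ "4 * B"]) auto
qed

text \<open>Three points off a line would give the directions \<open>e\<close>, \<open>f\<close> and
  \<open>f - e\<close>, all with Hessian form proportional to that of \<open>b - a\<close>; after
  normalisation this is what \<open>no_third_direction\<close> forbids.\<close>

lemma image_supp_collinear:
  assumes \<Psi>: "Dirac_fixing \<Psi>" and p: "p \<noteq> 2" and ab: "a \<noteq> b" and \<alpha>: "0 \<le> \<alpha>" "\<alpha> \<le> 1"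
    and y: "y1 \<in> supp (\<Psi> (two \<alpha> a b))" "y2 \<in> supp (\<Psi> (two \<alpha> a b))" "y1 \<noteq> y2" "y \<in> supp (\<Psi> (two \<alpha> a b))"
  shows "\<exists>c. y - y1 = c *\<^sub>R (y2 - y1)"
proof (rule ccontr)
  assume nc: "\<not> ?thesis"
  note pd = pair_direction[OF \<Psi> ab \<alpha>]
  define e where "e = y2 - y1"
  define f where "f = y - y1"
  have e0: "e \<noteq> 0" using y by (simp add: e_def)
  have nc': "f \<noteq> c *\<^sub>R e" for c using nc by (auto simp: e_def f_def)
  have "y \<noteq> y1" using nc'[of 0] by (auto simp: f_def)
  moreover have "y \<noteq> y2" using nc'[of 1] by (auto simp: e_def f_def)
  ultimately obtain k1 k2 k3 where k: "k1 > 0" "k2 > 0" "k3 > 0"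
    and q1: "\<And>v. v \<noteq> 0 \<Longrightarrow> q v e = k1 * q v (b - a)" and q2: "\<And>v. v \<noteq> 0 \<Longrightarrow> q v f = k2 * q v (b - a)"
    and q3: "\<And>v. v \<noteq> 0 \<Longrightarrow> q v (y - y2) = k3 * q v (b - a)"
    using pd[OF y(1,2,3)] pd[OF y(1,4)] pd[OF y(2,4)] unfolding e_def f_def by metis
  define E' where "E' = (1 / sqrt k1) *\<^sub>R e"
  define F' where "F' = (1 / sqrt k2) *\<^sub>R f"
  have qE: "q v E' = q v (b - a)" if "v \<noteq> 0" for v
    using k q_scale[OF that, of "1 / sqrt k1" e] q1[OF that] by (simp add: E'_def power_divide)
  have qF: "q v F' = q v (b - a)" if "v \<noteq> 0" for v
    using k q_scale[OF that, of "1 / sqrt k2" f] q2[OF that] by (simp add: F'_def power_divide)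
  have third: "(- sqrt k1 / sqrt k3) *\<^sub>R E' + (sqrt k2 / sqrt k3) *\<^sub>R F' = (1 / sqrt k3) *\<^sub>R (y - y2)"
  proof -
    have "(- sqrt k1 / sqrt k3) *\<^sub>R E' = - ((1 / sqrt k3) *\<^sub>R e)" "(sqrt k2 / sqrt k3) *\<^sub>R F' = (1 / sqrt k3) *\<^sub>R f"
      using k by (auto simp: E'_def F'_def)
    moreover have "y - y2 = f - e" by (simp add: e_def f_def)
    ultimately show ?thesis by (simp add: scaleR_diff_right)
  qed
  have "- sqrt k1 / sqrt k3 = 0 \<or> sqrt k2 / sqrt k3 = 0"
  proof (rule no_third_direction[OF p])
    show "E' \<noteq> 0" using e0 k by (simp add: E'_def)
    show "F' \<noteq> c *\<^sub>R E'" for c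
    proof
      assume "F' = c *\<^sub>R E'"
      hence "sqrt k2 *\<^sub>R F' = sqrt k2 *\<^sub>R c *\<^sub>R E'" by simp
      hence "f = (sqrt k2 * c / sqrt k1) *\<^sub>R e" using k by (simp add: F'_def E'_def)
      thus False using nc' by blast
    qed
    fix x :: 'a assume x: "x \<noteq> 0"
    show "q x E' = q x F'" by (simp add: qE[OF x] qF[OF x])
    show "q x E' = q x ((- sqrt k1 / sqrt k3) *\<^sub>R E' + (sqrt k2 / sqrt k3) *\<^sub>R F')"
      unfolding third q_scale[OF x] q3[OF x] qE[OF x] using k by (simp add: power_divide)
  qed
  thus False using k by simp
qed

lemma image_two_direction:
  assumes \<Psi>: "Dirac_fixing \<Psi>" and p: "p \<noteq> 2" and ab: "a \<noteq> b" and \<alpha>: "0 < \<alpha>" "\<alpha> < 1"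
  defines "m \<equiv> a + \<alpha> *\<^sub>R (b - a)"
  shows "\<exists>f. f \<noteq> 0 \<and> (AE z in \<Psi> (two \<alpha> a b). \<exists>c. z - m = c *\<^sub>R f) \<and> (\<forall>v. v \<noteq> 0 \<longrightarrow> q v f = q v (b - a))"
proof -
  have \<alpha>': "0 \<le> \<alpha>" "\<alpha> \<le> 1" using \<alpha> by auto
  define \<nu> where "\<nu> = \<Psi> (two \<alpha> a b)"
  have \<nu>: "\<nu> \<in> P" unfolding \<nu>_def by (intro Dirac_fixingD(1)[OF \<Psi>] two_in_P)
  have T: "T \<nu> = T (two \<alpha> a b)" unfolding \<nu>_def by (rule Dirac_fixing_T[OF \<Psi> two_in_P])
  obtain y1 where y1: "y1 \<in> supp \<nu>" using supp_nonempty[OF \<nu>] by auto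
  \<comment> \<open>With a single support point the image would be a Dirac measure, which
    \<open>\<Psi>\<close> already attains at that Dirac measure itself.\<close>
  have "\<exists>y2\<in>supp \<nu>. y1 \<noteq> y2"
  proof (rule ccontr)
    assume "\<not> (\<exists>y2\<in>supp \<nu>. y1 \<noteq> y2)"
    hence "AE x in \<nu>. x = y1" using P_AE_supp[OF \<nu>] by (auto elim!: eventually_mono)
    hence "\<Psi> (two \<alpha> a b) = \<Psi> (return borel y1)"
      using eq_return_iff[OF \<nu>] by (simp add: \<nu>_def Dirac_fixingD(3)[OF \<Psi>])
    hence "two \<alpha> a b = return borel y1"
      using Dirac_fixing_inv(3)[OF \<Psi> two_in_P] Dirac_fixing_inv(3)[OF \<Psi> return_in_P] by metis
    hence "supp (two \<alpha> a b) \<subseteq> {y1}" using supp_subset_closed[of "{y1}" "return borel y1"] AE_return_borel by simp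
    thus False using in_supp_two[OF \<alpha>] ab by blast
  qed
  then obtain y2 where y2: "y2 \<in> supp \<nu>" "y1 \<noteq> y2" by blast
  define f0 where "f0 = y2 - y1"
  have f0: "f0 \<noteq> 0" using y2 by (simp add: f0_def)
  have "AE z in \<nu>. \<exists>c. z - y1 = c *\<^sub>R f0" using P_AE_supp[OF \<nu>]
  proof eventually_elim
    case (elim z)
    show ?case unfolding f0_def
      by (rule image_supp_collinear[OF \<Psi> p ab \<alpha>' y1[unfolded \<nu>_def] y2(1)[unfolded \<nu>_def] y2(2) elim[unfolded \<nu>_def]])
  qed
  from mean_on_line[OF \<nu> T \<alpha>' m_def[THEN meta_eq_to_obj_eq] f0 this]
  have line: "AE z in \<nu>. \<exists>c. z - m = c *\<^sub>R f0" .
  note S = collinear_second_moment[OF \<nu> T \<alpha>' m_def[THEN meta_eq_to_obj_eq] f0 line]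
  define B where "B = (\<integral>z. ((z - m) \<bullet> f0 / (f0 \<bullet> f0))\<^sup>2 \<partial>\<nu>)"
  have aa: "0 < \<alpha> * (1 - \<alpha>)" using \<alpha> by simp
  have eq: "\<alpha> * (1 - \<alpha>) * q v (b - a) = B * q v f0" if "v \<noteq> 0" for v using S(2)[OF that] by (simp add: B_def)
  have "B \<noteq> 0"
  proof
    assume "B = 0"
    hence "\<alpha> * (1 - \<alpha>) * q (b - a) (b - a) = 0" using eq[of "b - a"] ab by simp
    moreover have "0 < \<alpha> * (1 - \<alpha>) * q (b - a) (b - a)" using q_self_pos[of "b - a"] ab by (intro mult_pos_pos[OF aa]) simp
    ultimately show False by linarith
  qed
  moreover have "0 \<le> B" unfolding B_def by (intro Bochner_Integration.integral_nonneg) auto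
  ultimately have B: "0 < B" by simp
  \<comment> \<open>Absorbs the ratio of the second moments, so that \<open>f\<close> gets the same
    Hessian form as \<open>b - a\<close>.\<close>
  define k where "k = B / (\<alpha> * (1 - \<alpha>))"
  have k: "0 < k" using B aa by (simp add: k_def)
  define f where "f = sqrt k *\<^sub>R f0"
  have "f \<noteq> 0" using f0 k by (simp add: f_def)
  moreover have "AE z in \<nu>. \<exists>c. z - m = c *\<^sub>R f" using line
  proof eventually_elim
    case (elim z)
    then obtain c where "z - m = c *\<^sub>R f0" by blast
    hence "z - m = (c / sqrt k) *\<^sub>R f" using k by (simp add: f_def)
    thus ?case by blast
  qed
  moreover have "q v f = q v (b - a)" if "v \<noteq> 0" for v
  proof -
    have "q v f = k * q v f0" unfolding f_def q_scale[OF that] using k by simp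
    also have "\<dots> = (B * q v f0) / (\<alpha> * (1 - \<alpha>))" by (simp add: k_def)
    also have "\<dots> = (\<alpha> * (1 - \<alpha>)) * q v (b - a) / (\<alpha> * (1 - \<alpha>))" by (simp only: eq[OF that])
    also have "\<dots> = q v (b - a)" using aa by (intro nonzero_mult_div_cancel_left) linarith
    finally show ?thesis .
  qed
  ultimately show ?thesis unfolding \<nu>_def by blast
qed

text \<open>In the separable case the law of \<open>t\<close> would agree with its own reflection, which only the weight \<open>1/2\<close> allows.\<close>

lemma two_fixed:
  assumes \<Psi>: "Dirac_fixing \<Psi>" and p: "p \<noteq> 2" and ab: "a \<noteq> b" and \<alpha>: "0 < \<alpha>" "\<alpha> < 1" "\<alpha> \<noteq> 1/2"
  shows "\<Psi> (two \<alpha> a b) = two \<alpha> a b"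
proof -
  have \<alpha>': "0 \<le> \<alpha>" "\<alpha> \<le> 1" using \<alpha> by auto
  define \<nu> where "\<nu> = \<Psi> (two \<alpha> a b)"
  have \<nu>: "\<nu> \<in> P" unfolding \<nu>_def by (intro Dirac_fixingD(1)[OF \<Psi>] two_in_P)
  interpret prob_space \<nu> using PD[OF \<nu>] by simp
  have T: "T \<nu> = T (two \<alpha> a b)" unfolding \<nu>_def by (rule Dirac_fixing_T[OF \<Psi> two_in_P])
  define m where "m = a + \<alpha> *\<^sub>R (b - a)"
  define e where "e = b - a"
  \<comment> \<open>Offset from the mean \<open>m\<close> to the midpoint of \<open>a\<close> and
    \<open>b\<close> in units of \<open>e\<close>; nonzero because the weight is not 1/2.\<close>
  define c0 where "c0 = 1/2 - \<alpha>"
  have c0: "c0 \<noteq> 0" using \<alpha> by (simp add: c0_def)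
  have e0: "e \<noteq> 0" using ab by (simp add: e_def)
  have bm: "b - m = (1 - \<alpha>) *\<^sub>R e" and am: "a - m = (- \<alpha>) *\<^sub>R e" by (auto simp: m_def e_def algebra_simps)
  obtain f where f: "f \<noteq> 0" "AE z in \<nu>. \<exists>c. z - m = c *\<^sub>R f" "\<And>v. v \<noteq> 0 \<Longrightarrow> q v f = q v e"
    using image_two_direction[OF \<Psi> p ab \<alpha>(1,2)] unfolding \<nu>_def m_def e_def by blast
  define t where "t z = ((z - m) \<bullet> f) / (f \<bullet> f)" for z
  note S = collinear_second_moment[OF \<nu> T \<alpha>' m_def f(1,2), folded t_def]
  have tm: "t \<in> borel_measurable borel" unfolding t_def[abs_def] by measurable
  note t\<nu>[measurable] = P_measurable[OF \<nu> tm]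
  have t2: "(\<integral>z. (t z)\<^sup>2 \<partial>\<nu>) = \<alpha> * (1 - \<alpha>)"
    using S(2)[OF e0] f(3)[OF e0] q_self_pos[OF e0] by (simp add: e_def[symmetric])
  have ti: "integrable \<nu> t"
    using P_inner_integrable[OF \<nu>, of f m] unfolding t_def[abs_def] by (simp add: inner_commute)
  \<comment> \<open>Variance \<open>\<alpha> * (1 - \<alpha>)\<close> plus squared offset is 1/4, as
    for points at distance 1/2 from the midpoint. The parameters allow both signs of offset and
    direction.\<close>
  have sq: "integrable \<nu> (\<lambda>z. (r * t z - c)\<^sup>2)" "(\<integral>z. (r * t z - c)\<^sup>2 \<partial>\<nu>) = 1/4" if "c\<^sup>2 = c0\<^sup>2" "r\<^sup>2 = 1" for c r
  proof -
    have x: "(r * t z - c)\<^sup>2 = r\<^sup>2 * (t z)\<^sup>2 - (2 * c * r) * t z + c\<^sup>2" for z by (simp add: power2_eq_square algebra_simps)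
    show "integrable \<nu> (\<lambda>z. (r * t z - c)\<^sup>2)" unfolding x using S(1) ti by auto
    have "(\<integral>z. (r * t z - c)\<^sup>2 \<partial>\<nu>) = \<alpha> * (1 - \<alpha>) + c0\<^sup>2"
      unfolding x using S(1,4) ti t2 that by (simp add: prob_space)
    also have "\<dots> = 1/4" by (simp add: c0_def power2_eq_square algebra_simps)
    finally show "(\<integral>z. (r * t z - c)\<^sup>2 \<partial>\<nu>) = 1/4" .
  qed
  have pi: "integrable \<nu> (\<lambda>z. \<bar>t z - r\<bar> powr p)" for r
  proof (rule Bochner_Integration.integrable_cong_AE_imp)
    show "integrable \<nu> (\<lambda>z. h (z - (m + r *\<^sub>R f)) / h f)" using P_integrable_shift[OF \<nu>, of "m + r *\<^sub>R f"] by simp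
    show "(\<lambda>z. \<bar>t z - r\<bar> powr p) \<in> borel_measurable \<nu>" by measurable
    show "AE z in \<nu>. h (z - (m + r *\<^sub>R f)) / h f = \<bar>t z - r\<bar> powr p" using S(3)
    proof eventually_elim
      case (elim z)
      hence "z - (m + r *\<^sub>R f) = (t z - r) *\<^sub>R f" by (simp add: algebra_simps)
      thus ?case using f(1) by (simp add: h_scale)
    qed
  qed
  have T\<nu>: "T \<nu> (m + x) = (\<integral>z. h (t z *\<^sub>R f - x) \<partial>\<nu>)" for x
    unfolding T_def
  proof (rule integral_cong_AE)
    show "AE z in \<nu>. h (z - (m + x)) = h (t z *\<^sub>R f - x)" using S(3)
    proof eventually_elim
      case (elim z)
      hence "z - (m + x) = t z *\<^sub>R f - x" by (simp add: algebra_simps)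
      thus ?case by (rule arg_cong)
    qed
    show "(\<lambda>z. h (z - (m + x))) \<in> borel_measurable \<nu>" by (rule P_measurable[OF \<nu>]) measurable
  qed measurable
  have T\<mu>: "T (two \<alpha> a b) (m + x) = \<alpha> * h ((1 - \<alpha>) *\<^sub>R e - x) + (1 - \<alpha>) * h ((- \<alpha>) *\<^sub>R e - x)" for x
  proof -
    have "T (two \<alpha> a b) (m + x) = \<alpha> * h (b - (m + x)) + (1 - \<alpha>) * h (a - (m + x))"
      unfolding T_def by (rule integral_two[OF \<alpha>']) measurable
    also have "b - (m + x) = (1 - \<alpha>) *\<^sub>R e - x" using bm by (simp add: algebra_simps)
    also have "a - (m + x) = (- \<alpha>) *\<^sub>R e - x" using am by (simp add: algebra_simps)
    finally show ?thesis .
  qed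
  \<comment> \<open>The p-th moment about \<open>r\<close> of the line coordinate of
    \<open>two \<alpha> a b\<close>; about \<open>c0\<close> both points have distance 1/2.\<close>
  define M where "M r = \<alpha> * \<bar>1 - \<alpha> - r\<bar> powr p + (1 - \<alpha>) * \<bar>- \<alpha> - r\<bar> powr p" for r
  have Mc0: "M c0 = (1/2) powr p" by (simp add: M_def c0_def algebra_simps)
  show ?thesis
  proof (cases "\<exists>c. f = c *\<^sub>R e")
    case True
    then obtain c where c: "f = c *\<^sub>R e" by blast
    have "c\<^sup>2 * q e e = q e e" using f(3)[OF e0] unfolding c q_scale[OF e0] .
    hence c2: "c\<^sup>2 = 1" using q_self_pos[OF e0] by simp
    have ca: "\<bar>c\<bar> = 1" using c2 by (auto simp: power2_eq_1_iff)
    have abs: "\<bar>c * t z - c0\<bar> = \<bar>t z - c * c0\<bar>" for z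
    proof -
      have "c * t z - c0 = c * (t z - c * c0)" using c2 by (simp add: algebra_simps power2_eq_square)
      thus ?thesis using ca by (simp add: abs_mult)
    qed
    have "h e * (\<integral>z. \<bar>c * t z - c0\<bar> powr p \<partial>\<nu>) = T \<nu> (m + c0 *\<^sub>R e)"
    proof -
      have "h (t z *\<^sub>R f - c0 *\<^sub>R e) = h e * \<bar>c * t z - c0\<bar> powr p" for z
        using h_scale[of "c * t z - c0" e] by (simp add: c algebra_simps)
      thus ?thesis unfolding T\<nu> by simp
    qed
    also have "\<dots> = h e * M c0" unfolding T T\<mu> M_def
      using h_scale[of "1 - \<alpha> - c0" e] h_scale[of "- \<alpha> - c0" e] by (simp add: algebra_simps)
    finally have "(\<integral>z. \<bar>c * t z - c0\<bar> powr p \<partial>\<nu>) = (1/2) powr p" using e0 by (simp add: Mc0)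
    moreover have "integrable \<nu> (\<lambda>z. \<bar>c * t z - c0\<bar> powr p)" unfolding abs by (rule pi)
    ultimately have ae: "AE z in \<nu>. \<bar>c * t z - c0\<bar> = 1/2"
      using sq[OF refl c2] by (intro double_well[OF p_gt_1 p])
    have ae2: "AE z in \<nu>. z \<in> {a, b}" using ae S(3)
    proof eventually_elim
      case (elim z)
      have z: "z - m = (c * t z) *\<^sub>R e" using elim by (simp add: c mult.commute)
      have "c * t z = 1 - \<alpha> \<or> c * t z = - \<alpha>" using elim(1) by (auto simp: c0_def abs_if split: if_splits)
      hence "z - m = b - m \<or> z - m = a - m" using z bm am by auto
      thus ?case by auto
    qed
    \<comment> \<open>Once the support is known, the mean determines the weight.\<close>
    have "measure \<nu> {b} = \<alpha>"
    proof -
      have "e \<bullet> (z - a) = (e \<bullet> e) * indicator {b} z" if "z \<in> {a, b}" for z using that ab by (auto simp: e_def)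
      hence "AE z in \<nu>. e \<bullet> (z - a) = (e \<bullet> e) * indicator {b} z" using ae2 by (auto elim!: eventually_mono)
      hence "(\<integral>z. e \<bullet> (z - a) \<partial>\<nu>) = (\<integral>z. (e \<bullet> e) * indicator {b} z \<partial>\<nu>)"
        by (intro integral_cong_AE) (auto intro!: P_measurable[OF \<nu>])
      also have "\<dots> = (e \<bullet> e) * measure \<nu> {b}" by (simp add: PD[OF \<nu>])
      finally have "(e \<bullet> e) * measure \<nu> {b} = (\<integral>z. e \<bullet> (z - a) \<partial>two \<alpha> a b)"
        using mean_eq[OF \<nu> two_in_P T, of e a] by simp
      also have "\<dots> = \<alpha> * (e \<bullet> (b - a)) + (1 - \<alpha>) * (e \<bullet> (a - a))" by (rule integral_two[OF \<alpha>']) measurable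
      also have "\<dots> = (e \<bullet> e) * \<alpha>" by (simp add: e_def)
      finally show ?thesis using e0 by simp
    qed
    from two_eqI[OF \<nu> \<alpha>' ab ae2 this] show ?thesis by (simp add: \<nu>_def)
  next
    case False
    hence np: "f \<noteq> c *\<^sub>R e" for c by blast
    define s where "s = e + f"
    define d where "d = e - f"
    have nz: "s \<noteq> 0" "d \<noteq> 0" using np[of "-1"] np[of 1] by (auto simp: s_def d_def add_eq_0_iff)
    have sep: "h (x *\<^sub>R s + y *\<^sub>R d) = \<bar>x\<bar> powr p * h s + \<bar>y\<bar> powr p * h d" for x y
      unfolding s_def d_def using f(3) by (intro separable e0 np) simp
    have ee: "e = (1/2) *\<^sub>R s + (1/2) *\<^sub>R d" and ff: "f = (1/2) *\<^sub>R s - (1/2) *\<^sub>R d"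
      by (simp_all add: s_def d_def algebra_simps flip: scaleR_add_left)
    define A where "A r = (\<integral>z. \<bar>t z - r\<bar> powr p \<partial>\<nu>)" for r
    have hp: "\<bar>x / 2\<bar> powr p = (1/2) powr p * \<bar>x\<bar> powr p" for x :: real by (simp add: abs_mult powr_divide)
    \<comment> \<open>The next four identities expand the cost seen from \<open>m\<close> shifted
      along \<open>s\<close> or \<open>d\<close>. Since \<open>e\<close> and \<open>f\<close> differ
      in the sign of the \<open>d\<close> coordinate, a shift along \<open>d\<close> gives
      \<open>- r\<close> for \<open>f\<close> where it gives \<open>r\<close> for
      \<open>e\<close>.\<close>
    have f1: "h (x *\<^sub>R f - (r / 2) *\<^sub>R s) = (1/2) powr p * (h s * \<bar>x - r\<bar> powr p + h d * \<bar>x - 0\<bar> powr p)" for x r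
    proof -
      have "x *\<^sub>R f - (r / 2) *\<^sub>R s = ((x - r) / 2) *\<^sub>R s + (- x / 2) *\<^sub>R d"
        by (simp add: ff algebra_simps diff_divide_distrib)
      hence "h (x *\<^sub>R f - (r / 2) *\<^sub>R s) = h (((x - r) / 2) *\<^sub>R s + (- x / 2) *\<^sub>R d)" by (rule arg_cong)
      also have "\<dots> = (1/2) powr p * (h s * \<bar>x - r\<bar> powr p + h d * \<bar>x - 0\<bar> powr p)"
        unfolding sep hp abs_minus_cancel by (simp add: algebra_simps)
      finally show ?thesis .
    qed
    have f2: "h (x *\<^sub>R f - (r / 2) *\<^sub>R d) = (1/2) powr p * (h s * \<bar>x - 0\<bar> powr p + h d * \<bar>x - (- r)\<bar> powr p)" for x r
    proof -
      have "x *\<^sub>R f - (r / 2) *\<^sub>R d = (x / 2) *\<^sub>R s + (- (x + r) / 2) *\<^sub>R d"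
        by (simp add: ff algebra_simps diff_divide_distrib)
      hence "h (x *\<^sub>R f - (r / 2) *\<^sub>R d) = h ((x / 2) *\<^sub>R s + (- (x + r) / 2) *\<^sub>R d)" by (rule arg_cong)
      also have "\<dots> = (1/2) powr p * (h s * \<bar>x - 0\<bar> powr p + h d * \<bar>x - (- r)\<bar> powr p)"
        unfolding sep hp abs_minus_cancel by (simp add: algebra_simps)
      finally show ?thesis .
    qed
    have e1: "h (x *\<^sub>R e - (r / 2) *\<^sub>R s) = (1/2) powr p * (h s * \<bar>x - r\<bar> powr p + h d * \<bar>x - 0\<bar> powr p)" for x r
    proof -
      have "x *\<^sub>R e - (r / 2) *\<^sub>R s = ((x - r) / 2) *\<^sub>R s + (x / 2) *\<^sub>R d"
        by (simp add: ee algebra_simps diff_divide_distrib)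
      hence "h (x *\<^sub>R e - (r / 2) *\<^sub>R s) = h (((x - r) / 2) *\<^sub>R s + (x / 2) *\<^sub>R d)" by (rule arg_cong)
      also have "\<dots> = (1/2) powr p * (h s * \<bar>x - r\<bar> powr p + h d * \<bar>x - 0\<bar> powr p)"
        unfolding sep hp by (simp add: algebra_simps)
      finally show ?thesis .
    qed
    have e2: "h (x *\<^sub>R e - (r / 2) *\<^sub>R d) = (1/2) powr p * (h s * \<bar>x - 0\<bar> powr p + h d * \<bar>x - r\<bar> powr p)" for x r
    proof -
      have "x *\<^sub>R e - (r / 2) *\<^sub>R d = (x / 2) *\<^sub>R s + ((x - r) / 2) *\<^sub>R d"
        by (simp add: ee algebra_simps diff_divide_distrib)
      hence "h (x *\<^sub>R e - (r / 2) *\<^sub>R d) = h ((x / 2) *\<^sub>R s + ((x - r) / 2) *\<^sub>R d)" by (rule arg_cong)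
      also have "\<dots> = (1/2) powr p * (h s * \<bar>x - 0\<bar> powr p + h d * \<bar>x - r\<bar> powr p)"
        unfolding sep hp by (simp add: algebra_simps)
      finally show ?thesis .
    qed
    have T1: "h s * A r + h d * A 0 = h s * M r + h d * M 0" for r
    proof -
      have "(1/2) powr p * (h s * A r + h d * A 0) = T \<nu> (m + (r / 2) *\<^sub>R s)"
        unfolding T\<nu> f1 A_def using pi[of r] pi[of 0] by simp
      also have "\<dots> = (1/2) powr p * (h s * M r + h d * M 0)"
        unfolding T T\<mu> e1 M_def by (simp add: algebra_simps)
      finally show ?thesis by simp
    qed
    have T2: "h s * A 0 + h d * A (- r) = h s * M 0 + h d * M r" for r
    proof -
      have "(1/2) powr p * (h s * A 0 + h d * A (- r)) = T \<nu> (m + (r / 2) *\<^sub>R d)"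
        unfolding T\<nu> f2 A_def using pi[of "- r"] pi[of 0] by simp
      also have "\<dots> = (1/2) powr p * (h s * M 0 + h d * M r)"
        unfolding T T\<mu> e2 M_def by (simp add: algebra_simps)
      finally show ?thesis by simp
    qed
    \<comment> \<open>The moments about the mean agree first; then \<open>T1\<close> and
      \<open>T2\<close> with \<open>r = c0\<close> give \<open>A\<close> the value
      \<open>M c0\<close> at \<open>c0\<close> and also at \<open>- c0\<close>.\<close>
    have "(h s + h d) * A 0 = (h s + h d) * M 0" using T1[of 0] by (simp add: algebra_simps)
    moreover have hsd: "0 < h s" "0 < h d" using nz by auto
    ultimately have A0: "A 0 = M 0" by simp
    have dw: "AE z in \<nu>. \<bar>t z - c\<bar> = 1/2" if "A c = (1/2) powr p" "c\<^sup>2 = c0\<^sup>2" for c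
      using sq[OF that(2), of 1] that(1) by (intro double_well[OF p_gt_1 p pi]) (simp_all add: A_def)
    have "A c0 = (1/2) powr p" "A (- c0) = (1/2) powr p"
      using T1[of c0] T2[of c0] A0 hsd by (auto simp: Mc0)
    \<comment> \<open>Distance 1/2 from both \<open>c0\<close> and \<open>- c0\<close> leaves only
      \<open>t z = 0\<close>, against the positive variance.\<close>
    hence "AE z in \<nu>. \<bar>t z - c0\<bar> = 1/2" "AE z in \<nu>. \<bar>t z - (- c0)\<bar> = 1/2" by (intro dw; simp)+
    hence "AE z in \<nu>. (t z)\<^sup>2 = 0"
    proof eventually_elim
      case (elim z)
      have "\<bar>t z - c0\<bar>\<^sup>2 = \<bar>t z - (- c0)\<bar>\<^sup>2" by (simp only: elim)
      hence "4 * (t z * c0) = 0" by (simp add: power2_eq_square algebra_simps)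
      thus ?case using c0 by simp
    qed
    hence "(\<integral>z. (t z)\<^sup>2 \<partial>\<nu>) = (\<integral>z. 0 \<partial>\<nu>)" by (intro integral_cong_AE) auto
    thus ?thesis using t2 \<alpha> by simp
  qed
qed

lemma identity_p_gt_1:
  assumes "Dirac_fixing \<Psi>" "p \<noteq> 2" "\<mu> \<in> P" shows "\<Psi> \<mu> = \<mu>"
  using identity_if_two_fixed[OF p_gt_1 Dirac_fixingD(4,3)[OF assms(1)] two_fixed[OF assms(1,2)] assms(3)] by blast

end

theorem theorem1p1:
  fixes N :: "real ^ 'n \<Rightarrow> real" and p :: real
  assumes "is_norm N"
    and "strictly_convex_norm N"
    and "C2_smooth_norm N"
    and "1 \<le> p" and "p \<noteq> 2"
  shows "isometrically_rigid p UNIV (norm_dist N)"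
proof -
  interpret smooth_cost N p using assms by unfold_locales auto
  show ?thesis
  proof (rule rigid_if_Dirac_fixing_trivial)
    fix \<Psi> \<mu> assume "cost_isometry \<Psi>" "\<And>x. \<Psi> (return borel x) = return borel x" and \<mu>: "\<mu> \<in> P"
    hence \<Psi>: "Dirac_fixing \<Psi>" by (simp add: Dirac_fixing_def)
    show "\<Psi> \<mu> = \<mu>"
    proof (cases "p = 1")
      case True thus ?thesis by (rule identity_p1[OF _ \<Psi> \<mu>])
    next
      case False
      then interpret smooth_power_cost N p using assms by unfold_locales auto
      show ?thesis by (rule identity_p_gt_1[OF \<Psi> assms(5) \<mu>])
    qed
  qed
qed

end
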